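(* Let $l>0$ and $v^*\in[0,1]$ be such that $f(u)=v^*r(u)-lu$ (with $r(u)=e^{-1/u}$ for $u>0$ and $r(u)=0$ for $u\le 0$) has exactly three roots $0<u_1<u_2$. Let $\alpha\neq\beta$ be real numbers and let $w(z)=\alpha$ for $z<0$, $w(0)=0$, $w(z)=\beta$ for $z>0$. Let $c\in\mathbb{R}$ and suppose that the unstable manifold of the fixed point $(0,0)$ of $$u'=s,\qquad s'=-(c-\alpha)s-f(u)$$ intersects the stable manifold of the fixed point $(u_2,0)$ of $$u'=s,\qquad s'=-(c-\beta)s-f(u)$$ at a point of the $(u,s)$-plane, and let $\hat u$ be the corresponding front, i.e. the $C^1$ function on $\mathbb{R}$ such that $(\hat u(0),\hat u'(0))$ is the intersection point, $(\hat u,\hat u')$ solves the first system for $z<0$ and the second system for $z>0$, $\hat u(z)\to0$ as $z\to-\infty$ and $\hat u(z)\to u_2$ as $z\to+\infty$. (i) If $\alpha>\beta$ (a type 1 intersection), then the front $\hat u$ is stable. (ii) If $\alpha<\beta$ (a type 2 intersection), then the front $\hat u$ is unstable.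
   Context: The underlying PDE, in the moving coordinate $z=x-ct$, is $$\frac{\partial u}{\partial t}=\frac{\partial^2u}{\partial z^2}+(c-w(z))\frac{\partial u}{\partial z}+f(u),$$ of which $\hat u$ is a stationary solution. Linearizing about $\hat u$ gives the eigenvalue problem $$\omega p=\mathcal{L}p:=p_{zz}+(c-w(z))p_z+f'(\hat u)p,$$ where $f'(u)=\frac{v^*}{u^2}e^{-1/u}-l$ for $u>0$ and $f'(u)=-l$ for $u\le0$. A number $\omega$ is an eigenvalue if there is a nonzero $p\in H^2(\mathbb{R})$ (so that $p$ and $p_z$ are continuous across $z=0$) with $\mathcal{L}p=\omega p$. The front $\hat u$ is called stable if $\mathcal{L}$ has no eigenvalue $\omega$ in the right half-plane $\{\operatorname{Re}\omega>0\}$, and unstable if $\mathcal{L}$ has at least one eigenvalue in $\{\operatorname{Re}\omega>0\}$. *)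

theory Defs
  imports "HOL-Analysis.Analysis"
begin

definition activation :: "real \<Rightarrow> real" where
  "activation u = (if u > 0 then exp (- 1 / u) else 0)"

definition reaction :: "real \<Rightarrow> real \<Rightarrow> real \<Rightarrow> real" where
  "reaction v l u = v * activation u - l * u"

definition reaction_deriv :: "real \<Rightarrow> real \<Rightarrow> real \<Rightarrow> real" where
  "reaction_deriv v l u = (if u > 0 then v / u\<^sup>2 * exp (- 1 / u) - l else - l)"


definition wind :: "real \<Rightarrow> real \<Rightarrow> real \<Rightarrow> real" where
  "wind \<alpha> \<beta> z = (if z < 0 then \<alpha> else if z = 0 then 0 else \<beta>)"


definition phase_field :: "real \<Rightarrow> real \<Rightarrow> real \<Rightarrow> real \<Rightarrow> real \<times> real \<Rightarrow> real \<times> real" where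
  "phase_field v l c a = (\<lambda>(u, s). (s, - (c - a) * s - reaction v l u))"

definition solves_on :: "('a::real_normed_vector \<Rightarrow> 'a) \<Rightarrow> (real \<Rightarrow> 'a) \<Rightarrow> real set \<Rightarrow> bool" where
  "solves_on F \<phi> I \<longleftrightarrow> (\<forall>z\<in>I. (\<phi> has_vector_derivative F (\<phi> z)) (at z within I))"

definition unstable_manifold :: "('a::real_normed_vector \<Rightarrow> 'a) \<Rightarrow> 'a \<Rightarrow> 'a set" where
  "unstable_manifold F q = {\<phi> 0 |\<phi>. solves_on F \<phi> {..0} \<and> (\<phi> \<longlongrightarrow> q) at_bot}"

definition stable_manifold :: "('a::real_normed_vector \<Rightarrow> 'a) \<Rightarrow> 'a \<Rightarrow> 'a set" where
  "stable_manifold F q = {\<phi> 0 |\<phi>. solves_on F \<phi> {0..} \<and> (\<phi> \<longlongrightarrow> q) at_top}"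

definition is_front ::
  "real \<Rightarrow> real \<Rightarrow> real \<Rightarrow> real \<Rightarrow> real \<Rightarrow> real \<Rightarrow> real \<times> real \<Rightarrow> (real \<Rightarrow> real) \<Rightarrow> bool" where
  "is_front v l \<alpha> \<beta> c u\<^sub>2 P U \<longleftrightarrow>
     U C1_differentiable_on UNIV \<and>
     (U 0, deriv U 0) = P \<and>
     solves_on (phase_field v l c \<alpha>) (\<lambda>z. (U z, deriv U z)) {..<0} \<and>
     solves_on (phase_field v l c \<beta>) (\<lambda>z. (U z, deriv U z)) {0<..} \<and>
     (U \<longlongrightarrow> 0) at_bot \<and> (U \<longlongrightarrow> u\<^sub>2) at_top"


(* Functions in L2 and H2 are only determined up to null sets, so membership is
   stated for representatives, and weak derivatives are taken in the sense of
   distributions on the real line. *)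

definition test_function :: "(real \<Rightarrow> real) \<Rightarrow> bool" where
  "test_function \<phi> \<longleftrightarrow>
     (\<forall>n x. (deriv ^^ n) \<phi> differentiable at x) \<and> compact (closure {x. \<phi> x \<noteq> 0})"

definition weak_derivative :: "(real \<Rightarrow> complex) \<Rightarrow> (real \<Rightarrow> complex) \<Rightarrow> bool" where
  "weak_derivative p q \<longleftrightarrow>
     (\<forall>a b. set_integrable lborel {a..b} p) \<and>
     (\<forall>a b. set_integrable lborel {a..b} q) \<and>
     (\<forall>\<phi>. test_function \<phi> \<longrightarrow>
        (LINT x|lborel. deriv \<phi> x *\<^sub>R p x) = - (LINT x|lborel. \<phi> x *\<^sub>R q x))"

definition square_integrable :: "(real \<Rightarrow> complex) \<Rightarrow> bool" where
  "square_integrable p \<longleftrightarrow>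
     p \<in> borel_measurable lborel \<and> integrable lborel (\<lambda>x. (cmod (p x))\<^sup>2)"

text \<open>\<open>H2_derivs p p\<^sub>z p\<^sub>z\<^sub>z\<close>: the function \<open>p\<close> is in $H^2(\mathbf{R})$, with weak
  derivatives \<open>p\<^sub>z\<close> and \<open>p\<^sub>z\<^sub>z\<close> (which are unique up to null sets).\<close>

definition H2_derivs ::
  "(real \<Rightarrow> complex) \<Rightarrow> (real \<Rightarrow> complex) \<Rightarrow> (real \<Rightarrow> complex) \<Rightarrow> bool" where
  "H2_derivs p p\<^sub>z p\<^sub>z\<^sub>z \<longleftrightarrow>
     square_integrable p \<and> square_integrable p\<^sub>z \<and> square_integrable p\<^sub>z\<^sub>z \<and>
     weak_derivative p p\<^sub>z \<and> weak_derivative p\<^sub>z p\<^sub>z\<^sub>z"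

text \<open>Nonzero and the eigenvalue equation are meant in $L^2$, that is, almost everywhere.\<close>

definition is_eigenvalue ::
  "real \<Rightarrow> real \<Rightarrow> real \<Rightarrow> real \<Rightarrow> real \<Rightarrow> (real \<Rightarrow> real) \<Rightarrow> complex \<Rightarrow> bool" where
  "is_eigenvalue v l \<alpha> \<beta> c U \<omega> \<longleftrightarrow>
     (\<exists>p p\<^sub>z p\<^sub>z\<^sub>z. H2_derivs p p\<^sub>z p\<^sub>z\<^sub>z \<and> \<not> (AE z in lborel. p z = 0) \<and>
        (AE z in lborel.
           p\<^sub>z\<^sub>z z + of_real (c - wind \<alpha> \<beta> z) * p\<^sub>z z + of_real (reaction_deriv v l (U z)) * p z
             = \<omega> * p z))"

definition front_stable ::
  "real \<Rightarrow> real \<Rightarrow> real \<Rightarrow> real \<Rightarrow> real \<Rightarrow> (real \<Rightarrow> real) \<Rightarrow> bool" where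
  "front_stable v l \<alpha> \<beta> c U \<longleftrightarrow> \<not> (\<exists>\<omega>. is_eigenvalue v l \<alpha> \<beta> c U \<omega> \<and> Re \<omega> > 0)"

definition front_unstable ::
  "real \<Rightarrow> real \<Rightarrow> real \<Rightarrow> real \<Rightarrow> real \<Rightarrow> (real \<Rightarrow> real) \<Rightarrow> bool" where
  "front_unstable v l \<alpha> \<beta> c U \<longleftrightarrow> (\<exists>\<omega>. is_eigenvalue v l \<alpha> \<beta> c U \<omega> \<and> Re \<omega> > 0)"

end

theory Submission
  imports Defs
begin

text \<open>Put \<open>A = c - \<alpha>\<close>, \<open>B = c - \<beta>\<close> and \<open>q = U'\<close>. Away from 0 the function \<open>q\<close> solves the linearized
  equation with \<open>\<omega> = 0\<close>, while \<open>q'\<close> jumps by \<open>(A - B) * q 0\<close> at 0.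

  If \<open>A < B\<close>, the energy \<open>q\<^sup>2 / 2 + F U\<close>, where \<open>F\<close> is a primitive of the reaction, stays above its limit
  at \<open>-\<infinity>\<close> or above its limit at \<open>+\<infinity>\<close>. This forces \<open>q > 0\<close>, so \<open>q\<close> is a positive supersolution, and
  comparing the modulus of an eigenfunction with a multiple of \<open>q\<close> excludes \<open>Re \<omega> > 0\<close>.

  If \<open>B < A\<close>, consider the set of all \<open>\<omega> \<ge> 0\<close> for which some nontrivial solution of the eigenvalue equation
  has two zeros. It is bounded and relatively open, and the jump of \<open>q'\<close> shows that it contains 0, even when \<open>q\<close>
  changes sign. At its supremum, a limit of solutions that are normalized between two zeros is a bounded positive
  solution on the whole line. It decays and hence is an eigenfunction.\<close>

section \<open>Calculus and linear systems of differential equations\<close>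

text \<open>The operator is symmetric only in L^2 with weight \<open>weight A B\<close>, which may
  be unbounded at either end, whereas eigenfunctions lie in unweighted L^2. Symmetry therefore does
  not dispose of complex \<open>\<omega>\<close>: stability rests on a maximum principle for moduli,
  instability on zeros of real solutions. Both halves depend on the sign of the jump of
  \<open>q'\<close>. If \<open>A < B\<close>, a positive \<open>q\<close> has a concave kink at 0,
  as a supersolution should. If \<open>B < A\<close>, continue \<open>q\<close> from each half-line
  as a genuine solution. A continuation with a zero is bounded at its own end, which already yields
  two zeros of some solution. If neither vanishes, then, after a common change of sign, the right
  one has the smallest logarithmic derivative at 0 among eventually positive solutions, and the jump
  contradicts this. Being relatively open, the set of \<open>\<omega>\<close> contains 0 but not its
  supremum, which is thus positive. Normalized maxima stay in \<open>{- R..R}\<close> since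
  \<open>g < \<omega>\<close> outside; this is the compactness behind the limit. Derivatives are
  allowed to fail at 0, where the weight and \<open>q\<close> have kinks.\<close>

lemma nondecreasing_off_zero:
  fixes f f' :: "real \<Rightarrow> real"
  assumes "a \<le> b" and cont: "continuous_on {a..b} f"
    and der: "\<And>x. a < x \<Longrightarrow> x < b \<Longrightarrow> x \<noteq> 0 \<Longrightarrow> (f has_real_derivative f' x) (at x)"
    and nonneg: "\<And>x. a < x \<Longrightarrow> x < b \<Longrightarrow> x \<noteq> 0 \<Longrightarrow> 0 \<le> f' x"
  shows "f a \<le> f b"
proof (cases "a < 0 \<and> 0 < b")
  case False
  show ?thesis
  proof (rule DERIV_nonneg_imp_increasing_open[OF \<open>a \<le> b\<close> _ cont])
    fix x assume "a < x" "x < b"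
    with False have "x \<noteq> 0" by auto
    thus "\<exists>y. DERIV f x :> y \<and> 0 \<le> y"
      using der nonneg \<open>a < x\<close> \<open>x < b\<close> by blast
  qed
next
  case True
  have *: "f u \<le> f v" if "a \<le> u" "u \<le> v" "v \<le> b" "0 \<notin> {u<..<v}" for u v
  proof (rule DERIV_nonneg_imp_increasing_open[OF \<open>u \<le> v\<close>])
    show "continuous_on {u..v} f"
      using that by (intro continuous_on_subset[OF cont]) auto
    fix x assume x: "u < x" "x < v"
    with that have "x \<noteq> 0" "a < x" "x < b" by auto
    thus "\<exists>y. DERIV f x :> y \<and> 0 \<le> y"
      using der nonneg by blast
  qed
  have "f a \<le> f 0" using True by (intro *) auto
  also have "f 0 \<le> f b" using True by (intro *) auto
  finally show ?thesis .
qed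

text \<open>\<open>f + N / M\<close> times the integrating factor \<open>exp (- M * (x - a))\<close>
  is nonincreasing; \<open>h\<close> below is its negative, so that the monotonicity lemma
  applies.\<close>

lemma gronwall_forward:
  fixes f f' :: "real \<Rightarrow> real"
  assumes "a \<le> b" and cont: "continuous_on {a..b} f" and "M > 0"
    and der: "\<And>x. a < x \<Longrightarrow> x < b \<Longrightarrow> x \<noteq> 0 \<Longrightarrow> (f has_real_derivative f' x) (at x)"
    and bound: "\<And>x. a < x \<Longrightarrow> x < b \<Longrightarrow> x \<noteq> 0 \<Longrightarrow> f' x \<le> M * f x + N"
  shows "f b \<le> (f a + N / M) * exp (M * (b - a)) - N / M"
proof -
  define h where "h x = - (f x + N / M) * exp (- M * (x - a))" for x
  have "h a \<le> h b"
  proof (rule nondecreasing_off_zero[OF \<open>a \<le> b\<close>])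
    show "continuous_on {a..b} h"
      unfolding h_def by (intro continuous_intros cont)
    fix x assume x: "a < x" "x < b" "x \<noteq> 0"
    show "(h has_real_derivative (M * f x + N - f' x) * exp (- M * (x - a))) (at x)"
      unfolding h_def using \<open>M > 0\<close>
      by (auto intro!: derivative_eq_intros der[OF x] simp: field_simps)
    show "0 \<le> (M * f x + N - f' x) * exp (- M * (x - a))"
      using bound[OF x] by simp
  qed
  hence "(f b + N / M) * exp (- (M * (b - a))) \<le> f a + N / M"
    by (simp add: h_def algebra_simps)
  hence "(f b + N / M) * exp (- (M * (b - a))) * exp (M * (b - a)) \<le> (f a + N / M) * exp (M * (b - a))"
    by (intro mult_right_mono) auto
  thus ?thesis by (simp add: mult.assoc exp_add[symmetric])
qed

text \<open>The bound on the absolute value of \<open>f'\<close> survives reversal of the axis, and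
  the reflection fixes the exceptional point 0, so the forward estimate also serves for
  \<open>y < x\<close>.\<close>

lemma gronwall_off_zero:
  fixes f f' :: "real \<Rightarrow> real"
  assumes cont: "continuous_on {a..b} f" and "M > 0" and N: "N \<ge> 0"
    and der: "\<And>x. a < x \<Longrightarrow> x < b \<Longrightarrow> x \<noteq> 0 \<Longrightarrow> (f has_real_derivative f' x) (at x)"
    and bound: "\<And>x. a < x \<Longrightarrow> x < b \<Longrightarrow> x \<noteq> 0 \<Longrightarrow> \<bar>f' x\<bar> \<le> M * f x + N"
    and x: "x \<in> {a..b}" and y: "y \<in> {a..b}"
  shows "f y \<le> (f x + N / M) * exp (M * \<bar>y - x\<bar>) - N / M"
proof (cases "x \<le> y")
  case True
  have "f y \<le> (f x + N / M) * exp (M * (y - x)) - N / M"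
    using x y bound
    by (intro gronwall_forward[OF True _ \<open>M > 0\<close>, where f' = f'] continuous_on_subset[OF cont] der)
       (auto simp: abs_le_iff)
  thus ?thesis using True by simp
next
  case False
  define g where "g u = f (- u)" for u
  have "g (- y) \<le> (g (- x) + N / M) * exp (M * (- y - (- x))) - N / M"
  proof (rule gronwall_forward[OF _ _ \<open>M > 0\<close>, where f' = "\<lambda>u. - f' (- u)"])
    show "- x \<le> - y" using False by simp
    show "continuous_on {- x..- y} g" unfolding g_def
      using x y by (intro continuous_on_compose2[OF cont] continuous_intros) auto
    fix u assume u: "- x < u" "u < - y" "u \<noteq> 0"
    have "(f has_real_derivative f' (- u)) (at (- u))"
      using u x y by (intro der) auto
    thus "(g has_real_derivative - f' (- u)) (at u)"
      unfolding g_def by (simp add: DERIV_mirror)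
    show "- f' (- u) \<le> M * g u + N"
      using bound[of "- u"] u x y by (auto simp: g_def abs_le_iff)
  qed
  thus ?thesis using False by (simp add: g_def)
qed

lemma continuous_antiderivative:
  fixes f :: "real \<Rightarrow> 'a::euclidean_space"
  assumes "continuous_on UNIV f"
  shows "\<exists>F. \<forall>x. (F has_vector_derivative f x) (at x)"
proof -
  have "\<exists>F. \<forall>x :: real. (-\<infinity>::ereal) < x \<longrightarrow> x < (\<infinity>::ereal) \<longrightarrow> (F has_vector_derivative f x) (at x)"
    using assms by (intro einterval_antiderivative) (auto simp: continuous_on_eq_continuous_at)
  thus ?thesis by simp
qed

lemma antiderivative_vanishing_at:
  fixes f :: "real \<Rightarrow> real"
  assumes "continuous_on UNIV f"
  shows "\<exists>F. (\<forall>x. (F has_real_derivative f x) (at x)) \<and> F x0 = 0"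
proof -
  obtain F where F: "\<And>x. (F has_real_derivative f x) (at x)"
    using continuous_antiderivative[OF assms] by (auto simp: has_real_derivative_iff_has_vector_derivative)
  show ?thesis
    by (rule exI[of _ "\<lambda>x. F x - F x0"]) (auto intro!: derivative_eq_intros F)
qed

lemma continuous_bounded_Icc:
  fixes f :: "real \<Rightarrow> 'a::real_normed_vector"
  assumes "continuous_on {a..b} f"
  shows "\<exists>C. \<forall>x\<in>{a..b}. norm (f x) \<le> C"
  using compact_imp_bounded[OF compact_continuous_image[OF assms compact_Icc]] by (auto simp: bounded_iff)

text \<open>One Picard step: integrating a bound with weight
  \<open>exp (m * \<bar>x - x0\<bar>)\<close> reproduces the weight and gains the factor
  \<open>1 / m\<close>.\<close>

lemma exp_growth_bound:
  fixes f f' :: "real \<Rightarrow> real"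
  assumes "f x0 = 0" and "m > 0" and "D \<ge> 0"
    and der: "\<And>x. (f has_real_derivative f' x) (at x)"
    and bound: "\<And>x. \<bar>x - x0\<bar> \<le> L \<Longrightarrow> \<bar>f' x\<bar> \<le> D * exp (m * \<bar>x - x0\<bar>)"
    and x: "\<bar>x - x0\<bar> \<le> L"
  shows "\<bar>f x\<bar> \<le> D / m * exp (m * \<bar>x - x0\<bar>)"
proof -
  \<comment> \<open>The signs \<open>\<sigma>\<close> and \<open>\<tau>\<close> treat both bounds on
    \<open>f\<close> and both directions from \<open>x0\<close> at once.\<close>
  have *: "\<sigma> * f (x0 + \<tau> * y) \<le> D / m * exp (m * y)"
    if st: "\<bar>\<sigma>\<bar> = 1" "\<bar>\<tau>\<bar> = 1" and y: "0 \<le> y" "y \<le> L" for \<sigma> \<tau> y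
  proof -
    define k where "k y = D / m * exp (m * y) - \<sigma> * f (x0 + \<tau> * y)" for y
    have d: "(k has_real_derivative (D * exp (m * z) - \<sigma> * (f' (x0 + \<tau> * z) * \<tau>))) (at z)" for z
      unfolding k_def using \<open>m > 0\<close> by (auto intro!: derivative_eq_intros DERIV_chain2[OF der])
    have "k 0 \<le> k y"
    proof (rule nondecreasing_off_zero[OF y(1)])
      show "continuous_on {0..y} k"
        by (intro continuous_at_imp_continuous_on ballI DERIV_isCont[OF d])
      show "0 \<le> D * exp (m * z) - \<sigma> * (f' (x0 + \<tau> * z) * \<tau>)" if "0 < z" "z < y" for z
      proof -
        have "\<bar>\<tau> * z\<bar> = z" "\<bar>\<sigma> * (f' (x0 + \<tau> * z) * \<tau>)\<bar> = \<bar>f' (x0 + \<tau> * z)\<bar>"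
          using st that by (simp_all add: abs_mult)
        thus ?thesis using bound[of "x0 + \<tau> * z"] that y by simp
      qed
    qed (rule d)
    moreover have "k 0 \<ge> 0" using assms(1-3) by (simp add: k_def)
    ultimately show ?thesis by (simp add: k_def)
  qed
  define \<tau> :: real where "\<tau> = (if x0 \<le> x then 1 else - 1)"
  have "x0 + \<tau> * \<bar>x - x0\<bar> = x" "\<bar>\<tau>\<bar> = 1" by (auto simp: \<tau>_def)
  thus ?thesis using *[of 1 \<tau> "\<bar>x - x0\<bar>"] *[of "- 1" \<tau> "\<bar>x - x0\<bar>"] x by (auto simp: abs_le_iff)
qed

text \<open>Picard iteration; the iterates are controlled by the weight
  \<open>exp (2 * M * \<bar>x - x0\<bar>)\<close>, for which each step gains a factor \<open>1/2\<close>.\<close>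

lemma linear_system_exists:
  fixes c :: "bool \<Rightarrow> real \<Rightarrow> real"
  assumes c: "\<And>i. continuous_on UNIV (c i)"
  shows "\<exists>y. (\<forall>i x. (y i has_real_derivative c i x * y (\<not> i) x) (at x)) \<and> (\<forall>i. y i x0 = Y i)"
proof -
  define prim where "prim f = (SOME F. (\<forall>x. (F has_real_derivative f x) (at x)) \<and> F x0 = 0)" for f :: "real \<Rightarrow> real"
  have prim: "(prim f has_real_derivative f x) (at x)" "prim f x0 = 0" if "continuous_on UNIV f" for f x
    using someI_ex[OF antiderivative_vanishing_at[OF that, of x0], folded prim_def] by auto
  \<comment> \<open>\<open>W n\<close> is the n-th term of the series of iterated integrals, that
    is, the difference of consecutive Picard iterates, so the solution is the sum of the
    series.\<close>
  define W :: "nat \<Rightarrow> bool \<Rightarrow> real \<Rightarrow> real" where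
    "W = rec_nat (\<lambda>i _. Y i) (\<lambda>_ w i. prim (\<lambda>x. c i x * w (\<not> i) x))"
  have W0: "W 0 i = (\<lambda>_. Y i)" and WS: "W (Suc n) i = prim (\<lambda>x. c i x * W n (\<not> i) x)" for n i
    by (simp_all add: W_def)
  have Wc: "continuous_on UNIV (W n i)" for n i
  proof (induction n arbitrary: i)
    case (Suc n)
    show ?case unfolding WS
      by (intro continuous_at_imp_continuous_on ballI DERIV_isCont[OF prim(1)] continuous_intros c Suc)
  qed (simp add: W0)
  have d: "(W (Suc n) i has_real_derivative c i x * W n (\<not> i) x) (at x)" "W (Suc n) i x0 = 0" for n i x
    unfolding WS by (intro prim continuous_intros c Wc)+
  define W' where "W' n i x = (case n of 0 \<Rightarrow> 0 | Suc k \<Rightarrow> c i x * W k (\<not> i) x)" for n i x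
  have der: "(W n i has_real_derivative W' n i x) (at x)" for n i x
    by (cases n) (simp_all add: W0 d W'_def)
  define C where "C = \<bar>Y True\<bar> + \<bar>Y False\<bar>"
  have main: "summable (\<lambda>n. W n i x) \<and> ((\<lambda>x. \<Sum>n. W n i x) has_real_derivative (\<Sum>n. W' n i x)) (at x)" for x i
  proof -
    \<comment> \<open>The extra 1 puts \<open>x\<close> in the interior of the ball on which the
      series is differentiated term by term.\<close>
    define L where "L = \<bar>x - x0\<bar> + 1"
    have "\<exists>K. \<forall>y\<in>{x0 - L..x0 + L}. norm (c i y) \<le> K" for i
      using c by (intro continuous_bounded_Icc) (auto intro: continuous_on_subset)
    then obtain K where K: "\<And>i y. y \<in> {x0 - L..x0 + L} \<Longrightarrow> \<bar>c i y\<bar> \<le> K i"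
      by (metis real_norm_def)
    define M where "M = max 1 (max (K True) (K False))"
    have M1: "M > 0" by (simp add: M_def)
    have KM: "K i \<le> M" for i by (cases i) (simp_all add: M_def)
    have M: "\<bar>c i y\<bar> \<le> M" if "\<bar>y - x0\<bar> \<le> L" for i y
      using that by (intro order_trans[OF K KM]) (auto simp: abs_le_iff)
    have bnd: "\<bar>y - x0\<bar> \<le> L \<Longrightarrow> \<bar>W n i y\<bar> \<le> C * (1/2)^n * exp (2 * M * \<bar>y - x0\<bar>)" for n i y
    proof (induction n arbitrary: i y)
      case 0
      have "C * 1 \<le> C * exp (2 * M * \<bar>y - x0\<bar>)"
        using M1 by (intro mult_left_mono) (auto simp: C_def)
      thus ?case by (cases i) (auto simp: W0 C_def)
    next
      case (Suc n)
      have "\<bar>W (Suc n) i y\<bar> \<le> M * (C * (1/2)^n) / (2 * M) * exp (2 * M * \<bar>y - x0\<bar>)"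
      proof (rule exp_growth_bound[OF d(2) _ _ d(1) _ Suc.prems])
        fix u assume u: "\<bar>u - x0\<bar> \<le> L"
        have "\<bar>c i u * W n (\<not> i) u\<bar> \<le> M * (C * (1/2)^n * exp (2 * M * \<bar>u - x0\<bar>))"
          unfolding abs_mult using Suc.IH[OF u] M[OF u] M1 by (intro mult_mono) auto
        thus "\<bar>c i u * W n (\<not> i) u\<bar> \<le> M * (C * (1/2)^n) * exp (2 * M * \<bar>u - x0\<bar>)"
          by (simp add: mult.assoc)
      qed (use M1 in \<open>auto simp: C_def\<close>)
      thus ?case using M1 by simp
    qed
    define H where "H = C * exp (2 * M * L)"
    have H: "\<bar>W n i y\<bar> \<le> H * (1/2)^n" if "\<bar>y - x0\<bar> \<le> L" for n i y
    proof -
      have "C * (1/2)^n * exp (2 * M * \<bar>y - x0\<bar>) \<le> C * (1/2)^n * exp (2 * M * L)"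
        using that M1 by (intro mult_left_mono) (auto simp: C_def)
      thus ?thesis using bnd[OF that, of n i] by (auto simp: H_def mult_ac)
    qed
    have H0: "H \<ge> 0" by (simp add: H_def C_def)
    have H': "\<bar>W' n i y\<bar> \<le> 2 * M * H * (1/2)^n" if "\<bar>y - x0\<bar> \<le> L" for n y
    proof -
      have "\<bar>c i y * W k (\<not> i) y\<bar> \<le> M * (H * (1/2)^k)" for k
        unfolding abs_mult using H[OF that] M[OF that] M1 by (auto intro!: mult_mono)
      thus ?thesis using M1 H0 by (auto simp: W'_def split: nat.split)
    qed
    have geo: "summable (\<lambda>n. k * (1/2)^n)" for k :: real
      by (intro summable_mult summable_geometric) auto
    have xL: "x \<in> interior (cball x0 L)" "x0 \<in> cball x0 L"
      by (auto simp: L_def dist_real_def abs_minus_commute)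
    have uc: "uniformly_convergent_on (cball x0 L) (\<lambda>n y. \<Sum>k<n. W' k i y)"
      by (rule Weierstrass_m_test'[OF _ geo[of "2 * M * H"]])
         (use H' in \<open>force simp: dist_real_def abs_minus_commute\<close>)
    have sm: "summable (\<lambda>n. W n i x0)"
      by (rule summable_comparison_test'[OF geo[of H], of 0]) (use H[of x0] in \<open>auto simp: L_def\<close>)
    show ?thesis
      using has_field_derivative_series'[OF convex_cball has_field_derivative_at_within[OF der] uc xL(2) sm xL(1)] by blast
  qed
  have "(\<Sum>n. W' n i x) = c i x * (\<Sum>n. W n (\<not> i) x)" for i x
  proof -
    have "(\<lambda>n. W' (Suc n) i x) sums (c i x * (\<Sum>n. W n (\<not> i) x))"
      using main[of "\<not> i" x] by (auto simp: W'_def intro!: sums_mult summable_sums)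
    from sums_Suc[OF this] show ?thesis by (auto simp: W'_def dest: sums_unique)
  qed
  moreover have "(\<Sum>n. W n i x0) = Y i" for i
  proof -
    have "W n i x0 = (if n = 0 then Y i else 0)" for n by (cases n) (simp_all add: W0 d)
    thus ?thesis using sums_single[of 0 "\<lambda>_. Y i"] by (auto dest: sums_unique)
  qed
  ultimately show ?thesis using main by (intro exI[of _ "\<lambda>i x. \<Sum>n. W n i x"]) auto
qed

section \<open>Second-order linear equations with a kink at 0\<close>

text \<open>The integrating factor of \<open>p'' + a p'\<close> with friction \<open>a = A\<close>
  on the left and \<open>a = B\<close> on the right, continuous at 0.\<close>

definition weight :: "real \<Rightarrow> real \<Rightarrow> real \<Rightarrow> real" where
  "weight A B z = exp (if z \<le> 0 then A * z else B * z)"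

text \<open>In terms of \<open>t = weight A B z * p'\<close>, the equation \<open>p'' + (c - w) p' + g p = \<omega> p\<close> together
  with the continuity of \<open>p\<close> and \<open>p'\<close> at 0 is a linear system with continuous coefficients.\<close>

definition sl_solution ::
  "real \<Rightarrow> real \<Rightarrow> (real \<Rightarrow> real) \<Rightarrow> real \<Rightarrow> (real \<Rightarrow> real) \<Rightarrow> (real \<Rightarrow> real) \<Rightarrow> bool" where
  "sl_solution A B g \<omega> p t \<longleftrightarrow>
     (\<forall>z. (p has_real_derivative t z / weight A B z) (at z)) \<and>
     (\<forall>z. (t has_real_derivative weight A B z * (\<omega> - g z) * p z) (at z))"

lemma weight_simps [simp]:
  "weight A B z > 0" "weight A B z \<noteq> 0" "\<bar>weight A B z\<bar> = weight A B z" "weight A B 0 = 1"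
  by (simp_all add: weight_def)

lemma weight_reflect: "weight (- B) (- A) z = weight A B (- z)"
  by (simp add: weight_def)

lemma weight_cont: "continuous_on S (weight A B)"
proof -
  have "continuous_on ({..0} \<union> {0..}) (\<lambda>z. if z \<le> 0 then A * z else B * z)"
    by (intro continuous_on_cases) (auto intro!: continuous_intros)
  moreover have "{..0} \<union> {0..} = (UNIV :: real set)" by auto
  ultimately have "continuous_on S (\<lambda>z. if z \<le> 0 then A * z else B * z)"
    by (metis continuous_on_subset subset_UNIV)
  thus ?thesis unfolding weight_def by (intro continuous_intros)
qed

lemma weight_has_derivative:
  assumes "z \<noteq> 0"
  shows "(weight A B has_real_derivative (if z < 0 then A else B) * weight A B z) (at z)"
proof (cases "z < 0")
  case True
  have "((\<lambda>z. exp (A * z)) has_real_derivative A * exp (A * z)) (at z)"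
    by (auto intro!: derivative_eq_intros)
  hence "(weight A B has_real_derivative A * exp (A * z)) (at z)"
    by (rule has_field_derivative_transform_within_open[of _ _ _ "{..<0}"])
       (use True in \<open>auto simp: weight_def\<close>)
  thus ?thesis using True by (simp add: weight_def)
next
  case False
  have "((\<lambda>z. exp (B * z)) has_real_derivative B * exp (B * z)) (at z)"
    by (auto intro!: derivative_eq_intros)
  hence "(weight A B has_real_derivative B * exp (B * z)) (at z)"
    by (rule has_field_derivative_transform_within_open[of _ _ _ "{0<..}"])
       (use False assms in \<open>auto simp: weight_def\<close>)
  thus ?thesis using False assms by (simp add: weight_def)
qed

text \<open>Reversing the axis interchanges the ends and replaces \<open>(A, B)\<close> by
  \<open>(- B, - A)\<close>; results about +infinity are transferred to -infinity in this
  way.\<close>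

lemma sl_solution_reflect:
  assumes "sl_solution A B g \<omega> p t"
  shows "sl_solution (- B) (- A) (\<lambda>z. g (- z)) \<omega> (\<lambda>z. p (- z)) (\<lambda>z. - t (- z))"
proof -
  have "((\<lambda>z. p (- z)) has_real_derivative - (t (- z) / weight A B (- z))) (at z)"
    "((\<lambda>z. t (- z)) has_real_derivative - (weight A B (- z) * (\<omega> - g (- z)) * p (- z))) (at z)" for z
    using assms unfolding sl_solution_def by (simp_all flip: DERIV_mirror)
  thus ?thesis
    by (auto simp: sl_solution_def weight_reflect intro!: derivative_eq_intros)
qed

lemma sl_solution_lincomb:
  assumes "sl_solution A B g \<omega> p t" "sl_solution A B g \<omega> y u"
  shows "sl_solution A B g \<omega> (\<lambda>z. a * p z + b * y z) (\<lambda>z. a * t z + b * u z)"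
  using assms unfolding sl_solution_def
  by (auto intro!: derivative_eq_intros simp: add_divide_distrib algebra_simps)

lemma sl_solution_scale:
  assumes "sl_solution A B g \<omega> p t"
  shows "sl_solution A B g \<omega> (\<lambda>z. a * p z) (\<lambda>z. a * t z)"
  using sl_solution_lincomb[OF assms assms, of a 0] by simp

lemma sl_solution_cont:
  assumes "sl_solution A B g \<omega> p t"
  shows "continuous_on S p" "continuous_on S t"
  using assms unfolding sl_solution_def
  by (meson DERIV_isCont continuous_at_imp_continuous_on)+

text \<open>Since \<open>t\<close> contains the weight, the exponential factor of Abel's formula is
  absorbed.\<close>

lemma wronskian_constant:
  assumes "sl_solution A B g \<omega> p t" "sl_solution A B g \<omega> y u"
  shows "p x * u x - y x * t x = p x' * u x' - y x' * t x'"
proof -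
  have "((\<lambda>z. p z * u z - y z * t z) has_real_derivative 0) (at z)" for z
    using assms unfolding sl_solution_def
    by (auto intro!: derivative_eq_intros simp: divide_simps)
  thus ?thesis
    using DERIV_isconst_all[of "\<lambda>z. p z * u z - y z * t z" x x'] by blast
qed

text \<open>For \<open>\<omega> \<ge> 0\<close> the tail condition makes \<open>\<omega> - g\<close>
  at least \<open>\<delta>\<close> where \<open>R \<le> \<bar>z\<bar>\<close>, so that solutions
  cannot oscillate there.\<close>

locale sturm_liouville =
  fixes A B :: real and g :: "real \<Rightarrow> real" and R \<delta> K :: real
  assumes g_cont: "continuous_on UNIV g"
    and g_bound: "\<And>z. \<bar>g z\<bar> \<le> K"
    and g_tail: "\<And>z. R \<le> \<bar>z\<bar> \<Longrightarrow> g z \<le> - \<delta>"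
    and \<delta>_pos: "\<delta> > 0" and R_pos: "R > 0"
begin

abbreviation "\<rho> \<equiv> weight A B"
abbreviation "sol \<equiv> sl_solution A B g"

lemma reflected: "sturm_liouville (\<lambda>z. g (- z)) R \<delta> K"
proof
  show "continuous_on UNIV (\<lambda>z. g (- z))"
    by (intro continuous_on_compose2[OF g_cont] continuous_intros) auto
qed (use g_bound g_tail \<delta>_pos R_pos in auto)

lemma solD:
  assumes "sol \<omega> p t"
  shows "(p has_real_derivative t z / \<rho> z) (at z)"
    and "(t has_real_derivative \<rho> z * (\<omega> - g z) * p z) (at z)"
  using assms by (auto simp: sl_solution_def)

lemma sol_exists: obtains p t where "sol \<omega> p t" "p x0 = P" "t x0 = T"
proof -
  have "continuous_on UNIV (\<lambda>x. if i then 1 / \<rho> x else \<rho> x * (\<omega> - g x))" for i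
    by (cases i) (auto intro!: continuous_intros weight_cont g_cont)
  from linear_system_exists[of "\<lambda>i x. if i then 1 / \<rho> x else \<rho> x * (\<omega> - g x)", OF this, of x0 "\<lambda>i. if i then P else T"]
  obtain y where y: "\<And>i x. (y i has_real_derivative (if i then 1 / \<rho> x else \<rho> x * (\<omega> - g x)) * y (\<not> i) x) (at x)"
    "\<And>i. y i x0 = (if i then P else T)"
    by blast
  show thesis
    using y(1)[of True] y(1)[of False] y(2) by (intro that[of "y True" "y False"]) (auto simp: sl_solution_def)
qed

text \<open>Gronwall for the squared distance of two solutions. The competitor \<open>(q, v)\<close>
  solves the system only off 0 and inside the interval, which admits the front derivative on a
  half-line. \<open>C\<close> does not depend on the base point \<open>x\<close>, so base points may
  move in limits.\<close>

lemma sol_close: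
  assumes "sol \<omega> p t"
  shows "\<exists>C. \<forall>\<omega>' q v x y. \<bar>\<omega>' - \<omega>\<bar> \<le> 1 \<longrightarrow> continuous_on {a..b} q \<longrightarrow> continuous_on {a..b} v \<longrightarrow>
    (\<forall>z\<in>{a<..<b} - {0}. (q has_real_derivative v z / \<rho> z) (at z) \<and>
       (v has_real_derivative \<rho> z * (\<omega>' - g z) * q z) (at z)) \<longrightarrow> x \<in> {a..b} \<longrightarrow> y \<in> {a..b} \<longrightarrow>
    (q y - p y)\<^sup>2 + (v y - t y)\<^sup>2 \<le> C * ((q x - p x)\<^sup>2 + (v x - t x)\<^sup>2 + (\<omega>' - \<omega>)\<^sup>2)"
proof -
  have "\<exists>C1. \<forall>y\<in>{a..b}. norm (\<rho> y) \<le> C1" "\<exists>C2. \<forall>y\<in>{a..b}. norm (1 / \<rho> y) \<le> C2" "\<exists>C3. \<forall>y\<in>{a..b}. norm (p y) \<le> C3"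
    by (intro continuous_bounded_Icc continuous_intros weight_cont sl_solution_cont[OF assms]; simp)+
  then obtain C1 C2 C3 where C: "\<And>y. y \<in> {a..b} \<Longrightarrow> \<bar>\<rho> y\<bar> \<le> C1" "\<And>y. y \<in> {a..b} \<Longrightarrow> \<bar>1 / \<rho> y\<bar> \<le> C2"
    "\<And>y. y \<in> {a..b} \<Longrightarrow> \<bar>p y\<bar> \<le> C3"
    unfolding real_norm_def by metis
  define Q where "Q = max 1 (max C1 (max C2 C3))"
  have Q1: "Q \<ge> 1" by (simp add: Q_def)
  have Q: "\<rho> y \<le> Q" "1 / \<rho> y \<le> Q" "\<bar>p y\<bar> \<le> Q" if "y \<in> {a..b}" for y
    using C(1)[OF that] C(2)[OF that] C(3)[OF that] unfolding Q_def by linarith+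
  \<comment> \<open>The terms bound, in turn, the coupling by \<open>1 / \<rho>\<close>, the
    coupling by \<open>\<rho> * (\<omega>' - g)\<close>, and the square of the error in
    \<open>t\<close> that is split off from the inhomogeneous term.\<close>
  define M where "M = Q + Q * (\<bar>\<omega>\<bar> + 1 + K) + 1"
  have K0: "K \<ge> 0" using g_bound[of 0] by linarith
  have M1: "M > 0"
    using Q1 K0 mult_nonneg_nonneg[of Q "\<bar>\<omega>\<bar> + 1 + K"] unfolding M_def by linarith
  define D where "D = exp (M * (b - a)) * (1 + Q^4 / M)"
  show ?thesis
  proof (intro exI[of _ D] allI impI)
    fix \<omega>' p' t' x y
    assume \<omega>': "\<bar>\<omega>' - \<omega>\<bar> \<le> 1" and cont: "continuous_on {a..b} p'" "continuous_on {a..b} t'"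
      and der: "\<forall>z\<in>{a<..<b} - {0}. (p' has_real_derivative t' z / \<rho> z) (at z) \<and>
        (t' has_real_derivative \<rho> z * (\<omega>' - g z) * p' z) (at z)" and xy: "x \<in> {a..b}" "y \<in> {a..b}"
    \<comment> \<open>The inhomogeneity \<open>\<rho> * (\<omega>' - \<omega>) * p\<close> is at
      most \<open>Q\<^sup>2 * \<bar>\<omega>' - \<omega>\<bar>\<close> in absolute value;
      \<open>N\<close> is the square of this bound.\<close>
    define N where "N = Q^4 * (\<omega>' - \<omega>)\<^sup>2"
    define E where "E z = (p' z - p z)\<^sup>2 + (t' z - t z)\<^sup>2" for z
    define E' where "E' z = 2 * (p' z - p z) * ((t' z - t z) * (1 / \<rho> z)) +
      2 * (t' z - t z) * (\<rho> z * ((\<omega>' - g z) * (p' z - p z) + (\<omega>' - \<omega>) * p z))" for z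
    have N0: "N \<ge> 0" by (simp add: N_def)
    have "E y \<le> (E x + N / M) * exp (M * \<bar>y - x\<bar>) - N / M"
    proof (rule gronwall_off_zero[OF _ M1 N0, where a = a and b = b])
      show "continuous_on {a..b} E" unfolding E_def
        by (intro continuous_intros cont sl_solution_cont[OF assms])
      fix z assume z: "a < z" "z < b" "z \<noteq> 0"
      hence zab: "z \<in> {a..b}" and dz: "(p' has_real_derivative t' z / \<rho> z) (at z)"
        "(t' has_real_derivative \<rho> z * (\<omega>' - g z) * p' z) (at z)" using der by auto
      show "(E has_real_derivative E' z) (at z)"
        unfolding E_def E'_def
        by (auto intro!: derivative_eq_intros dz solD[OF assms] simp: field_simps)
      define d e where "d = p' z - p z" and "e = t' z - t z"
      have k: "\<bar>\<omega>' - g z\<bar> \<le> \<bar>\<omega>\<bar> + 1 + K" using g_bound[of z] \<omega>' by linarith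
      have de: "2 * (\<bar>d\<bar> * \<bar>e\<bar>) \<le> d\<^sup>2 + e\<^sup>2"
        using sum_squares_bound[of "\<bar>d\<bar>" "\<bar>e\<bar>"] by simp
      have "\<bar>2 * d * (e * (1 / \<rho> z))\<bar> = (2 * (\<bar>d\<bar> * \<bar>e\<bar>)) * (1 / \<rho> z)" by (simp add: abs_mult)
      also have "\<dots> \<le> (d\<^sup>2 + e\<^sup>2) * Q"
        using de Q(2)[OF zab] Q1 by (intro mult_mono) (auto simp: less_imp_le)
      finally have 1: "\<bar>2 * d * (e * (1 / \<rho> z))\<bar> \<le> (d\<^sup>2 + e\<^sup>2) * Q" .
      have "\<bar>2 * e * (\<rho> z * ((\<omega>' - g z) * d))\<bar> = (2 * (\<bar>d\<bar> * \<bar>e\<bar>)) * (\<rho> z * \<bar>\<omega>' - g z\<bar>)"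
        by (simp add: abs_mult)
      also have "\<dots> \<le> (d\<^sup>2 + e\<^sup>2) * (Q * (\<bar>\<omega>\<bar> + 1 + K))"
        using de Q(1)[OF zab] Q1 k by (intro mult_mono) (auto simp: less_imp_le)
      finally have 2: "\<bar>2 * e * (\<rho> z * ((\<omega>' - g z) * d))\<bar> \<le> (d\<^sup>2 + e\<^sup>2) * (Q * (\<bar>\<omega>\<bar> + 1 + K))" .
      have "\<bar>2 * e * (\<rho> z * ((\<omega>' - \<omega>) * p z))\<bar> = 2 * \<bar>e\<bar> * ((\<rho> z * \<bar>p z\<bar>) * \<bar>\<omega>' - \<omega>\<bar>)"
        by (simp add: abs_mult)
      also have "\<dots> \<le> 2 * \<bar>e\<bar> * (Q * Q * \<bar>\<omega>' - \<omega>\<bar>)"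
        using Q(1)[OF zab] Q(3)[OF zab] Q1 by (intro mult_left_mono mult_right_mono mult_mono) auto
      also have "\<dots> \<le> e\<^sup>2 + N"
        using sum_squares_bound[of "\<bar>e\<bar>" "Q * Q * \<bar>\<omega>' - \<omega>\<bar>"]
        by (simp add: N_def power_mult_distrib power2_eq_square power4_eq_xxxx algebra_simps)
      finally have 3: "\<bar>2 * e * (\<rho> z * ((\<omega>' - \<omega>) * p z))\<bar> \<le> d\<^sup>2 + e\<^sup>2 + N"
        by (smt (verit) zero_le_power2)
      have "E' z = 2 * d * (e * (1 / \<rho> z)) + 2 * e * (\<rho> z * ((\<omega>' - g z) * d)) + 2 * e * (\<rho> z * ((\<omega>' - \<omega>) * p z))"
        by (simp add: E'_def d_def e_def algebra_simps)
      hence "\<bar>E' z\<bar> \<le> \<bar>2 * d * (e * (1 / \<rho> z))\<bar> + \<bar>2 * e * (\<rho> z * ((\<omega>' - g z) * d))\<bar> + \<bar>2 * e * (\<rho> z * ((\<omega>' - \<omega>) * p z))\<bar>"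
        by linarith
      also have "\<dots> \<le> (d\<^sup>2 + e\<^sup>2) * Q + (d\<^sup>2 + e\<^sup>2) * (Q * (\<bar>\<omega>\<bar> + 1 + K)) + (d\<^sup>2 + e\<^sup>2 + N)"
        using 1 2 3 by linarith
      also have "\<dots> = M * E z + N"
        by (simp add: M_def E_def d_def e_def algebra_simps)
      finally show "\<bar>E' z\<bar> \<le> M * E z + N" .
    qed (use xy in auto)
    also have "\<dots> \<le> (E x + N / M) * exp (M * \<bar>y - x\<bar>)" using N0 M1 by simp
    also have "\<dots> \<le> (E x + N / M) * exp (M * (b - a))"
      using xy M1 N0 by (intro mult_left_mono) (auto simp: E_def)
    also have "\<dots> \<le> D * (E x + (\<omega>' - \<omega>)\<^sup>2)"
    proof -
      have "E x + N / M \<le> (1 + Q^4 / M) * (E x + (\<omega>' - \<omega>)\<^sup>2)"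
        using M1 Q1 by (simp add: N_def E_def algebra_simps)
      from mult_left_mono[OF this, of "exp (M * (b - a))"] show ?thesis
        by (simp add: D_def mult_ac)
    qed
    finally show "(p' y - p y)\<^sup>2 + (t' y - t y)\<^sup>2 \<le> D * ((p' x - p x)\<^sup>2 + (t' x - t x)\<^sup>2 + (\<omega>' - \<omega>)\<^sup>2)"
      by (simp add: E_def)
  qed
qed

text \<open>With equal parameters and matching data the bound of \<open>sol_close\<close> is 0. This
  identifies a function known only on a half-line with a solution on the whole line.\<close>

lemma sol_eq_on_interval:
  assumes s: "sol \<omega> p t" and cont: "continuous_on {a..b} q" "continuous_on {a..b} v"
    and der: "\<And>z. a < z \<Longrightarrow> z < b \<Longrightarrow> z \<noteq> 0 \<Longrightarrow> (q has_real_derivative v z / \<rho> z) (at z)"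
      "\<And>z. a < z \<Longrightarrow> z < b \<Longrightarrow> z \<noteq> 0 \<Longrightarrow> (v has_real_derivative \<rho> z * (\<omega> - g z) * q z) (at z)"
    and x: "x \<in> {a..b}" "q x = p x" "v x = t x" and y: "y \<in> {a..b}"
  shows "q y = p y"
proof -
  obtain C where "(q y - p y)\<^sup>2 + (v y - t y)\<^sup>2 \<le> C * ((q x - p x)\<^sup>2 + (v x - t x)\<^sup>2 + (\<omega> - \<omega>)\<^sup>2)"
    using sol_close[OF s, of a b] cont der x(1) y
    by (metis Diff_iff abs_zero diff_self greaterThanLessThan_iff singletonI zero_le_one)
  hence "(q y - p y)\<^sup>2 + (v y - t y)\<^sup>2 \<le> 0" using x by simp
  thus ?thesis by (simp add: sum_power2_le_zero_iff)
qed

lemma sol_trivial: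
  assumes "sol \<omega> p t" "p x = 0" "t x = 0"
  shows "p z = 0"
proof -
  have "0 = p z"
    by (rule sol_eq_on_interval[OF assms(1), of "min x z" "max x z" "\<lambda>_. 0" "\<lambda>_. 0" x z]) (use assms in auto)
  thus ?thesis by simp
qed

text \<open>Solutions are matched at the moving points \<open>xn\<close>, not at a fixed one;
  uniformity of \<open>sol_close\<close> in the base point and continuity of the limit solution
  absorb the motion.\<close>

lemma sol_limit:
  assumes s: "sol \<omega> p t" and sn: "\<And>n::nat. sol (w n) (pn n) (tn n)"
    and w: "w \<longlonglongrightarrow> \<omega>" and xn: "xn \<longlonglongrightarrow> x"
    and p: "(\<lambda>n. pn n (xn n)) \<longlonglongrightarrow> p x" and t: "(\<lambda>n. tn n (xn n)) \<longlonglongrightarrow> t x"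
    and "e > 0"
  shows "\<forall>\<^sub>F n in sequentially. \<forall>y\<in>{a..b}. \<bar>pn n y - p y\<bar> < e"
proof -
  \<comment> \<open>The interval is enlarged so as to contain all late \<open>xn\<close>.\<close>
  define a' b' where "a' = min a (x - 1)" and "b' = max b (x + 1)"
  obtain C where C: "\<And>\<omega>' p' t' x y. sol \<omega>' p' t' \<Longrightarrow> \<bar>\<omega>' - \<omega>\<bar> \<le> 1 \<Longrightarrow> x \<in> {a'..b'} \<Longrightarrow> y \<in> {a'..b'} \<Longrightarrow>
    (p' y - p y)\<^sup>2 + (t' y - t y)\<^sup>2 \<le> C * ((p' x - p x)\<^sup>2 + (t' x - t x)\<^sup>2 + (\<omega>' - \<omega>)\<^sup>2)"
    using sol_close[OF s, of a' b'] solD sl_solution_cont by metis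
  have "isCont p x" "isCont t x" using solD[OF s] by (auto intro: DERIV_isCont)
  hence "(\<lambda>n. p (xn n)) \<longlonglongrightarrow> p x" "(\<lambda>n. t (xn n)) \<longlonglongrightarrow> t x"
    using xn by (auto intro: isCont_tendsto_compose)
  hence "(\<lambda>n. C * ((pn n (xn n) - p (xn n))\<^sup>2 + (tn n (xn n) - t (xn n))\<^sup>2 + (w n - \<omega>)\<^sup>2)) \<longlonglongrightarrow>
      C * ((p x - p x)\<^sup>2 + (t x - t x)\<^sup>2 + (\<omega> - \<omega>)\<^sup>2)"
    by (intro tendsto_intros p t w)
  hence "\<forall>\<^sub>F n in sequentially. C * ((pn n (xn n) - p (xn n))\<^sup>2 + (tn n (xn n) - t (xn n))\<^sup>2 + (w n - \<omega>)\<^sup>2) < e\<^sup>2"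
    using \<open>e > 0\<close> by (intro order_tendstoD) auto
  moreover have "\<forall>\<^sub>F n in sequentially. dist (xn n) x < 1" "\<forall>\<^sub>F n in sequentially. dist (w n) \<omega> < 1"
    using tendstoD[OF xn, of 1] tendstoD[OF w, of 1] by simp_all
  ultimately show ?thesis
  proof eventually_elim
    case (elim n)
    show ?case
    proof
      fix y assume y: "y \<in> {a..b}"
      have "(pn n y - p y)\<^sup>2 + (tn n y - t y)\<^sup>2 \<le>
          C * ((pn n (xn n) - p (xn n))\<^sup>2 + (tn n (xn n) - t (xn n))\<^sup>2 + (w n - \<omega>)\<^sup>2)"
        using elim y by (intro C sn) (auto simp: a'_def b'_def dist_real_def)
      hence "(pn n y - p y)\<^sup>2 < e\<^sup>2" using elim(1) zero_le_power2[of "tn n y - t y"] by linarith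
      thus "\<bar>pn n y - p y\<bar> < e" using \<open>e > 0\<close> power2_less_imp_less[of "\<bar>pn n y - p y\<bar>" e] by simp
    qed
  qed
qed

end

section \<open>Zeros of solutions and conjugate points\<close>

lemma positive_if_nonzero:
  fixes f :: "real \<Rightarrow> real"
  assumes "continuous_on S f" "connected S" "\<And>x. x \<in> S \<Longrightarrow> f x \<noteq> 0" "w \<in> S" "f w > 0" "x \<in> S"
  shows "f x > 0"
proof (rule ccontr)
  assume "\<not> f x > 0"
  moreover have "connected (f ` S)" using assms by (intro connected_continuous_image)
  ultimately have "0 \<in> f ` S"
    using assms(4-6) connectedD_interval[of "f ` S" "f x" "f w" 0] by auto
  thus False using assms by force
qed

lemma zero_between:
  fixes f :: "real \<Rightarrow> real"
  assumes "continuous_on {x..y} f" "x < y" "f x * f y < 0"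
  obtains z where "x < z" "z < y" "f z = 0"
proof -
  have "\<exists>z\<ge>x. z \<le> y \<and> f z = 0"
    using positive_if_nonzero[OF assms(1) connected_Icc, of x y] positive_if_nonzero[OF assms(1) connected_Icc, of y x]
      assms(2,3) by (force simp: mult_less_0_iff)
  then obtain z where "x \<le> z" "z \<le> y" "f z = 0" by blast
  thus thesis using assms(3) by (intro that[of z]) (auto simp: less_le)
qed

text \<open>Zeros of a nontrivial solution are simple, and a strict sign change across them persists
  under small perturbations. The product form spares a distinction by the sign of
  \<open>d\<close>.\<close>

lemma sign_change_at_simple_zero:
  fixes f :: "real \<Rightarrow> real"
  assumes "(f has_real_derivative d) (at a)" "f a = 0" "d \<noteq> 0"
  shows "\<exists>e>0. \<forall>h. 0 < h \<longrightarrow> h < e \<longrightarrow> f (a - h) * f (a + h) < 0"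
proof -
  have pos: "\<exists>e>0. \<forall>h. 0 < h \<longrightarrow> h < e \<longrightarrow> k (a - h) * k (a + h) < 0"
    if k: "(k has_real_derivative d) (at a)" "k a = 0" "d > 0" for k :: "real \<Rightarrow> real" and d
  proof -
    obtain e1 where e1: "e1 > 0" "\<And>h. 0 < h \<Longrightarrow> h < e1 \<Longrightarrow> k a < k (a + h)"
      using DERIV_pos_inc_right[OF k(1,3)] by blast
    obtain e2 where e2: "e2 > 0" "\<And>h. 0 < h \<Longrightarrow> h < e2 \<Longrightarrow> k (a - h) < k a"
      using DERIV_pos_inc_left[OF k(1,3)] by blast
    show ?thesis
      using e1 e2 k(2) by (intro exI[of _ "min e1 e2"]) (auto simp: mult_neg_pos)
  qed
  show ?thesis
    using pos[of f d] pos[of "\<lambda>x. - f x" "- d"] assms by (cases "d > 0") (auto intro: DERIV_minus)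
qed

text \<open>Failure of disconjugacy, in the sense of Sturm theory, on the whole line.\<close>

definition conjugate_points :: "real \<Rightarrow> real \<Rightarrow> (real \<Rightarrow> real) \<Rightarrow> real \<Rightarrow> bool" where
  "conjugate_points A B g \<omega> \<longleftrightarrow>
     (\<exists>p t a b. sl_solution A B g \<omega> p t \<and> (\<exists>z. p z \<noteq> 0) \<and> a < b \<and> p a = 0 \<and> p b = 0)"

lemma conjugate_points_reflect:
  assumes "conjugate_points (- B) (- A) (\<lambda>z. g (- z)) \<omega>"
  shows "conjugate_points A B g \<omega>"
proof -
  obtain p t a b z where "sl_solution (- B) (- A) (\<lambda>z. g (- z)) \<omega> p t"
    "a < b" "p a = 0" "p b = 0" "p z \<noteq> 0"
    using assms unfolding conjugate_points_def by blast
  moreover from this(1) have "sl_solution A B g \<omega> (\<lambda>z. p (- z)) (\<lambda>z. - t (- z))"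
    using sl_solution_reflect[of "- B" "- A" "\<lambda>z. g (- z)" \<omega> p t] by simp
  ultimately show ?thesis
    unfolding conjugate_points_def
    by (intro exI[of _ "\<lambda>z. p (- z)"] exI[of _ "\<lambda>z. - t (- z)"] exI[of _ "- b"] exI[of _ "- a"] conjI exI[of _ "- z"]) auto
qed

section \<open>Bounded solutions at the ends and the threshold of oscillation\<close>

context sturm_liouville
begin

lemma pt_deriv:
  assumes "sol \<omega> p t"
  shows "((\<lambda>z. p z * t z) has_real_derivative ((t z)\<^sup>2 / \<rho> z + \<rho> z * (\<omega> - g z) * (p z)\<^sup>2)) (at z)"
  by (auto intro!: derivative_eq_intros solD[OF assms] simp: power2_eq_square)

lemma p2_deriv:
  assumes "sol \<omega> p t"
  shows "((\<lambda>z. (p z)\<^sup>2) has_real_derivative 2 * (p z * t z) / \<rho> z) (at z)"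
  by (auto intro!: derivative_eq_intros solD[OF assms])

text \<open>\<open>p * t\<close> is half the weighted derivative of \<open>p\<^sup>2\<close>; where
  \<open>g \<le> \<omega>\<close> both terms of its derivative in \<open>pt_deriv\<close> are
  nonnegative.\<close>

lemma pt_mono:
  assumes s: "sol \<omega> p t" and "x \<le> y" and g: "\<And>z. x < z \<Longrightarrow> z < y \<Longrightarrow> g z \<le> \<omega>"
  shows "p x * t x \<le> p y * t y"
proof (rule DERIV_nonneg_imp_increasing_open[OF \<open>x \<le> y\<close>])
  show "continuous_on {x..y} (\<lambda>z. p z * t z)"
    by (intro continuous_intros sl_solution_cont[OF s])
  fix z assume "x < z" "z < y"
  hence "(t z)\<^sup>2 / \<rho> z + \<rho> z * (\<omega> - g z) * (p z)\<^sup>2 \<ge> 0"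
    using g[of z] by (intro add_nonneg_nonneg mult_nonneg_nonneg divide_nonneg_pos) (auto simp: less_imp_le)
  thus "\<exists>d. ((\<lambda>z. p z * t z) has_real_derivative d) (at z) \<and> 0 \<le> d"
    using pt_deriv[OF s] by blast
qed

text \<open>The nondecreasing function \<open>p * t\<close> is squeezed to 0 between the ends; then
  both nonnegative terms of its derivative vanish, in particular the one with \<open>t\<close>. Ends
  where \<open>p = 0\<close> and ends where \<open>t = 0\<close> are covered alike.\<close>

lemma pt_zero:
  assumes s: "sol \<omega> p t" and "x < y" and g: "\<And>z. x < z \<Longrightarrow> z < y \<Longrightarrow> g z \<le> \<omega>"
    and "p x * t x \<ge> 0" "p y * t y \<le> 0"
  shows "\<And>z. x < z \<Longrightarrow> z < y \<Longrightarrow> t z = 0" and "\<And>z. x \<le> z \<Longrightarrow> z \<le> y \<Longrightarrow> p z = p x"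
proof -
  have F0: "p z * t z = 0" if "x \<le> z" "z \<le> y" for z
  proof (rule antisym)
    show "p z * t z \<le> 0"
      by (rule order_trans[OF pt_mono[OF s that(2)] assms(5)]) (use that g in auto)
    show "0 \<le> p z * t z"
      by (rule order_trans[OF assms(4) pt_mono[OF s that(1)]]) (use that g in auto)
  qed
  show t0: "t z = 0" if z: "x < z" "z < y" for z
  proof -
    have "((\<lambda>z. p z * t z) has_real_derivative 0) (at z)"
      by (rule has_field_derivative_transform_within_open[of "\<lambda>_. 0" _ _ "{x<..<y}"])
         (use z F0 in auto)
    hence "(t z)\<^sup>2 / \<rho> z + \<rho> z * (\<omega> - g z) * (p z)\<^sup>2 = 0"
      using pt_deriv[OF s] DERIV_unique by blast
    moreover have "\<rho> z * (\<omega> - g z) * (p z)\<^sup>2 \<ge> 0" "(t z)\<^sup>2 / \<rho> z \<ge> 0"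
      using g[OF z] by (simp_all add: less_imp_le)
    ultimately have "(t z)\<^sup>2 / \<rho> z = 0" by linarith
    thus ?thesis by simp
  qed
  show "p z = p x" if z: "x \<le> z" "z \<le> y" for z
  proof (rule DERIV_isconst2[OF \<open>x < y\<close> sl_solution_cont(1)[OF s] _ z])
    show "(p has_real_derivative 0) (at w)" if "x < w" "w < y" for w
      using solD(1)[OF s, of w] t0[OF that] by simp
  qed
qed

lemma sol_trivial_between:
  assumes s: "sol \<omega> p t" and "x < y" and g: "\<And>z. x < z \<Longrightarrow> z < y \<Longrightarrow> g z \<le> \<omega>"
    and "p x = 0" "p y * t y \<le> 0"
  shows "p z = 0"
proof -
  \<comment> \<open>An interior point is taken because \<open>pt_zero\<close> gives
    \<open>t = 0\<close> only strictly between the ends.\<close>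
  define m where "m = (x + y) / 2"
  have m: "x < m" "m < y" using \<open>x < y\<close> by (auto simp: m_def)
  have "t m = 0" using pt_zero(1)[OF s \<open>x < y\<close> g _ assms(5) m] assms(4) by simp
  moreover have "p m = 0" using pt_zero(2)[OF s \<open>x < y\<close> g _ assms(5), of m] assms(4) m by simp
  ultimately show ?thesis using sol_trivial[OF s] by blast
qed

lemma g_neg_tail: "R \<le> \<bar>z\<bar> \<Longrightarrow> 0 \<le> \<omega> \<Longrightarrow> g z \<le> \<omega>"
  using g_tail[of z] \<delta>_pos by linarith

lemma p2_mono:
  assumes s: "sol \<omega> p t" and "x \<le> y" and "\<And>z. x < z \<Longrightarrow> z < y \<Longrightarrow> p z * t z \<ge> 0"
  shows "(p x)\<^sup>2 \<le> (p y)\<^sup>2"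
proof (rule DERIV_nonneg_imp_increasing_open[OF \<open>x \<le> y\<close>])
  show "continuous_on {x..y} (\<lambda>z. (p z)\<^sup>2)"
    by (intro continuous_intros sl_solution_cont[OF s])
  fix z assume "x < z" "z < y"
  thus "\<exists>d. ((\<lambda>z. (p z)\<^sup>2) has_real_derivative d) (at z) \<and> 0 \<le> d"
    using p2_deriv[OF s, of z] assms(3)[of z] by (auto intro!: exI[of _ "2 * (p z * t z) / \<rho> z"] divide_nonneg_pos)
qed

text \<open>With \<open>m = p p'\<close>, the function \<open>m + B p\<^sup>2 / 2\<close> grows at least linearly once \<open>m > 0\<close>.\<close>

lemma bounded_tail_pt:
  assumes s: "sol \<omega> p t" and "\<omega> \<ge> 0" and C: "\<And>z. R \<le> z \<Longrightarrow> \<bar>p z\<bar> \<le> C" and z1: "R \<le> z1"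
  shows "p z1 * t z1 \<le> 0"
proof (rule ccontr)
  assume neg: "\<not> p z1 * t z1 \<le> 0"
  \<comment> \<open>If \<open>\<rho>\<close> grows, a positive lower bound on \<open>p * t\<close>
    does not keep \<open>p p'\<close> away from 0; hence the weight is divided out again.\<close>
  define m where "m z = p z * t z / \<rho> z" for z
  have pt: "p z * t z > 0" if "z1 \<le> z" for z
    using pt_mono[OF s that] neg z1 R_pos g_neg_tail[OF _ \<open>\<omega> \<ge> 0\<close>] by force
  have p2: "(p z)\<^sup>2 \<ge> (p z1)\<^sup>2" if "z1 \<le> z" for z
    using p2_mono[OF s that] pt by (simp add: less_imp_le)
  have p1: "(p z1)\<^sup>2 > 0" using neg by auto
  define c where "c = \<delta> * (p z1)\<^sup>2"
  have c: "c > 0" using p1 \<delta>_pos by (simp add: c_def)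
  define h where "h z = m z + B * (p z)\<^sup>2 / 2 - c * (z - z1)" for z
  have hm: "h z1 \<le> h z" if "z1 \<le> z" for z
  proof (rule DERIV_nonneg_imp_increasing_open[OF that])
    show "continuous_on {z1..z} h"
      unfolding h_def m_def
      by (intro continuous_intros sl_solution_cont[OF s] weight_cont) auto
    fix y assume y: "z1 < y" "y < z"
    have y0: "y > 0" using y z1 R_pos by linarith
    have "(h has_real_derivative ((t y / \<rho> y)\<^sup>2 + (\<omega> - g y) * (p y)\<^sup>2 - c)) (at y)"
      unfolding h_def m_def using y0
      by (auto intro!: derivative_eq_intros solD[OF s] weight_has_derivative
          simp: power2_eq_square field_simps)
    moreover have "(\<omega> - g y) * (p y)\<^sup>2 \<ge> \<delta> * (p z1)\<^sup>2"
      using g_tail[of y] p2[of y] y y0 z1 \<open>\<omega> \<ge> 0\<close> \<delta>_pos by (intro mult_mono) auto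
    hence "(t y / \<rho> y)\<^sup>2 + (\<omega> - g y) * (p y)\<^sup>2 - c \<ge> 0"
      using zero_le_power2[of "t y / \<rho> y"] unfolding c_def by linarith
    ultimately show "\<exists>d. (h has_real_derivative d) (at y) \<and> 0 \<le> d" by blast
  qed
  have pC: "(p z)\<^sup>2 \<le> C\<^sup>2" if "z1 \<le> z" for z
    using C[of z] that z1 by (simp add: abs_le_square_iff[symmetric])
  \<comment> \<open>Over this length the linear growth of rate \<open>c\<close> beats both
    \<open>\<bar>B\<bar> * C\<^sup>2 / 2\<close> and the initial value \<open>h z1\<close>, leaving
    \<open>m \<ge> 1\<close>.\<close>
  define z2 where "z2 = z1 + (1 + \<bar>B\<bar> * C\<^sup>2 / 2 + \<bar>h z1\<bar>) / c"
  have z2: "z1 \<le> z2" unfolding z2_def using c by (simp add: divide_nonneg_pos)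
  have m1: "m z \<ge> 1" if z: "z2 \<le> z" for z
  proof -
    have "B * (p z)\<^sup>2 / 2 \<le> \<bar>B\<bar> * C\<^sup>2 / 2"
      using pC[of z] z z2 by (intro divide_right_mono mult_mono) auto
    moreover have "c * (z - z1) \<ge> c * (z2 - z1)" using z c by simp
    moreover have "c * (z2 - z1) = 1 + \<bar>B\<bar> * C\<^sup>2 / 2 + \<bar>h z1\<bar>" using c by (simp add: z2_def)
    moreover have "h z \<ge> h z1" using hm z z2 by simp
    ultimately show ?thesis by (simp add: h_def)
  qed
  \<comment> \<open>From \<open>z2\<close> on \<open>p\<^sup>2\<close> has slope at least 2, so
    after a length \<open>C\<^sup>2\<close> it violates its bound \<open>C\<^sup>2\<close>.\<close>
  define z3 where "z3 = z2 + C\<^sup>2"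
  have "(p z2)\<^sup>2 - 2 * z2 \<le> (p z3)\<^sup>2 - 2 * z3"
  proof (rule DERIV_nonneg_imp_increasing_open[where f = "\<lambda>z. (p z)\<^sup>2 - 2 * z"])
    show "z2 \<le> z3" by (simp add: z3_def)
    show "continuous_on {z2..z3} (\<lambda>z. (p z)\<^sup>2 - 2 * z)"
      by (intro continuous_intros sl_solution_cont[OF s])
    fix y assume y: "z2 < y" "y < z3"
    have "((\<lambda>z. (p z)\<^sup>2 - 2 * z) has_real_derivative 2 * m y - 2) (at y)"
      by (auto intro!: derivative_eq_intros solD[OF s] simp: m_def)
    thus "\<exists>d. ((\<lambda>z. (p z)\<^sup>2 - 2 * z) has_real_derivative d) (at y) \<and> 0 \<le> d"
      using m1[of y] y by (intro exI[of _ "2 * m y - 2"]) auto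
  qed
  hence "(p z3)\<^sup>2 \<ge> (p z1)\<^sup>2 + 2 * C\<^sup>2" using p2[OF z2] by (simp add: z3_def)
  moreover have "z1 \<le> z3" using z2 zero_le_power2[of C] unfolding z3_def by linarith
  ultimately have "C\<^sup>2 \<ge> (p z1)\<^sup>2 + 2 * C\<^sup>2" using pC[of z3] by linarith
  thus False using p1 zero_le_power2[of C] by linarith
qed

text \<open>\<open>bounded_tail_pt\<close> provides the point with \<open>p * t \<le> 0\<close>
  after the zero that \<open>sol_trivial_between\<close> asks for.\<close>

lemma bounded_tail_nonzero:
  assumes s: "sol \<omega> p t" and "\<omega> \<ge> 0" and C: "\<And>z. R \<le> z \<Longrightarrow> \<bar>p z\<bar> \<le> C" and "R \<le> z1" "p z1 = 0"
  shows "p z = 0"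
proof (rule sol_trivial_between[OF s])
  show "z1 < z1 + 1" by simp
  show "p (z1 + 1) * t (z1 + 1) \<le> 0" using assms by (intro bounded_tail_pt[OF s]) auto
  fix w assume "z1 < w" thus "g w \<le> \<omega>" using assms by (intro g_neg_tail) auto
qed (use assms in auto)

text \<open>A positive solution that is bounded at \<open>+\<infinity>\<close> has the smallest logarithmic derivative among
  the solutions that are eventually positive.\<close>

lemma principal_wronskian:
  assumes s: "sol \<omega> p t" and "\<omega> \<ge> 0" and C: "\<And>z. R \<le> z \<Longrightarrow> \<bar>p z\<bar> \<le> C"
    and pos: "\<And>z. R \<le> z \<Longrightarrow> p z > 0"
    and y: "sol \<omega> y u" and ypos: "\<And>z. zi \<le> z \<Longrightarrow> y z > 0"
  shows "p x * u x - y x * t x \<ge> 0"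
proof -
  define M where "M = max R zi"
  have t0: "t z \<le> 0" if "R \<le> z" for z
    using bounded_tail_pt[OF s \<open>\<omega> \<ge> 0\<close> C that] pos[OF that] by (simp add: mult_le_0_iff)
  show ?thesis
  \<comment> \<open>Either some late \<open>u z \<ge> 0\<close> decides the sign of the constant
    Wronskian, because \<open>t \<le> 0\<close> there; or \<open>y\<close> decreases, is bounded,
    and is therefore proportional to \<open>p\<close>.\<close>
  proof (cases "\<exists>z\<ge>M. u z \<ge> 0")
    case True
    then obtain z where z: "z \<ge> M" "u z \<ge> 0" by blast
    hence "p z > 0" "y z > 0" "t z \<le> 0" using pos ypos t0 by (auto simp: M_def)
    hence "p z * u z - y z * t z \<ge> 0"
      using z mult_nonneg_nonneg[of "p z" "u z"] mult_nonneg_nonpos[of "y z" "t z"] by linarith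
    thus ?thesis using wronskian_constant[OF s y, of x z] by simp
  next
    case False
    have "y z \<le> y M" if "M \<le> z" for z
    proof (rule DERIV_nonpos_imp_decreasing_open[OF that])
      show "continuous_on {M..z} y" by (rule sl_solution_cont[OF y])
      fix w assume "M < w" "w < z"
      hence "u w < 0" using False by (meson less_imp_le not_less)
      thus "\<exists>d. (y has_real_derivative d) (at w) \<and> d \<le> 0"
        using solD(1)[OF y, of w] by (intro exI[of _ "u w / \<rho> w"]) (auto simp: field_simps)
    qed
    hence yb: "\<bar>y z\<bar> \<le> y M" if "M \<le> z" for z
      using ypos[of z] that by (auto simp: M_def)
    \<comment> \<open>The combination that vanishes at \<open>M\<close>; being bounded, it is
      trivial.\<close>
    define d e where "d z = p M * y z + (- y M) * p z" and "e z = p M * u z + (- y M) * t z" for z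
    have de: "sol \<omega> d e" unfolding d_def e_def by (rule sl_solution_lincomb[OF y s])
    \<comment> \<open>\<open>M\<close> replaces \<open>R\<close> because \<open>y\<close> is known
      to be bounded only from \<open>M\<close> on.\<close>
    interpret M: sturm_liouville A B g M \<delta> K
      by unfold_locales (use g_cont g_bound g_tail \<delta>_pos R_pos in \<open>auto simp: M_def\<close>)
    have "\<bar>d z\<bar> \<le> p M * y M + y M * C" if "M \<le> z" for z
    proof -
      have "\<bar>d z\<bar> \<le> \<bar>p M * y z\<bar> + \<bar>y M * p z\<bar>" unfolding d_def by simp
      also have "\<dots> \<le> p M * y M + y M * C"
        unfolding abs_mult using pos[of M] ypos[of M] yb[OF that] C[of z] that
        by (intro add_mono mult_mono) (auto simp: M_def)
      finally show ?thesis .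
    qed
    from M.bounded_tail_nonzero[OF de \<open>\<omega> \<ge> 0\<close> this, of M]
    have d0: "d z = 0" for z by (simp add: d_def)
    have "e x = 0"
    proof -
      have "(d has_real_derivative e x / \<rho> x) (at x)" by (rule solD[OF de])
      moreover have "d = (\<lambda>_. 0)" using d0 by auto
      ultimately have "e x / \<rho> x = 0" using DERIV_unique[OF _ DERIV_const] by metis
      thus ?thesis by simp
    qed
    have "p M * (p x * u x - y x * t x) = p x * e x - d x * t x"
      by (simp add: d_def e_def algebra_simps)
    also have "\<dots> = 0" using \<open>e x = 0\<close> d0[of x] by simp
    finally show ?thesis using pos[of M] by (auto simp: M_def)
  qed
qed

text \<open>Just to the right of a zero a positive solution has an unbounded logarithmic derivative,
  whereas the bounded one should have the smallest. Without conjugate points a solution vanishing at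
  \<open>a - 1\<close> keeps one sign beyond that point, and the comparison with it at
  \<open>a\<close> is contradictory.\<close>

lemma conjugate_if_bounded_zero:
  assumes s: "sol \<omega> p t" and "\<omega> \<ge> 0" and C: "\<And>z. R \<le> z \<Longrightarrow> \<bar>p z\<bar> \<le> C"
    and nz: "p z0 \<noteq> 0" and a: "p a = 0"
  shows "conjugate_points A B g \<omega>"
proof (rule ccontr)
  assume nc: "\<not> ?thesis"
  have uniq: "y b = 0 \<Longrightarrow> y c = 0 \<Longrightarrow> y z \<noteq> 0 \<Longrightarrow> sol \<omega> y u \<Longrightarrow> b = c" for y u b c z
    using nc unfolding conjugate_points_def by (metis linorder_neqE_linordered_idom)
  define k where "k = sgn (p (a + 1))"
  have "p (a + 1) \<noteq> 0" using uniq[OF a _ nz s, of "a + 1"] by auto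
  hence k: "k \<noteq> 0" "k * p (a + 1) > 0" "\<bar>k\<bar> = 1" unfolding k_def by (auto simp: sgn_if)
  define q v where "q z = k * p z" and "v z = k * t z" for z
  have qv: "sol \<omega> q v" unfolding q_def v_def by (rule sl_solution_scale[OF s])
  have qpos: "q z > 0" if "z > a" for z
  proof (rule positive_if_nonzero[of "{a<..}" q "a + 1"])
    show "q x \<noteq> 0" if "x \<in> {a<..}" for x
      using uniq[OF a _ nz s, of x] that k by (auto simp: q_def)
  qed (use that k sl_solution_cont[OF qv] in \<open>auto simp: q_def\<close>)
  have qa: "q a = 0" using a by (simp add: q_def)
  have "v a \<noteq> 0" using sol_trivial[OF qv qa] qpos[of "a + 1"] by force
  moreover have "\<not> v a < 0"
  proof
    assume "v a < 0"
    hence "v a / \<rho> a < 0" by (simp add: divide_neg_pos)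
    then obtain e where "e > 0" "\<And>h. 0 < h \<Longrightarrow> h < e \<Longrightarrow> q (a + h) < q a"
      using DERIV_neg_dec_right[OF solD(1)[OF qv]] by blast
    from this(2)[of "e / 2"] this(1) show False using qpos[of "a + e / 2"] qa by simp
  qed
  ultimately have va: "v a > 0" by linarith
  \<comment> \<open>\<open>principal_wronskian\<close> needs positivity from \<open>R\<close> on,
    while \<open>q\<close> is positive only beyond \<open>a\<close>.\<close>
  have aR: "a < R"
  proof (rule ccontr)
    assume "\<not> a < R"
    thus False using bounded_tail_nonzero[OF s \<open>\<omega> \<ge> 0\<close> C, of a z0] a nz by simp
  qed
  obtain y u where y: "sol \<omega> y u" "y (a - 1) = 0" "u (a - 1) = 1"
    by (rule sol_exists)
  have "u (a - 1) / \<rho> (a - 1) > 0" using y by simp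
  then obtain e where e: "e > 0" "\<And>h. 0 < h \<Longrightarrow> h < e \<Longrightarrow> y (a - 1) < y (a - 1 + h)"
    using DERIV_pos_inc_right[OF solD(1)[OF y(1)]] by blast
  have ye: "y (a - 1 + e / 2) > 0" using e(2)[of "e / 2"] e(1) y by simp
  have ypos: "y z > 0" if "z > a - 1" for z
  proof (rule positive_if_nonzero[of "{a - 1<..}" y "a - 1 + e / 2"])
    show "y x \<noteq> 0" if "x \<in> {a - 1<..}" for x
      using uniq[OF y(2) _ _ y(1), of x] that ye by force
  qed (use that ye e sl_solution_cont[OF y(1)] in auto)
  have "q a * u a - y a * v a \<ge> 0"
    by (rule principal_wronskian[OF qv \<open>\<omega> \<ge> 0\<close> _ _ y(1), where C = C and zi = a])
       (use C k qpos ypos aR in \<open>auto simp: q_def abs_mult\<close>)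
  thus False using qa va ypos[of a] by (simp add: mult_le_0_iff)
qed

text \<open>Both zeros are simple, so they come with sign changes that survive a small change of
  \<open>\<omega>\<close> when the data at \<open>a\<close> are kept.\<close>

lemma conjugate_open:
  assumes "conjugate_points A B g \<omega>"
  shows "\<exists>\<epsilon>>0. \<forall>\<omega>'. \<bar>\<omega>' - \<omega>\<bar> < \<epsilon> \<longrightarrow> conjugate_points A B g \<omega>'"
proof (rule ccontr)
  assume "\<not> ?thesis"
  hence "\<exists>\<omega>'. \<bar>\<omega>' - \<omega>\<bar> < 1 / Suc n \<and> \<not> conjugate_points A B g \<omega>'" for n
    by (metis of_nat_0_less_iff zero_less_Suc zero_less_divide_1_iff)
  then obtain w where w: "\<And>n. \<bar>w n - \<omega>\<bar> < 1 / Suc n" "\<And>n. \<not> conjugate_points A B g (w n)"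
    by metis
  have "(\<lambda>n. w n - \<omega>) \<longlonglongrightarrow> 0"
    by (rule Lim_null_comparison[OF _ LIMSEQ_Suc[OF lim_1_over_n]])
       (use w(1) in \<open>auto intro!: always_eventually less_imp_le\<close>)
  hence wlim: "w \<longlonglongrightarrow> \<omega>" by (simp add: LIM_zero_iff)
  obtain p t a b z where p: "sol \<omega> p t" "p z \<noteq> 0" "a < b" "p a = 0" "p b = 0"
    using assms unfolding conjugate_points_def by blast
  have "t a / \<rho> a \<noteq> 0" "t b / \<rho> b \<noteq> 0" using sol_trivial[OF p(1), of _ z] p by auto
  then obtain e1 e2 where e: "e1 > 0" "\<And>h. 0 < h \<Longrightarrow> h < e1 \<Longrightarrow> p (a - h) * p (a + h) < 0"
      "e2 > 0" "\<And>h. 0 < h \<Longrightarrow> h < e2 \<Longrightarrow> p (b - h) * p (b + h) < 0"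
    using sign_change_at_simple_zero[OF solD(1)[OF p(1)]] p(4,5) by metis
  \<comment> \<open>The bound by half of \<open>b - a\<close> keeps the neighbourhoods of the two
    zeros disjoint, so that the perturbed zeros stay distinct.\<close>
  define h where "h = min (min e1 e2) (b - a) / 2"
  have h: "h > 0" "h < e1" "h < e2" "2 * h \<le> b - a" using e p by (auto simp: h_def)
  have "\<exists>pn tn. sol (w n) pn tn \<and> pn a = p a \<and> tn a = t a" for n
    by (metis sol_exists)
  then obtain pn tn where pn: "\<And>n. sol (w n) (pn n) (tn n)" "\<And>n. pn n a = p a" "\<And>n. tn n a = t a"
    by metis
  have lim: "(\<lambda>n. pn n y) \<longlonglongrightarrow> p y" for y
  proof (rule tendstoI)
    fix e :: real assume "e > 0"
    have "\<forall>\<^sub>F n in sequentially. \<forall>x\<in>{y..y}. \<bar>pn n x - p x\<bar> < e"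
      by (rule sol_limit[OF p(1) pn(1) wlim tendsto_const[of a] _ _ \<open>e > 0\<close>]) (use pn in auto)
    thus "\<forall>\<^sub>F n in sequentially. dist (pn n y) (p y) < e" by (simp add: dist_real_def)
  qed
  have "\<forall>\<^sub>F n in sequentially. pn n (a - h) * pn n (a + h) < 0"
    "\<forall>\<^sub>F n in sequentially. pn n (b - h) * pn n (b + h) < 0"
    using e h by (auto intro!: order_tendstoD(2)[OF tendsto_mult[OF lim lim]])
  hence "\<forall>\<^sub>F n in sequentially. False"
  proof eventually_elim
    case (elim n)
    obtain x where x: "a - h < x" "x < a + h" "pn n x = 0"
      by (rule zero_between[OF sl_solution_cont(1)[OF pn(1)] _ elim(1)]) (use h in auto)
    obtain y where y: "b - h < y" "y < b + h" "pn n y = 0"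
      by (rule zero_between[OF sl_solution_cont(1)[OF pn(1)] _ elim(2)]) (use h in auto)
    have "pn n (a - h) \<noteq> 0" using elim(1) by auto
    moreover have "x < y" using x y h by linarith
    ultimately show ?case using w(2)[of n] pn(1)[of n] x y unfolding conjugate_points_def by blast
  qed
  thus False by simp
qed

text \<open>For \<open>\<omega> \<ge> K\<close> the potential is nowhere above
  \<open>\<omega>\<close>, so a zero cannot be followed by another one.\<close>

lemma conjugate_less: assumes "conjugate_points A B g \<omega>" shows "\<omega> < K"
proof (rule ccontr)
  assume "\<not> \<omega> < K"
  hence g: "g z \<le> \<omega>" for z using g_bound[of z] by linarith
  obtain p t a b z where p: "sol \<omega> p t" "p z \<noteq> 0" "a < b" "p a = 0" "p b = 0"
    using assms unfolding conjugate_points_def by blast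
  thus False using sol_trivial_between[OF p(1) \<open>a < b\<close> g, of z] by simp
qed

text \<open>Normalizing at a maximum of \<open>\<bar>p\<bar>\<close> between the zeros gives the
  data \<open>(1, 0)\<close>; confining that point to \<open>{- R..R}\<close> lets a sequence of
  such solutions converge along a subsequence.\<close>

lemma conjugate_normalized:
  assumes "conjugate_points A B g \<omega>" "\<omega> \<ge> 0"
  obtains p t x a b where "sol \<omega> p t" "a < x" "x < b" "p a = 0" "p b = 0" "p x = 1" "t x = 0"
    "x \<in> {- R..R}" "\<And>z. a \<le> z \<Longrightarrow> z \<le> b \<Longrightarrow> \<bar>p z\<bar> \<le> 1"
proof -
  obtain p t a b z where p: "sol \<omega> p t" "p z \<noteq> 0" "a < b" "p a = 0" "p b = 0"
    using assms unfolding conjugate_points_def by blast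
  have "\<exists>x\<in>{a..b}. \<forall>y\<in>{a..b}. \<bar>p y\<bar> \<le> \<bar>p x\<bar>"
    using p(3) by (intro continuous_attains_sup) (auto intro!: continuous_intros sl_solution_cont[OF p(1)])
  then obtain x where x: "x \<in> {a..b}" "\<And>y. y \<in> {a..b} \<Longrightarrow> \<bar>p y\<bar> \<le> \<bar>p x\<bar>" by blast
  have px: "p x \<noteq> 0"
  proof
    assume "p x = 0"
    hence p0: "p y = 0" if "y \<in> {a..b}" for y using x(2)[OF that] by simp
    define m where "m = (a + b) / 2"
    have "t m / \<rho> m = 0"
    proof (rule DERIV_local_const[OF solD(1)[OF p(1)], of "(b - a) / 2"])
      show "\<forall>y. \<bar>m - y\<bar> < (b - a) / 2 \<longrightarrow> p m = p y"
      proof (intro allI impI)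
        fix y assume "\<bar>m - y\<bar> < (b - a) / 2"
        hence "y \<in> {a..b}" "m \<in> {a..b}" unfolding abs_less_iff m_def by (auto simp: field_simps)
        thus "p m = p y" using p0 by simp
      qed
    qed (use p(3) in simp)
    moreover have "p m = 0" using p(3) by (intro p0) (auto simp: m_def field_simps)
    ultimately show False using sol_trivial[OF p(1), of m z] p(2) by simp
  qed
  define q v where "q z = 1 / p x * p z" and "v z = 1 / p x * t z" for z
  have qv: "sol \<omega> q v" unfolding q_def v_def by (rule sl_solution_scale[OF p(1)])
  have q1: "\<bar>q y\<bar> \<le> 1" if "a \<le> y" "y \<le> b" for y
    using x(2)[of y] that px by (simp add: q_def abs_mult divide_le_eq_1)
  have ax: "a < x" "x < b" using x(1) px p by (auto simp: less_le)
  have qx: "q x = 1" and q0: "q a = 0" "q b = 0" using px p by (simp_all add: q_def)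
  have "v x / \<rho> x = 0"
  proof (rule DERIV_local_max[OF solD(1)[OF qv], of "min (x - a) (b - x)"])
    show "\<forall>y. \<bar>x - y\<bar> < min (x - a) (b - x) \<longrightarrow> q y \<le> q x"
    proof (intro allI impI)
      fix y assume "\<bar>x - y\<bar> < min (x - a) (b - x)"
      hence "a \<le> y" "y \<le> b" by linarith+
      thus "q y \<le> q x" using q1[of y] qx by simp
    qed
  qed (use ax in auto)
  hence vx: "v x = 0" by simp
  \<comment> \<open>Beyond \<open>R\<close> the product \<open>q * v\<close> would vanish at the
    critical point \<open>x\<close> and at the zero \<open>b\<close>, forcing \<open>q\<close> to be
    constant in between.\<close>
  have "\<not> x > R"
  proof
    assume "x > R"
    have "q b = q x"
      by (rule pt_zero(2)[OF qv ax(2)]) (use \<open>x > R\<close> assms(2) ax R_pos vx q0 in \<open>auto intro!: g_neg_tail\<close>)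
    thus False using qx q0 by simp
  qed
  moreover have "\<not> x < - R"
  proof
    assume "x < - R"
    have "q x = q a"
      by (rule pt_zero(2)[OF qv ax(1)]) (use \<open>x < - R\<close> assms(2) ax R_pos vx q0 in \<open>auto intro!: g_neg_tail\<close>)
    thus False using qx q0 by simp
  qed
  ultimately show thesis using that[OF qv ax q0 qx vx _ q1] by auto
qed

text \<open>As long as the limit \<open>p\<close> has no zero on \<open>{x..z}\<close>, the zeros
  \<open>bn n\<close> lie beyond \<open>z\<close> for large \<open>n\<close>; so the bound valid up
  to \<open>bn n\<close> holds at \<open>z\<close> and passes to the limit.\<close>

lemma limit_bound_right:
  assumes s: "sol \<omega> p t" and sn: "\<And>n::nat. sol (w n) (pn n) (tn n)"
    and w: "w \<longlonglongrightarrow> \<omega>" and xn: "xn \<longlonglongrightarrow> x" and px: "p x = 1" "t x = 0"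
    and pn: "\<And>n. pn n (xn n) = 1" "\<And>n. tn n (xn n) = 0" "\<And>n. xn n < bn n" "\<And>n. pn n (bn n) = 0"
    and le: "\<And>n z. xn n \<le> z \<Longrightarrow> z \<le> bn n \<Longrightarrow> \<bar>pn n z\<bar> \<le> 1"
    and "x \<le> z" and nz: "\<And>y. x \<le> y \<Longrightarrow> y \<le> z \<Longrightarrow> p y \<noteq> 0"
  shows "\<bar>p z\<bar> \<le> 1"
proof (cases "x = z")
  case False
  hence xz: "x < z" using \<open>x \<le> z\<close> by simp
  have "isCont p x" using solD[OF s] by (auto intro: DERIV_isCont)
  then obtain d where d: "d > 0" "\<And>y. \<bar>y - x\<bar> < d \<Longrightarrow> \<bar>p y - 1\<bar> < 1"
    using px unfolding continuous_at_eps_delta dist_real_def by (metis zero_less_one)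
  \<comment> \<open>The points \<open>xn n\<close> may approach \<open>x\<close> from the left, so
    positivity of \<open>p\<close> is needed slightly before \<open>x\<close> as well.\<close>
  define x' where "x' = x - d / 2"
  have pnz: "p y \<noteq> 0" if "y \<in> {x'..z}" for y
    using nz[of y] d(2)[of y] d(1) that by (cases "x \<le> y") (auto simp: x'_def)
  have ppos: "p y > 0" if "y \<in> {x'..z}" for y
    by (rule positive_if_nonzero[OF sl_solution_cont(1)[OF s] _ pnz _ _ that, of x])
       (use d xz px in \<open>auto simp: x'_def\<close>)
  have "\<exists>y\<in>{x'..z}. \<forall>u\<in>{x'..z}. p y \<le> p u"
    using xz d by (intro continuous_attains_inf sl_solution_cont(1)[OF s]) (auto simp: x'_def)
  then obtain y where y: "y \<in> {x'..z}" "\<And>u. u \<in> {x'..z} \<Longrightarrow> p y \<le> p u" by blast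
  have lim: "\<forall>\<^sub>F n in sequentially. \<forall>u\<in>{x'..z}. \<bar>pn n u - p u\<bar> < e" if "e > 0" for e
    by (rule sol_limit[OF s sn w xn _ _ that]) (simp_all add: pn px)
  have mpos: "0 < min (d / 2) (z - x)" using d xz by simp
  have "\<forall>\<^sub>F n in sequentially. \<bar>pn n z\<bar> \<le> 1"
    using lim[OF ppos[OF y(1)]] tendstoD[OF xn mpos]
  proof eventually_elim
    case (elim n)
    have xnb: "x' < xn n" "xn n < z"
      using elim(2) unfolding dist_real_def x'_def by linarith+
    have "pn n u \<noteq> 0" if "u \<in> {x'..z}" for u
      using elim that y(2)[OF that] by fastforce
    hence "\<not> bn n \<le> z" using pn(3,4)[of n] xnb by force
    thus ?case using le[of n z] xnb by simp
  qed
  moreover have "(\<lambda>n. \<bar>pn n z\<bar>) \<longlonglongrightarrow> \<bar>p z\<bar>"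
  proof (intro tendsto_rabs tendstoI)
    fix e :: real assume "e > 0"
    from lim[OF this] show "\<forall>\<^sub>F n in sequentially. dist (pn n z) (p z) < e"
      by eventually_elim (use xz d in \<open>auto simp: dist_real_def x'_def\<close>)
  qed
  ultimately show ?thesis
    by (intro tendsto_upperbound[of "\<lambda>n. \<bar>pn n z\<bar>"]) auto
qed (use px in simp)

lemma positive_bounded_solution:
  assumes "conjugate_points A B g 0"
  obtains \<omega> p t where "\<omega> > 0" "sol \<omega> p t" "\<And>z. p z > 0" "\<And>z. p z \<le> 1"
proof -
  interpret r: sturm_liouville "- B" "- A" "\<lambda>z. g (- z)" R \<delta> K by (rule reflected)
  define Z where "Z = {\<omega>. 0 \<le> \<omega> \<and> conjugate_points A B g \<omega>}"
  define s where "s = Sup Z"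
  have Z0: "0 \<in> Z" using assms by (simp add: Z_def)
  have bdd: "bdd_above Z" using conjugate_less by (auto simp: Z_def intro!: bdd_aboveI[of _ K] less_imp_le)
  have s0: "s \<ge> 0" unfolding s_def using Z0 bdd by (rule cSup_upper)
  \<comment> \<open>If the supremum were attained, openness would give a larger element. As 0
    belongs to \<open>Z\<close>, this also makes \<open>s\<close> positive.\<close>
  have ns: "\<not> conjugate_points A B g s"
  proof
    assume "conjugate_points A B g s"
    then obtain e where e: "e > 0" "\<And>\<omega>'. \<bar>\<omega>' - s\<bar> < e \<Longrightarrow> conjugate_points A B g \<omega>'"
      using conjugate_open by blast
    hence "s + e / 2 \<in> Z" using s0 by (simp add: Z_def)
    hence "s + e / 2 \<le> s" unfolding s_def using bdd by (rule cSup_upper)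
    thus False using e by simp
  qed
  have spos: "s > 0" using s0 ns assms by (metis less_le)
  have "\<exists>w p t x a b. w \<in> {s - 1 / Suc n<..s} \<and> sol w p t \<and> a < x \<and> x < b \<and> p a = 0 \<and> p b = 0 \<and> p x = 1 \<and> t x = 0 \<and>
    x \<in> {- R..R} \<and> (\<forall>z. a \<le> z \<longrightarrow> z \<le> b \<longrightarrow> \<bar>p z\<bar> \<le> 1)" for n
  proof -
    have "s - 1 / Suc n < s" by simp
    then obtain w where w: "w \<in> Z" "s - 1 / Suc n < w"
      unfolding s_def using Z0 by (metis empty_iff less_cSupD)
    have "w \<le> s" unfolding s_def using w(1) bdd by (rule cSup_upper)
    have "conjugate_points A B g w" "w \<ge> 0" using w by (auto simp: Z_def)
    then obtain p t x a b where "sol w p t" "a < x" "x < b" "p a = 0" "p b = 0" "p x = 1" "t x = 0"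
      "x \<in> {- R..R}" "\<And>z. a \<le> z \<Longrightarrow> z \<le> b \<Longrightarrow> \<bar>p z\<bar> \<le> 1" by (rule conjugate_normalized) blast
    thus ?thesis using w \<open>w \<le> s\<close>
      by (intro exI[of _ w] exI[of _ p] exI[of _ t] exI[of _ x] exI[of _ a] exI[of _ b]) auto
  qed
  then obtain w pn tn xn an bn where seq: "\<And>n. w n \<in> {s - 1 / Suc n<..s}" "\<And>n. sol (w n) (pn n) (tn n)"
    "\<And>n. an n < xn n" "\<And>n. xn n < bn n" "\<And>n. pn n (an n) = 0" "\<And>n. pn n (bn n) = 0"
    "\<And>n. pn n (xn n) = 1" "\<And>n. tn n (xn n) = 0" "\<And>n. xn n \<in> {- R..R}"
    "\<And>n z. an n \<le> z \<Longrightarrow> z \<le> bn n \<Longrightarrow> \<bar>pn n z\<bar> \<le> 1" by metis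
  have wlim: "w \<longlonglongrightarrow> s"
  proof (rule tendsto_sandwich[of "\<lambda>n. s - 1 / Suc n" _ _ "\<lambda>_. s"])
    show "(\<lambda>n. s - 1 / Suc n) \<longlonglongrightarrow> s"
      using tendsto_diff[OF tendsto_const LIMSEQ_Suc[OF lim_1_over_n], of s] by simp
  qed (use seq(1) in \<open>auto intro!: always_eventually less_imp_le\<close>)
  obtain x r where x: "x \<in> {- R..R}" and r: "strict_mono r" and xlim: "(xn \<circ> r) \<longlonglongrightarrow> x"
    using seq(9) compact_Icc[of "- R" R] unfolding compact_def by metis
  have wr: "(\<lambda>n. w (r n)) \<longlonglongrightarrow> s" using LIMSEQ_subseq_LIMSEQ[OF wlim r] by (simp add: o_def)
  have xr: "(\<lambda>n. xn (r n)) \<longlonglongrightarrow> x" using xlim by (simp add: o_def)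
  obtain p t where p: "sol s p t" "p x = 1" "t x = 0" by (rule sol_exists)
  \<comment> \<open>So far the bound reaches only up to the first zero of \<open>p\<close>; the
    absence of zeros is shown afterwards with its help.\<close>
  have right: "\<bar>p z\<bar> \<le> 1" if "x \<le> z" "\<And>y. x \<le> y \<Longrightarrow> y \<le> z \<Longrightarrow> p y \<noteq> 0" for z
    by (rule limit_bound_right[where w = "\<lambda>n. w (r n)" and xn = "\<lambda>n. xn (r n)" and pn = "\<lambda>n. pn (r n)" and
          tn = "\<lambda>n. tn (r n)" and bn = "\<lambda>n. bn (r n)", OF p(1) seq(2) wr xr p(2,3) seq(7,8,4,6) _ that])
       (use seq(3) in \<open>auto intro!: seq(10) intro: order_trans[OF less_imp_le]\<close>)
  have left: "\<bar>p z\<bar> \<le> 1" if z: "z \<le> x" "\<And>y. z \<le> y \<Longrightarrow> y \<le> x \<Longrightarrow> p y \<noteq> 0" for z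
  proof -
    have "\<bar>p (- (- z))\<bar> \<le> 1"
    proof (rule r.limit_bound_right[where w = "\<lambda>n. w (r n)" and xn = "\<lambda>n. - xn (r n)" and pn = "\<lambda>n z. pn (r n) (- z)" and
          tn = "\<lambda>n z. - tn (r n) (- z)" and bn = "\<lambda>n. - an (r n)" and p = "\<lambda>z. p (- z)" and t = "\<lambda>z. - t (- z)"
          and x = "- x" and z = "- z"])
      show "\<bar>pn (r n) (- y)\<bar> \<le> 1" if "- xn (r n) \<le> y" "y \<le> - an (r n)" for n y
        using that seq(4)[of "r n"] by (intro seq(10)) auto
      show "p (- y) \<noteq> 0" if "- x \<le> y" "y \<le> - z" for y using that by (intro z) auto
      show "(\<lambda>n. - xn (r n)) \<longlonglongrightarrow> - x" by (intro tendsto_minus xr)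
    qed (use z p seq wr in \<open>auto intro!: sl_solution_reflect\<close>)
    thus ?thesis by simp
  qed
  \<comment> \<open>If \<open>p\<close> has no zero on one side of \<open>x\<close>, it is bounded
    there, and a bounded solution with a zero yields conjugate points; zeros on both sides are
    conjugate themselves. Both are excluded at \<open>s\<close>.\<close>
  have nz: "p c \<noteq> 0" for c
  proof
    assume c: "p c = 0"
    have "\<exists>y\<ge>x. p y = 0"
    proof (rule ccontr)
      assume *: "\<not> ?thesis"
      have "conjugate_points A B g s"
        by (rule conjugate_if_bounded_zero[OF p(1) s0 _ _ c, of 1 x])
           (use right * x p(2) in auto)
      thus False using ns by simp
    qed
    moreover have "\<exists>y\<le>x. p y = 0"
    proof (rule ccontr)
      assume *: "\<not> ?thesis"
      have "conjugate_points (- B) (- A) (\<lambda>z. g (- z)) s"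
      proof (rule r.conjugate_if_bounded_zero[OF sl_solution_reflect[OF p(1)] s0, of 1 "- x" "- c"])
        fix z assume "R \<le> z"
        thus "\<bar>p (- z)\<bar> \<le> 1" using * x by (intro left) auto
      qed (use p(2) c in auto)
      hence "conjugate_points A B g s" by (rule conjugate_points_reflect)
      thus False using ns by simp
    qed
    ultimately obtain y1 y2 where "y1 \<ge> x" "p y1 = 0" "y2 \<le> x" "p y2 = 0" by blast
    moreover from this have "y2 < y1" using p(2) by (metis antisym_conv2 le_less_trans order_trans zero_neq_one not_less)
    ultimately have "conjugate_points A B g s"
      unfolding conjugate_points_def using p by (metis zero_neq_one)
    thus False using ns by simp
  qed
  have pos: "p z > 0" for z
    by (rule positive_if_nonzero[OF sl_solution_cont(1)[OF p(1), of UNIV] _ nz, of x]) (use p in auto)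
  have "p z \<le> 1" for z
    using right[of z] left[of z] nz by (cases "x \<le> z") auto
  thus thesis using that[OF spos p(1) pos] by blast
qed

end

section \<open>Bistable fronts\<close>

locale bistable_front =
  fixes f :: "real \<Rightarrow> real" and u1 u2 A B L :: real and U q :: "real \<Rightarrow> real"
  assumes lip: "\<And>x y. \<bar>f x - f y\<bar> \<le> L * \<bar>x - y\<bar>" and L_pos: "L > 0"
    and u: "0 < u1" "u1 < u2"
    and f_zero: "f 0 = 0" "f u1 = 0" "f u2 = 0"
    and f_sign: "\<And>x. x < 0 \<Longrightarrow> f x > 0" "\<And>x. 0 < x \<Longrightarrow> x < u1 \<Longrightarrow> f x < 0"
      "\<And>x. u1 < x \<Longrightarrow> x < u2 \<Longrightarrow> f x > 0" "\<And>x. u2 < x \<Longrightarrow> f x < 0"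
    and U_deriv: "\<And>z. (U has_real_derivative q z) (at z)"
    and q_cont: "continuous_on UNIV q"
    and q_neg: "\<And>z. z < 0 \<Longrightarrow> (q has_real_derivative - A * q z - f (U z)) (at z)"
    and q_pos: "\<And>z. z > 0 \<Longrightarrow> (q has_real_derivative - B * q z - f (U z)) (at z)"
    and U_bot: "(U \<longlongrightarrow> 0) at_bot" and U_top: "(U \<longlongrightarrow> u2) at_top"
begin

text \<open>The reflection exchanges the stable states 0 and \<open>u2\<close> together with the
  ends of the line, and it preserves \<open>A < B\<close>.\<close>

lemma reflected:
  "bistable_front (\<lambda>x. - f (u2 - x)) (u2 - u1) u2 (- B) (- A) L (\<lambda>z. u2 - U (- z)) (\<lambda>z. q (- z))"
proof
  show "\<bar>- f (u2 - x) - - f (u2 - y)\<bar> \<le> L * \<bar>x - y\<bar>" for x y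
    using lip[of "u2 - x" "u2 - y"] by (simp add: abs_minus_commute)
  show "continuous_on UNIV (\<lambda>z. q (- z))"
    by (intro continuous_on_compose2[OF q_cont] continuous_intros) auto
  have m: "((\<lambda>z. h (- z)) has_real_derivative - d) (at z)" if "(h has_real_derivative d) (at (- z))" for h d z
    using that by (simp flip: DERIV_mirror)
  show "((\<lambda>z. u2 - U (- z)) has_real_derivative q (- z)) (at z)" for z
    using DERIV_diff[OF DERIV_const[of u2] m[OF U_deriv[of "- z"]]] by simp
  show "((\<lambda>z. q (- z)) has_real_derivative - (- B) * q (- z) - - f (u2 - (u2 - U (- z)))) (at z)" if "z < 0" for z
    using m[OF q_pos[of "- z"]] that by (simp add: add.commute)
  show "((\<lambda>z. q (- z)) has_real_derivative - (- A) * q (- z) - - f (u2 - (u2 - U (- z)))) (at z)" if "z > 0" for z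
    using m[OF q_neg[of "- z"]] that by (simp add: add.commute)
  show "((\<lambda>z. u2 - U (- z)) \<longlongrightarrow> 0) at_bot"
    using tendsto_diff[OF tendsto_const filterlim_compose[OF U_top filterlim_uminus_at_top_at_bot], of u2] by simp
  show "((\<lambda>z. u2 - U (- z)) \<longlongrightarrow> u2) at_top"
    using tendsto_diff[OF tendsto_const filterlim_compose[OF U_bot filterlim_uminus_at_bot_at_top], of u2] by simp
qed (use L_pos u f_zero f_sign in auto)

lemma q_deriv: "z \<noteq> 0 \<Longrightarrow> (q has_real_derivative - (if z < 0 then A else B) * q z - f (U z)) (at z)"
  using q_neg[of z] q_pos[of z] by (cases "z < 0") auto

lemma U_cont: "continuous_on S U"
  by (rule continuous_at_imp_continuous_on) (use U_deriv in \<open>auto intro: DERIV_isCont\<close>)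

lemma q_cont': "continuous_on S q"
  using q_cont by (rule continuous_on_subset) auto

lemma f_cont: "continuous_on S f"
proof (rule lipschitz_on_continuous_on[of L])
  show "L-lipschitz_on S f"
    using lip L_pos by (auto simp: lipschitz_on_def dist_real_def)
qed

text \<open>\<open>(e, 0)\<close> is an equilibrium for both values of the friction, so the squared
  distance to it obeys a Gronwall estimate across 0 regardless of the jump.\<close>

lemma equilibrium_constant:
  assumes "f e = 0" "U z0 = e" "q z0 = 0"
  shows "U z = e"
proof -
  define W where "W z = (U z - e)\<^sup>2 + (q z)\<^sup>2" for z
  define W' where "W' z = 2 * (U z - e) * q z + 2 * q z * (- (if z < 0 then A else B) * q z - f (U z))" for z
  define m where "m = max \<bar>A\<bar> \<bar>B\<bar>"
  define M where "M = 1 + 2 * m + L"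
  have M: "M > 0" using L_pos by (simp add: M_def m_def)
  have "W z \<le> (W z0 + 0 / M) * exp (M * \<bar>z - z0\<bar>) - 0 / M"
  proof (rule gronwall_off_zero[OF _ M order_refl, where a = "min z z0" and b = "max z z0"])
    show "continuous_on {min z z0..max z z0} W"
      unfolding W_def by (intro continuous_intros U_cont q_cont')
    fix y :: real assume y: "y \<noteq> 0"
    show "(W has_real_derivative W' y) (at y)"
      unfolding W_def W'_def by (auto intro!: derivative_eq_intros U_deriv q_deriv[OF y])
    define a where "a = (if y < 0 then A else B)"
    define x s where "x = \<bar>U y - e\<bar>" and "s = \<bar>q y\<bar>"
    have fb: "\<bar>f (U y)\<bar> \<le> L * x" using lip[of "U y" e] assms(1) by (simp add: x_def)
    have am: "\<bar>a\<bar> \<le> m" by (simp add: a_def m_def)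
    have xs: "2 * (x * s) \<le> x\<^sup>2 + s\<^sup>2" using sum_squares_bound[of x s] by simp
    have "\<bar>W' y\<bar> \<le> \<bar>2 * (U y - e) * q y\<bar> + \<bar>2 * a * (q y)\<^sup>2\<bar> + \<bar>2 * q y * f (U y)\<bar>"
      unfolding W'_def a_def[symmetric] by (simp add: power2_eq_square algebra_simps)
    also have "\<dots> = 2 * (x * s) + 2 * (\<bar>a\<bar> * s\<^sup>2) + 2 * (s * \<bar>f (U y)\<bar>)"
      unfolding x_def s_def by (simp only: abs_mult) simp
    also have "\<dots> \<le> 2 * (x * s) + 2 * (m * s\<^sup>2) + 2 * (s * (L * x))"
      by (intro add_mono mult_left_mono mult_right_mono fb am) (auto simp: s_def)
    also have "\<dots> = 2 * (x * s) * (1 + L) + 2 * m * s\<^sup>2" by (simp add: algebra_simps)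
    also have "\<dots> \<le> (x\<^sup>2 + s\<^sup>2) * (1 + L) + 2 * m * (x\<^sup>2 + s\<^sup>2)"
      using xs L_pos by (intro add_mono mult_right_mono mult_left_mono) (auto simp: m_def)
    also have "\<dots> = M * W y + 0"
      by (simp add: M_def W_def x_def s_def algebra_simps)
    finally show "\<bar>W' y\<bar> \<le> M * W y + 0" .
  qed auto
  hence "(U z - e)\<^sup>2 + (q z)\<^sup>2 \<le> 0" using assms by (simp add: W_def)
  thus ?thesis by (simp add: sum_power2_le_zero_iff)
qed

lemma no_equilibrium: "\<not> (f (U z) = 0 \<and> q z = 0)"
proof
  assume *: "f (U z) = 0 \<and> q z = 0"
  define e where "e = U z"
  have c: "U = (\<lambda>_. e)"
  proof
    show "U x = e" for x by (rule equilibrium_constant[of e z]) (use * in \<open>auto simp: e_def\<close>)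
  qed
  have "e = 0" "e = u2"
    using U_bot U_top unfolding c by (auto simp: tendsto_const_iff)
  thus False using u by simp
qed

text \<open>Convergence of \<open>U\<close> gives a small value of \<open>q\<close> in each late
  unit interval by the mean value theorem. It is carried back to \<open>z\<close> by
  \<open>q + B * U\<close>, whose derivative \<open>- f (U y)\<close> is small.\<close>

lemma q_top: "(q \<longlongrightarrow> 0) at_top"
proof (rule tendstoI)
  fix \<epsilon> :: real assume \<epsilon>: "\<epsilon> > 0"
  \<comment> \<open>The total error is \<open>(2 + 2 * \<bar>B\<bar> + L) * e\<close>; the
    additional 2 makes the inequality strict.\<close>
  define e where "e = \<epsilon> / (4 + 2 * \<bar>B\<bar> + L)"
  have D: "4 + 2 * \<bar>B\<bar> + L > 0" using L_pos by (intro add_pos_nonneg add_pos_pos) auto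
  have e: "e > 0" using \<epsilon> D by (simp add: e_def)
  have "\<forall>\<^sub>F z in at_top. dist (U z) u2 < e" using U_top e by (rule tendstoD)
  then obtain N where N: "\<And>z. z \<ge> N \<Longrightarrow> \<bar>U z - u2\<bar> < e"
    by (auto simp: eventually_at_top_linorder dist_real_def)
  have "dist (q z) 0 < \<epsilon>" if z: "z \<ge> max N 1" for z
  proof -
    obtain \<xi> where \<xi>: "z < \<xi>" "\<xi> < z + 1" "U (z + 1) - U z = (z + 1 - z) * q \<xi>"
      using MVT2[of z "z + 1" U q] U_deriv by auto
    define h where "h y = q y + B * U y" for y
    have hd: "(h has_real_derivative - f (U y)) (at y)" if "y > 0" for y
      unfolding h_def by (auto intro!: derivative_eq_intros U_deriv q_pos[OF that])
    obtain \<eta> where \<eta>: "z < \<eta>" "\<eta> < \<xi>" "h \<xi> - h z = (\<xi> - z) * (- f (U \<eta>))"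
      using MVT2[of z \<xi> h "\<lambda>y. - f (U y)"] hd \<xi> z by force
    have "\<bar>f (U \<eta>)\<bar> \<le> L * \<bar>U \<eta> - u2\<bar>" using lip[of "U \<eta>" u2] f_zero by simp
    also have "\<dots> \<le> L * e" using N[of \<eta>] \<eta> z L_pos by (intro mult_left_mono) auto
    finally have "\<bar>f (U \<eta>)\<bar> \<le> L * e" .
    hence "\<bar>h \<xi> - h z\<bar> \<le> 1 * (L * e)"
      unfolding \<eta>(3) abs_mult using \<xi> by (intro mult_mono) auto
    moreover have "\<bar>q \<xi>\<bar> \<le> 2 * e" using \<xi>(3) N[of z] N[of "z + 1"] z by simp
    moreover have "\<bar>B * (U \<xi> - U z)\<bar> \<le> \<bar>B\<bar> * (2 * e)"
      unfolding abs_mult using N[of z] N[of \<xi>] z \<xi> by (intro mult_left_mono) auto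
    moreover have "q z = q \<xi> + B * (U \<xi> - U z) - (h \<xi> - h z)" by (simp add: h_def algebra_simps)
    ultimately have "\<bar>q z\<bar> \<le> 2 * e + \<bar>B\<bar> * (2 * e) + L * e" by linarith
    also have "\<dots> < (4 + 2 * \<bar>B\<bar> + L) * e" using e by (simp add: algebra_simps)
    also have "\<dots> = \<epsilon>" using D by (simp add: e_def)
    finally show ?thesis by simp
  qed
  thus "\<forall>\<^sub>F z in at_top. dist (q z) 0 < \<epsilon>" unfolding eventually_at_top_linorder by blast
qed

lemma q_bot: "(q \<longlongrightarrow> 0) at_bot"
proof -
  interpret r: bistable_front "\<lambda>x. - f (u2 - x)" "u2 - u1" u2 "- B" "- A" L "\<lambda>z. u2 - U (- z)" "\<lambda>z. q (- z)"
    by (rule reflected)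
  show ?thesis
    using filterlim_compose[OF r.q_top filterlim_uminus_at_top_at_bot] by simp
qed

text \<open>While \<open>U > u1\<close>, the function \<open>weight A B z * (U - u2) * q\<close> is nondecreasing; hence a zero of
  \<open>q\<close> there would force \<open>\<bar>U - u2\<bar>\<close> to be nondecreasing from then on.\<close>

lemma q_nonzero_beyond:
  assumes above: "\<And>y. z \<le> y \<Longrightarrow> u1 < U y"
  shows "q z \<noteq> 0"
proof
  assume qz: "q z = 0"
  define m where "m y = weight A B y * ((U y - u2) * q y)" for y
  have sgn: "(U y - u2) * f (U y) \<le> 0" if "z \<le> y" for y
    using f_sign(3,4)[of "U y"] above[OF that] f_zero
    by (cases "U y" u2 rule: linorder_cases) (auto simp: mult_le_0_iff)
  have m0: "m z \<le> m y" if "z \<le> y" for y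
  proof (rule nondecreasing_off_zero[OF that])
    show "continuous_on {z..y} m"
      unfolding m_def by (intro continuous_intros weight_cont U_cont q_cont')
    fix w assume w: "z < w" "w < y" "w \<noteq> 0"
    show "(m has_real_derivative weight A B w * ((q w)\<^sup>2 - (U w - u2) * f (U w))) (at w)"
      unfolding m_def
      by (auto intro!: derivative_eq_intros U_deriv q_deriv[OF w(3)] weight_has_derivative[OF w(3)]
          simp: power2_eq_square algebra_simps)
    show "0 \<le> weight A B w * ((q w)\<^sup>2 - (U w - u2) * f (U w))"
    proof (rule mult_nonneg_nonneg)
      show "0 \<le> (q w)\<^sup>2 - (U w - u2) * f (U w)"
        using sgn[of w] w zero_le_power2[of "q w"] by linarith
    qed (simp add: less_imp_le)
  qed
  have mono: "(U y - u2)\<^sup>2 \<le> (U y' - u2)\<^sup>2" if "z \<le> y" "y \<le> y'" for y y'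
  proof (rule DERIV_nonneg_imp_nondecreasing[OF that(2)])
    fix w assume "y \<le> w" "w \<le> y'"
    hence "0 \<le> m w" using m0[of w] that qz by (simp add: m_def)
    hence "(U w - u2) * q w \<ge> 0" by (metis m_def mult_pos_neg not_le weight_simps(1))
    thus "\<exists>d. ((\<lambda>w. (U w - u2)\<^sup>2) has_real_derivative d) (at w) \<and> 0 \<le> d"
      by (intro exI[of _ "2 * ((U w - u2) * q w)"]) (auto intro!: derivative_eq_intros U_deriv)
  qed
  have "((\<lambda>w. (U w - u2)\<^sup>2) \<longlongrightarrow> (u2 - u2)\<^sup>2) at_top"
    by (intro tendsto_intros U_top)
  hence "(U z - u2)\<^sup>2 \<le> (u2 - u2)\<^sup>2"
    by (rule tendsto_lowerbound) (use mono[of z] in \<open>auto simp: eventually_at_top_linorder\<close>)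
  hence "U z = u2" by simp
  thus False using no_equilibrium[of z] qz f_zero by simp
qed

text \<open>Where \<open>U \<le> u1\<close>, the potential \<open>F\<close> is negative except at 0,
  so nonnegative energy forbids zeros of \<open>q\<close> there; a zero of \<open>q\<close> at
  \<open>U = 0\<close> would be an equilibrium. After the last passage through \<open>u1\<close>,
  \<open>q_nonzero_beyond\<close> takes over.\<close>

lemma increasing_if_energy_nonneg:
  assumes F: "\<And>x. (F has_real_derivative f x) (at x)" "F 0 = 0"
    and energy: "\<And>z. (q z)\<^sup>2 / 2 + F (U z) \<ge> 0"
  shows "q z > 0"
proof -
  have Fneg: "F x < 0" if "x \<le> u1" "x \<noteq> 0" for x
  proof (cases "x < 0")
    case True
    obtain z where "x < z" "z < 0" "F 0 - F x = (0 - x) * f z"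
      using MVT2[OF True, of F f] F(1) by blast
    thus ?thesis using F(2) f_sign(1)[of z] True by (simp add: mult_neg_pos)
  next
    case False
    hence x: "0 < x" using that by simp
    obtain z where "0 < z" "z < x" "F x - F 0 = (x - 0) * f z"
      using MVT2[OF x, of F f] F(1) by blast
    thus ?thesis using F(2) f_sign(2)[of z] that x by (simp add: mult_pos_neg)
  qed
  have below: "q y \<noteq> 0" if "U y \<le> u1" for y
  proof
    assume q0: "q y = 0"
    hence "F (U y) \<ge> 0" using energy[of y] by simp
    hence "U y = 0" using Fneg[OF that] by force
    thus False using no_equilibrium[of y] q0 f_zero by simp
  qed
  define S where "S = {z. U z \<le> u1}"
  have clS: "closed S" unfolding S_def by (intro closed_Collect_le U_cont continuous_intros)
  have "\<forall>\<^sub>F z in at_bot. U z < u1" using U_bot u by (intro order_tendstoD) auto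
  hence neS: "S \<noteq> {}" unfolding S_def eventually_at_bot_linorder by (auto intro: less_imp_le)
  have "\<forall>\<^sub>F z in at_top. U z > u1" using U_top u by (intro order_tendstoD) auto
  then obtain N where N: "\<And>z. z \<ge> N \<Longrightarrow> U z > u1" unfolding eventually_at_top_linorder by blast
  have bdS: "bdd_above S"
  proof (rule bdd_aboveI[of _ N])
    fix x assume "x \<in> S"
    thus "x \<le> N" using N[of x] by (force simp: S_def)
  qed
  \<comment> \<open>The last passage of \<open>U\<close> through \<open>u1\<close>; afterwards
    \<open>U\<close> stays above \<open>u1\<close>.\<close>
  define zp where "zp = Sup S"
  have zpS: "U zp \<le> u1" using closed_contains_Sup[OF neS bdS clS] by (simp add: S_def zp_def)
  have above: "U y > u1" if "y > zp" for y
    using cSup_upper[OF _ bdS, of y] that unfolding zp_def by (force simp: S_def)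
  have Uzp: "U zp = u1"
  proof (rule antisym[OF zpS])
    have "(U \<longlongrightarrow> U zp) (at_right zp)"
      using U_cont[of UNIV] by (auto simp: continuous_on_def intro: tendsto_within_subset)
    thus "u1 \<le> U zp"
      by (rule tendsto_lowerbound) (use above in \<open>auto simp: eventually_at_right_less eventually_at_filter less_imp_le\<close>)
  qed
  have "\<not> q zp < 0"
  proof
    assume "q zp < 0"
    then obtain e where e: "e > 0" "\<And>h. 0 < h \<Longrightarrow> h < e \<Longrightarrow> U (zp + h) < U zp"
      using DERIV_neg_dec_right[OF U_deriv] by blast
    from e(2)[of "e / 2"] e(1) show False using above[of "zp + e / 2"] Uzp by simp
  qed
  hence qzp: "q zp > 0" using below[of zp] Uzp by force
  show ?thesis
  proof (cases "z > zp")
    case True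
    show ?thesis
    proof (rule positive_if_nonzero[OF q_cont', of "{zp..}" zp])
      show "q x \<noteq> 0" if "x \<in> {zp..}" for x
        using q_nonzero_beyond[of x] above that qzp by (cases "x = zp") auto
    qed (use qzp True in auto)
  next
    case False
    show ?thesis
    proof (rule ccontr)
      assume neg: "\<not> q z > 0"
      define T where "T = {z..zp} \<inter> {y. q y \<le> 0}"
      have clT: "closed T" unfolding T_def by (intro closed_Int closed_Collect_le q_cont' continuous_intros)
      have neT: "z \<in> T" using neg False by (simp add: T_def)
      have bdT: "bdd_above T" by (rule bdd_aboveI[of _ zp]) (auto simp: T_def)
      \<comment> \<open>The last point before \<open>zp\<close> at which \<open>q\<close> is not
        positive. From there \<open>U\<close> increases up to \<open>u1\<close>, so \<open>q\<close>
        vanishes at a level where this is excluded.\<close>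
      define zt where "zt = Sup T"
      have zt: "zt \<in> T" unfolding zt_def using closed_contains_Sup[OF _ bdT clT] neT by blast
      have ztp: "zt < zp" "q zt \<le> 0" using zt qzp by (auto simp: T_def less_le)
      have after: "q y > 0" if "zt < y" "y \<le> zp" for y
        using cSup_upper[OF _ bdT, of y] that zt unfolding zt_def[symmetric] by (force simp: T_def)
      have "q zt \<ge> 0"
      proof -
        have "(q \<longlongrightarrow> q zt) (at_right zt)"
          using q_cont by (auto simp: continuous_on_def intro: tendsto_within_subset)
        moreover have "\<forall>\<^sub>F y in at_right zt. 0 \<le> q y"
          using eventually_at_right_real[OF ztp(1)]
          by eventually_elim (use after in \<open>auto simp: less_imp_le\<close>)
        ultimately show ?thesis by (intro tendsto_lowerbound[of q]) auto
      qed
      moreover have "U zt \<le> U zp"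
        by (rule DERIV_nonneg_imp_increasing_open[of zt zp U])
           (use ztp after U_deriv U_cont in \<open>auto intro: less_imp_le\<close>)
      ultimately show False using below[of zt] ztp Uzp by simp
    qed
  qed
qed

theorem increasing:
  assumes "A < B"
  shows "q z > 0"
proof -
  obtain F where F: "\<And>x. (F has_real_derivative f x) (at x)" "F 0 = 0"
    using antiderivative_vanishing_at[OF f_cont] by blast
  define E where "E z = (q z)\<^sup>2 / 2 + F (U z)" for z
  have Fc: "isCont F x" for x using F(1) by (rule DERIV_isCont)
  have Ec: "continuous_on S E" for S
    unfolding E_def using Fc
    by (intro continuous_intros q_cont' continuous_on_compose2[OF _ U_cont, of UNIV F])
       (auto intro: continuous_at_imp_continuous_on)
  have Ed: "(E has_real_derivative - (if y < 0 then A else B) * (q y)\<^sup>2) (at y)" if "y \<noteq> 0" for y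
    unfolding E_def
    by (auto intro!: derivative_eq_intros q_deriv[OF that] DERIV_chain2[OF F(1)] U_deriv simp: power2_eq_square field_simps)
  have "(E \<longlongrightarrow> 0\<^sup>2 / 2 + F 0) at_bot" unfolding E_def
    by (intro tendsto_intros q_bot isCont_tendsto_compose[OF Fc] U_bot) auto
  hence Ebot: "(E \<longlongrightarrow> 0) at_bot" using F by simp
  have "(E \<longlongrightarrow> 0\<^sup>2 / 2 + F u2) at_top" unfolding E_def
    by (intro tendsto_intros q_top isCont_tendsto_compose[OF Fc] U_top) auto
  hence Etop: "(E \<longlongrightarrow> F u2) at_top" by simp
  have inc: "E x \<le> E y" if "x \<le> y" "x < 0 \<Longrightarrow> A \<le> 0" "0 < y \<Longrightarrow> B \<le> 0" for x y
    by (rule nondecreasing_off_zero[OF that(1) Ec Ed]) (use that(2,3) in \<open>auto simp: mult_le_0_iff zero_le_mult_iff\<close>)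
  have dec: "E y \<le> E x" if "x \<le> y" "x < 0 \<Longrightarrow> A \<ge> 0" "0 < y \<Longrightarrow> B \<ge> 0" for x y
  proof -
    have "- E x \<le> - E y"
      by (rule nondecreasing_off_zero[OF that(1) _ DERIV_minus[OF Ed]])
         (use that(2,3) in \<open>auto intro!: continuous_intros Ec simp: mult_le_0_iff zero_le_mult_iff\<close>)
    thus ?thesis by simp
  qed
  have E0: "E y \<ge> 0" if "A \<le> 0" "0 < y \<Longrightarrow> B \<le> 0" for y
    by (rule tendsto_upperbound[OF Ebot]) (use inc[of _ y] that in \<open>auto simp: eventually_at_bot_linorder\<close>)
  have E2: "E y \<ge> F u2" if "B \<ge> 0" "y < 0 \<Longrightarrow> A \<ge> 0" for y
    by (rule tendsto_upperbound[OF Etop]) (use dec[of y] that in \<open>auto simp: eventually_at_top_linorder\<close>)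
  \<comment> \<open>The energy is monotone if the friction has one sign. For
    \<open>A \<le> 0 \<le> B\<close> it rises up to 0 and then falls, so it stays above the smaller
    of its limits. The remaining pattern, a valley at 0, is what \<open>A < B\<close>
    excludes.\<close>
  have "(\<forall>y. E y \<ge> 0) \<or> (\<forall>y. E y \<ge> F u2)"
  proof -
    consider "B \<le> 0" | "A \<ge> 0" | "A \<le> 0" "0 \<le> B" by linarith
    thus ?thesis
    proof cases
      case 1 thus ?thesis using E0 assms by auto
    next
      case 2 thus ?thesis using E2 assms by auto
    next
      case 3
      have "E y \<ge> 0 \<or> 0 \<le> y" "E y \<ge> F u2 \<or> y < 0" for y using 3 E0[of y] E2[of y] by force+
      hence "E y \<ge> min 0 (F u2)" for y by (smt (verit, best))
      thus ?thesis by (smt (verit, best))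
    qed
  qed
  thus ?thesis
  proof
    assume "\<forall>y. E y \<ge> 0"
    thus ?thesis by (intro increasing_if_energy_nonneg[OF F]) (simp add: E_def)
  next
    \<comment> \<open>After reflection the energy is measured from \<open>u2\<close>, which takes
      over the part of 0.\<close>
    assume E: "\<forall>y. E y \<ge> F u2"
    interpret r: bistable_front "\<lambda>x. - f (u2 - x)" "u2 - u1" u2 "- B" "- A" L "\<lambda>z. u2 - U (- z)" "\<lambda>z. q (- z)"
      by (rule reflected)
    have "q (- (- z)) > 0"
    proof (rule r.increasing_if_energy_nonneg[where F = "\<lambda>x. F (u2 - x) - F u2"])
      show "((\<lambda>x. F (u2 - x) - F u2) has_real_derivative - f (u2 - x)) (at x)" for x
        by (auto intro!: derivative_eq_intros DERIV_chain2[OF F(1)])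
      show "0 \<le> (q (- z))\<^sup>2 / 2 + (F (u2 - (u2 - U (- z))) - F u2)" for z
        using E[rule_format, of "- z"] by (simp add: E_def)
    qed simp
    thus ?thesis by simp
  qed
qed

end

section \<open>Linearization at a smooth front\<close>

locale smooth_bistable_front = bistable_front +
  fixes f' :: "real \<Rightarrow> real" and K :: real
  assumes f_deriv: "\<And>x. (f has_real_derivative f' x) (at x)"
    and f'_cont: "continuous_on UNIV f'"
    and f'_bound: "\<And>x. \<bar>f' x\<bar> \<le> K"
    and f'_neg: "f' 0 < 0" "f' u2 < 0"
begin

lemma smooth_reflected:
  "smooth_bistable_front (\<lambda>x. - f (u2 - x)) (u2 - u1) u2 (- B) (- A) L (\<lambda>z. u2 - U (- z)) (\<lambda>z. q (- z))
     (\<lambda>x. f' (u2 - x)) K"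
proof (intro smooth_bistable_front.intro reflected smooth_bistable_front_axioms.intro)
  show "((\<lambda>x. - f (u2 - x)) has_real_derivative f' (u2 - x)) (at x)" for x
    by (auto intro!: derivative_eq_intros DERIV_chain2[OF f_deriv])
  show "continuous_on UNIV (\<lambda>x. f' (u2 - x))"
    by (intro continuous_on_compose2[OF f'_cont] continuous_intros) auto
qed (use f'_bound f'_neg in auto)

lemma tail_right: "\<exists>R>0. \<exists>\<delta>>0. \<forall>z\<ge>R. f' (U z) \<le> - \<delta> \<and> \<bar>q z\<bar> \<le> 1"
proof -
  have "isCont f' u2" using f'_cont by (simp add: continuous_on_eq_continuous_at)
  hence "((\<lambda>z. f' (U z)) \<longlongrightarrow> f' u2) at_top" using U_top by (rule isCont_tendsto_compose)
  hence "\<forall>\<^sub>F z in at_top. f' (U z) < f' u2 / 2" using f'_neg by (intro order_tendstoD) auto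
  moreover have "\<forall>\<^sub>F z in at_top. dist (q z) 0 < 1" using q_top by (rule tendstoD) simp
  ultimately have "\<forall>\<^sub>F z in at_top. f' (U z) \<le> f' u2 / 2 \<and> \<bar>q z\<bar> \<le> 1"
    by eventually_elim auto
  then obtain N where N: "\<And>z. z \<ge> N \<Longrightarrow> f' (U z) \<le> f' u2 / 2 \<and> \<bar>q z\<bar> \<le> 1"
    by (auto simp: eventually_at_top_linorder)
  show ?thesis
    by (intro exI[of _ "max N 1"] conjI exI[of _ "- f' u2 / 2"]) (use N f'_neg in auto)
qed

lemma tails:
  obtains R \<delta> where "sturm_liouville (\<lambda>z. f' (U z)) R \<delta> K" "\<And>z. R \<le> \<bar>z\<bar> \<Longrightarrow> \<bar>q z\<bar> \<le> 1"
proof -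
  interpret r: smooth_bistable_front "\<lambda>x. - f (u2 - x)" "u2 - u1" u2 "- B" "- A" L "\<lambda>z. u2 - U (- z)" "\<lambda>z. q (- z)"
     "\<lambda>x. f' (u2 - x)" K by (rule smooth_reflected)
  obtain R1 d1 where 1: "R1 > 0" "d1 > 0" "\<And>z. z \<ge> R1 \<Longrightarrow> f' (U z) \<le> - d1 \<and> \<bar>q z\<bar> \<le> 1"
    using tail_right by blast
  obtain R2 d2 where 2: "R2 > 0" "d2 > 0" "\<And>z. z \<ge> R2 \<Longrightarrow> f' (U (- z)) \<le> - d2 \<and> \<bar>q (- z)\<bar> \<le> 1"
    using r.tail_right by auto
  have *: "f' (U z) \<le> - min d1 d2 \<and> \<bar>q z\<bar> \<le> 1" if "max R1 R2 \<le> \<bar>z\<bar>" for z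
    using 1(3)[of z] 2(3)[of "- z"] that by (cases "z \<ge> 0") auto
  show thesis
  proof (rule that[of "max R1 R2" "min d1 d2"])
    show "sturm_liouville (\<lambda>z. f' (U z)) (max R1 R2) (min d1 d2) K"
    proof
      show "continuous_on UNIV (\<lambda>z. f' (U z))"
        by (intro continuous_on_compose2[OF f'_cont] U_cont) auto
    qed (use * 1 2 f'_bound in auto)
  qed (use * in auto)
qed

text \<open>Differentiating the front equation for \<open>z < 0\<close> shows that \<open>q\<close>
  solves the linearized equation there; \<open>t 0\<close> is the left-hand limit of
  \<open>q'\<close>. The solution continues across 0 without the jump of \<open>q'\<close>.\<close>

lemma left_branch:
  "\<exists>p t. sl_solution A B (\<lambda>z. f' (U z)) 0 p t \<and> (\<forall>z\<le>0. p z = q z) \<and> t 0 = - A * q 0 - f (U 0)"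
proof -
  obtain R \<delta> where "sturm_liouville (\<lambda>z. f' (U z)) R \<delta> K" by (rule tails)
  then interpret sturm_liouville A B "\<lambda>z. f' (U z)" R \<delta> K .
  obtain p t where p: "sol 0 p t" "p 0 = q 0" "t 0 = - A * q 0 - f (U 0)" by (rule sol_exists)
  define v where "v z = \<rho> z * (- A * q z - f (U z))" for z
  have "p z = q z" if "z \<le> 0" for z
  proof -
    have "q z = p z"
    proof (rule sol_eq_on_interval[OF p(1), of z 0 q v 0 z])
      show "continuous_on {z..0} v"
        unfolding v_def by (intro continuous_intros weight_cont q_cont' U_cont continuous_on_compose2[OF f_cont[of UNIV] U_cont] subset_UNIV)
      fix y assume y: "z < y" "y < 0" "y \<noteq> 0"
      show "(q has_real_derivative v y / \<rho> y) (at y)"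
        using q_neg[OF y(2)] by (simp add: v_def)
      show "(v has_real_derivative \<rho> y * (0 - f' (U y)) * q y) (at y)"
        unfolding v_def using y
        by (auto intro!: derivative_eq_intros weight_has_derivative q_neg DERIV_chain2[OF f_deriv] U_deriv
            simp: algebra_simps)
    qed (use that p q_cont' in \<open>auto simp: v_def\<close>)
    thus ?thesis by simp
  qed
  thus ?thesis using p by blast
qed

lemma right_branch:
  "\<exists>p t. sl_solution A B (\<lambda>z. f' (U z)) 0 p t \<and> (\<forall>z\<ge>0. p z = q z) \<and> t 0 = - B * q 0 - f (U 0)"
proof -
  interpret r: smooth_bistable_front "\<lambda>x. - f (u2 - x)" "u2 - u1" u2 "- B" "- A" L "\<lambda>z. u2 - U (- z)" "\<lambda>z. q (- z)"
     "\<lambda>x. f' (u2 - x)" K by (rule smooth_reflected)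
  obtain p t where p: "sl_solution (- B) (- A) (\<lambda>z. f' (U (- z))) 0 p t" "\<And>z. z \<le> 0 \<Longrightarrow> p z = q (- z)"
    "t 0 = B * q 0 + f (U 0)" using r.left_branch by auto
  have "sl_solution A B (\<lambda>z. f' (U z)) 0 (\<lambda>z. p (- z)) (\<lambda>z. - t (- z))"
    using sl_solution_reflect[OF p(1)] by simp
  thus ?thesis using p by (intro exI[of _ "\<lambda>z. p (- z)"] exI[of _ "\<lambda>z. - t (- z)"]) auto
qed

theorem unstable_mode:
  assumes "B < A"
  obtains \<omega> p t where "\<omega> > 0" "sl_solution A B (\<lambda>z. f' (U z)) \<omega> p t" "\<And>z. p z > 0" "\<And>z. p z \<le> 1"
proof -
  obtain R \<delta> where sl: "sturm_liouville (\<lambda>z. f' (U z)) R \<delta> K" and q1: "\<And>z. R \<le> \<bar>z\<bar> \<Longrightarrow> \<bar>q z\<bar> \<le> 1"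
    using tails by blast
  interpret sturm_liouville A B "\<lambda>z. f' (U z)" R \<delta> K by (rule sl)
  interpret r: sturm_liouville "- B" "- A" "\<lambda>z. f' (U (- z))" R \<delta> K
    using sturm_liouville.reflected[OF sl] .
  obtain y u where y: "sol 0 y u" "\<And>z. z \<le> 0 \<Longrightarrow> y z = q z" "u 0 = - A * q 0 - f (U 0)"
    using left_branch by blast
  obtain p t where p: "sol 0 p t" "\<And>z. z \<ge> 0 \<Longrightarrow> p z = q z" "t 0 = - B * q 0 - f (U 0)"
    using right_branch by blast
  have nontrivial: "\<exists>z. h z \<noteq> 0" if h: "sol 0 h k" "h 0 = q 0" "k 0 = - C * q 0 - f (U 0)" for h k C
  proof (rule ccontr)
    assume *: "\<not> ?thesis"
    hence "h = (\<lambda>_. 0)" by auto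
    hence "(h has_real_derivative 0) (at 0)" by simp
    hence "k 0 / \<rho> 0 = 0" using solD(1)[OF h(1), of 0] DERIV_unique by blast
    thus False using no_equilibrium[of 0] h(2,3) * by simp
  qed
  have bounds: "\<bar>p z\<bar> \<le> 1" "\<bar>y (- z)\<bar> \<le> 1" if "R \<le> z" for z
    using q1[of z] q1[of "- z"] p(2)[of z] y(2)[of "- z"] that R_pos by auto
  have "conjugate_points A B (\<lambda>z. f' (U z)) 0"
  \<comment> \<open>\<open>y\<close> agrees with \<open>q\<close> on the left and \<open>p\<close>
    does on the right, so each is bounded at its own end, and a zero of either yields conjugate
    points directly. This covers every front on which \<open>q\<close> vanishes somewhere.\<close>
  proof (cases "(\<exists>z. y z = 0) \<or> (\<exists>z. p z = 0)")
    case True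
    thus ?thesis
    proof
      assume "\<exists>z. p z = 0"
      thus ?thesis
        using conjugate_if_bounded_zero[OF p(1) _ bounds(1)] nontrivial[OF p(1) _ p(3)] p(2)[of 0] by auto
    next
      assume "\<exists>z. y z = 0"
      then obtain a where a: "y a = 0" by blast
      obtain z where z: "y z \<noteq> 0" using nontrivial[OF y(1) _ y(3)] y(2)[of 0] by auto
      have "conjugate_points (- B) (- A) (\<lambda>z. f' (U (- z))) 0"
        by (rule r.conjugate_if_bounded_zero[OF sl_solution_reflect[OF y(1)] order_refl bounds(2), of "- z" "- a"])
           (use a z in auto)
      thus ?thesis by (rule conjugate_points_reflect)
    qed
  next
    case False
    hence nz: "y z \<noteq> 0" "p z \<noteq> 0" for z by auto
    have q0: "q 0 = y 0" "q 0 = p 0" using y(2)[of 0] p(2)[of 0] by auto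
    define k where "k = sgn (q 0)"
    have k: "k * k = 1" "k * q 0 > 0" "\<bar>k\<bar> = 1" using nz[of 0] q0 by (auto simp: k_def sgn_if)
    have pos: "k * p z > 0" "k * y z > 0" for z
    proof -
      show "k * p z > 0"
        by (rule positive_if_nonzero[of UNIV "\<lambda>z. k * p z" 0])
           (use k nz q0 sl_solution_cont[OF p(1)] in \<open>auto intro!: continuous_intros\<close>)
      show "k * y z > 0"
        by (rule positive_if_nonzero[of UNIV "\<lambda>z. k * y z" 0])
           (use k nz q0 sl_solution_cont[OF y(1)] in \<open>auto intro!: continuous_intros\<close>)
    qed
    \<comment> \<open>At 0 the two solutions share the value \<open>q 0\<close> and their slopes
      differ by the jump, so this Wronskian equals \<open>(B - A) * (q 0)\<^sup>2\<close>, which is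
      negative.\<close>
    have "(k * p 0) * (k * u 0) - (k * y 0) * (k * t 0) \<ge> 0"
    proof (rule principal_wronskian[where \<omega> = 0 and p = "\<lambda>z. k * p z" and t = "\<lambda>z. k * t z"
          and y = "\<lambda>z. k * y z" and u = "\<lambda>z. k * u z" and C = 1 and zi = 0 and x = 0])
    qed (use pos bounds k p y in \<open>auto simp: abs_mult intro: sl_solution_scale\<close>)
    also have "(k * p 0) * (k * u 0) - (k * y 0) * (k * t 0) = (k * k) * ((B - A) * (q 0)\<^sup>2)"
      unfolding q0(1)[symmetric] q0(2)[symmetric] y(3) p(3) by (simp add: power2_eq_square algebra_simps)
    finally have "(B - A) * (q 0)\<^sup>2 \<ge> 0" using k(1) by simp
    moreover have "(q 0)\<^sup>2 > 0" using nz[of 0] q0 by simp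
    ultimately show ?thesis using assms by (simp add: zero_le_mult_iff)
  qed
  from positive_bounded_solution[OF this] show thesis using that by metis
qed

end

section \<open>Weak derivatives and regularity\<close>

text \<open>Differentiation only changes the polynomial, so all derivatives of
  \<open>exp (- 1 / y)\<close> extended by 0 have this form. \<open>flat 1\<close> is
  \<open>activation\<close>, so the same family later yields the smoothness of the reaction.\<close>

definition flat :: "real poly \<Rightarrow> real \<Rightarrow> real" where
  "flat P y = (if y > 0 then poly P (1 / y) * exp (- 1 / y) else 0)"

lemma poly_times_exp_tendsto_0: "((\<lambda>x. poly P x * exp (- x)) \<longlongrightarrow> 0) (at_top :: real filter)"
proof -
  have "((\<lambda>x. \<Sum>i\<le>degree P. coeff P i * (x ^ i / exp x)) \<longlongrightarrow> (\<Sum>i\<le>degree P. coeff P i * 0)) at_top"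
    by (intro tendsto_sum tendsto_mult tendsto_const tendsto_power_div_exp_0)
  thus ?thesis by (simp add: poly_altdef sum_distrib_right exp_minus divide_inverse mult.assoc)
qed

lemma flat_has_derivative:
  "(flat P has_real_derivative flat ([:0, 0, 1:] * (P - pderiv P)) y) (at y)"
proof (cases y "0 :: real" rule: linorder_cases)
  case less
  have "((\<lambda>_. 0) has_real_derivative 0) (at y)" by simp
  hence "(flat P has_real_derivative 0) (at y)"
    by (rule has_field_derivative_transform_within_open[of _ _ _ "{..<0}"]) (use less in \<open>auto simp: flat_def\<close>)
  thus ?thesis using less by (simp add: flat_def)
next
  case greater
  have i: "((\<lambda>y. 1 / y) has_real_derivative - (1 / y\<^sup>2)) (at y)"
    using greater by (auto intro!: derivative_eq_intros simp: power2_eq_square)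
  have e: "((\<lambda>y. exp (- (1 / y))) has_real_derivative exp (- (1 / y)) * (- (- (1 / y\<^sup>2)))) (at y)"
    by (rule DERIV_fun_exp[OF DERIV_minus[OF i]])
  have "((\<lambda>y. poly P (1 / y) * exp (- (1 / y))) has_real_derivative flat ([:0, 0, 1:] * (P - pderiv P)) y) (at y)"
    by (rule DERIV_cong[OF DERIV_mult[OF DERIV_chain2[OF poly_DERIV i] e]])
       (use greater in \<open>simp add: flat_def power2_eq_square algebra_simps\<close>)
  thus ?thesis
    by (rule has_field_derivative_transform_within_open[of _ _ _ "{0<..}"]) (use greater in \<open>auto simp: flat_def\<close>)
next
  case equal
  \<comment> \<open>Dividing by \<open>h\<close> multiplies the polynomial in \<open>1 / h\<close>
    by its variable.\<close>
  have "((\<lambda>h. poly (pCons 0 P) (1 / h) * exp (- (1 / h))) \<longlongrightarrow> 0) (at_right 0)"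
    by (rule filterlim_compose[OF poly_times_exp_tendsto_0 filterlim_inverse_at_top_right[unfolded inverse_eq_divide]])
  hence r: "((\<lambda>h. (flat P (0 + h) - flat P 0) / h) \<longlongrightarrow> 0) (at_right 0)"
  proof (rule Lim_transform_eventually)
    show "\<forall>\<^sub>F h in at_right 0. poly (pCons 0 P) (1 / h) * exp (- (1 / h)) = (flat P (0 + h) - flat P 0) / h"
      using eventually_at_right_less[of 0] by eventually_elim (simp add: flat_def)
  qed
  have "((\<lambda>_. 0 :: real) \<longlongrightarrow> 0) (at_left (0 :: real))" by simp
  hence l: "((\<lambda>h. (flat P (0 + h) - flat P 0) / h) \<longlongrightarrow> 0) (at_left 0)"
  proof (rule Lim_transform_eventually)
    show "\<forall>\<^sub>F h in at_left 0. 0 = (flat P (0 + h) - flat P 0) / h"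
      unfolding eventually_at_filter by (intro always_eventually) (auto simp: flat_def)
  qed
  have "(flat P has_real_derivative 0) (at 0)"
    unfolding DERIV_def using l r by (rule filterlim_split_at)
  thus ?thesis using equal by (simp add: flat_def)
qed

text \<open>The set is closed under \<open>deriv\<close>, so iterated derivatives exist by induction
  without any formula for them.\<close>

inductive_set smooth_algebra :: "(real \<Rightarrow> real) set" where
  flat: "(\<lambda>x. flat P (a * x + b)) \<in> smooth_algebra"
| const: "(\<lambda>_. c) \<in> smooth_algebra"
| add: "f \<in> smooth_algebra \<Longrightarrow> g \<in> smooth_algebra \<Longrightarrow> (\<lambda>x. f x + g x) \<in> smooth_algebra"
| mult: "f \<in> smooth_algebra \<Longrightarrow> g \<in> smooth_algebra \<Longrightarrow> (\<lambda>x. f x * g x) \<in> smooth_algebra"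

lemma smooth_algebra_derivative:
  "f \<in> smooth_algebra \<Longrightarrow> \<exists>f'\<in>smooth_algebra. \<forall>x. (f has_real_derivative f' x) (at x)"
proof (induction rule: smooth_algebra.induct)
  case (flat P a b)
  define Q where "Q = smult a ([:0, 0, 1:] * (P - pderiv P))"
  have "((\<lambda>x. flat P (a * x + b)) has_real_derivative flat Q (a * x + b)) (at x)" for x
    by (rule DERIV_cong[OF DERIV_chain2[OF flat_has_derivative]])
       (auto intro!: derivative_eq_intros simp: flat_def Q_def)
  thus ?case by (intro bexI[of _ "\<lambda>x. flat Q (a * x + b)"] allI smooth_algebra.flat)
next
  case (const c)
  show ?case by (intro bexI[of _ "\<lambda>_. 0"] allI DERIV_const smooth_algebra.const)
next
  case (add f g)
  then obtain f' g' where "f' \<in> smooth_algebra" "g' \<in> smooth_algebra"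
    "\<And>x. (f has_real_derivative f' x) (at x)" "\<And>x. (g has_real_derivative g' x) (at x)" by blast
  thus ?case
    by (intro bexI[of _ "\<lambda>x. f' x + g' x"] allI smooth_algebra.add) (auto intro!: derivative_eq_intros)
next
  case (mult f g)
  then obtain f' g' where "f' \<in> smooth_algebra" "g' \<in> smooth_algebra"
    "\<And>x. (f has_real_derivative f' x) (at x)" "\<And>x. (g has_real_derivative g' x) (at x)" by blast
  thus ?case using mult.hyps
    by (intro bexI[of _ "\<lambda>x. f' x * g x + f x * g' x"] allI smooth_algebra.add smooth_algebra.mult)
       (auto intro!: derivative_eq_intros)
qed

lemma smooth_algebra_deriv:
  assumes "f \<in> smooth_algebra"
  shows "deriv f \<in> smooth_algebra" "(f has_real_derivative deriv f x) (at x)"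
proof -
  obtain f' where f': "f' \<in> smooth_algebra" "\<And>x. (f has_real_derivative f' x) (at x)"
    using smooth_algebra_derivative[OF assms] by blast
  hence "deriv f = f'" by (auto intro: DERIV_imp_deriv)
  thus "deriv f \<in> smooth_algebra" "(f has_real_derivative deriv f x) (at x)" using f' by simp_all
qed

lemma smooth_algebra_cont: "f \<in> smooth_algebra \<Longrightarrow> continuous_on S f"
  by (intro continuous_at_imp_continuous_on ballI DERIV_isCont[OF smooth_algebra_deriv(2)])

text \<open>The algebra provides no primitives, so only the derivative of \<open>\<phi>\<close> is
  asked to lie in it.\<close>

lemma test_function_primitive:
  assumes \<psi>: "\<psi> \<in> smooth_algebra" and d: "\<And>x. (\<phi> has_real_derivative \<psi> x) (at x)"
    and supp: "\<And>x. x \<notin> {a..b} \<Longrightarrow> \<phi> x = 0"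
  shows "test_function \<phi>"
  unfolding test_function_def
proof (intro conjI allI)
  have dphi: "deriv \<phi> = \<psi>" using d by (auto intro: DERIV_imp_deriv)
  have *: "(deriv ^^ n) \<psi> \<in> smooth_algebra" for n
    by (induction n) (use \<psi> smooth_algebra_deriv in auto)
  fix n x
  show "(deriv ^^ n) \<phi> differentiable at x"
  proof (cases n)
    case 0 thus ?thesis using d by (auto simp: real_differentiable_def)
  next
    case (Suc m)
    have "(deriv ^^ n) \<phi> = (deriv ^^ m) \<psi>" using Suc by (simp add: funpow_swap1 dphi)
    thus ?thesis using smooth_algebra_deriv(2)[OF *[of m]] by (auto simp: real_differentiable_def)
  qed
next
  have "closure {x. \<phi> x \<noteq> 0} \<subseteq> {a..b}"
    by (intro closure_minimal subsetI) (use supp in \<open>blast, simp\<close>)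
  thus "compact (closure {x. \<phi> x \<noteq> 0})"
    by (metis bounded_closed_interval bounded_subset closed_closure compact_eq_bounded_closed)
qed

text \<open>Increasing \<open>n\<close> steepens the edges: the bumps tend to the indicator of
  \<open>{a<..<b}\<close> with values in \<open>{0..1}\<close>.\<close>

definition bump :: "nat \<Rightarrow> real \<Rightarrow> real \<Rightarrow> real \<Rightarrow> real" where
  "bump n a b x = flat 1 (real (Suc n) * (x - a)) * flat 1 (real (Suc n) * (b - x))"

lemma bump_smooth: "bump n a b \<in> smooth_algebra"
proof -
  have "bump n a b = (\<lambda>x. flat 1 (real (Suc n) * x + (- real (Suc n) * a)) * flat 1 ((- real (Suc n)) * x + real (Suc n) * b))"
    by (simp add: bump_def algebra_simps fun_eq_iff)
  thus ?thesis by (simp only:) (intro smooth_algebra.intros)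
qed

lemma bump_support: "x \<notin> {a<..<b} \<Longrightarrow> bump n a b x = 0"
  by (auto simp: bump_def flat_def zero_less_mult_iff)

lemma bump_pos: "a < x \<Longrightarrow> x < b \<Longrightarrow> bump n a b x > 0"
  by (simp add: bump_def flat_def)

lemma bump_bounds: "0 \<le> bump n a b x" "bump n a b x \<le> 1"
proof -
  have "0 \<le> flat 1 y" "flat 1 y \<le> 1" for y by (auto simp: flat_def)
  thus "0 \<le> bump n a b x" "bump n a b x \<le> 1"
    unfolding bump_def by (auto intro!: mult_le_one)
qed

lemma bump_limit: "(\<lambda>n. bump n a b x) \<longlonglongrightarrow> indicator {a<..<b} x"
proof (cases "x \<in> {a<..<b}")
  case True
  have "(\<lambda>n. exp (- (1 / real (Suc n)) * (1 / y))) \<longlonglongrightarrow> exp (- 0 * (1 / y))" for y :: real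
    by (intro tendsto_intros LIMSEQ_Suc[OF lim_1_over_n])
  hence "(\<lambda>n. exp (- 1 / (real (Suc n) * y))) \<longlonglongrightarrow> 1" for y :: real by simp
  hence "(\<lambda>n. exp (- 1 / (real (Suc n) * (x - a))) * exp (- 1 / (real (Suc n) * (b - x)))) \<longlonglongrightarrow> 1 * 1"
    by (intro tendsto_mult)
  thus ?thesis using True by (simp add: bump_def flat_def)
qed (simp add: bump_support)

section \<open>Locally integrable functions and the lemma of du Bois-Reymond\<close>

definition locally_integrable :: "(real \<Rightarrow> complex) \<Rightarrow> bool" where
  "locally_integrable h \<longleftrightarrow> (\<forall>a b. set_integrable lborel {a..b} h)"

lemma locally_integrable_continuous:
  "continuous_on UNIV h \<Longrightarrow> locally_integrable h"
  unfolding locally_integrable_def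
  using borel_integrable_atLeastAtMost' continuous_on_subset subset_UNIV by blast

lemma locally_integrable_diff:
  "locally_integrable h \<Longrightarrow> locally_integrable k \<Longrightarrow> locally_integrable (\<lambda>x. h x - k x)"
  unfolding locally_integrable_def by (auto intro: set_integral_diff)

lemma integrable_scaleR_compact_support:
  fixes g :: "real \<Rightarrow> real"
  assumes "locally_integrable h" "g \<in> borel_measurable borel" "\<And>x. \<bar>g x\<bar> \<le> M" "\<And>x. x \<notin> {a..b} \<Longrightarrow> g x = 0"
  shows "integrable lborel (\<lambda>x. g x *\<^sub>R h x)"
proof -
  have h: "integrable lborel (\<lambda>x. indicator {a..b} x *\<^sub>R h x)"
    using assms(1) by (auto simp: locally_integrable_def set_integrable_def)
  have "integrable lborel (\<lambda>x. g x *\<^sub>R (indicator {a..b} x *\<^sub>R h x))"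
  proof (rule Bochner_Integration.integrable_bound[of _ "\<lambda>x. M * norm (indicator {a..b} x *\<^sub>R h x)"])
    show "integrable lborel (\<lambda>x. M * norm (indicator {a..b} x *\<^sub>R h x))"
      by (intro integrable_mult_right integrable_norm h)
    show "(\<lambda>x. g x *\<^sub>R (indicator {a..b} x *\<^sub>R h x)) \<in> borel_measurable lborel"
      using assms(2) borel_measurable_integrable[OF h] by measurable
    show "AE x in lborel. norm (g x *\<^sub>R (indicator {a..b} x *\<^sub>R h x)) \<le> norm (M * norm (indicator {a..b} x *\<^sub>R h x))"
      using assms(3) by (intro AE_I2) (auto simp: abs_mult split: split_indicator intro!: mult_right_mono order_trans[OF assms(3) abs_ge_self])
  qed
  moreover have "g x *\<^sub>R (indicator {a..b} x *\<^sub>R h x) = g x *\<^sub>R h x" for x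
    using assms(4)[of x] by (auto split: split_indicator)
  ultimately show ?thesis by (simp only:)
qed

lemma test_function_derivative:
  assumes "test_function \<phi>"
  shows "(\<phi> has_real_derivative deriv \<phi> x) (at x)" "continuous_on UNIV \<phi>" "continuous_on UNIV (deriv \<phi>)"
proof -
  have "\<phi> differentiable (at x)" "deriv \<phi> differentiable (at x)" for x
    using assms unfolding test_function_def by (metis funpow_0, metis funpow_0 funpow.simps(2) comp_def)
  thus "(\<phi> has_real_derivative deriv \<phi> x) (at x)" "continuous_on UNIV \<phi>" "continuous_on UNIV (deriv \<phi>)"
    by (auto simp: DERIV_deriv_iff_real_differentiable intro!: differentiable_imp_continuous_on differentiable_at_imp_differentiable_on)
qed

lemma test_function_support:
  assumes "test_function \<phi>"
  obtains N where "N > 0" "\<And>x. N \<le> \<bar>x\<bar> \<Longrightarrow> \<phi> x = 0" "\<And>x. N \<le> \<bar>x\<bar> \<Longrightarrow> deriv \<phi> x = 0"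
proof -
  have "bounded (closure {x. \<phi> x \<noteq> 0})"
    using assms compact_imp_bounded by (auto simp: test_function_def)
  hence "bounded {x. \<phi> x \<noteq> 0}" by (rule bounded_subset) (rule closure_subset)
  then obtain M where M: "M > 0" "\<And>x. \<phi> x \<noteq> 0 \<Longrightarrow> \<bar>x\<bar> \<le> M" by (auto simp: bounded_pos)
  show thesis
  proof (rule that[of "M + 1"])
    fix x assume x: "M + 1 \<le> \<bar>x\<bar>"
    show "\<phi> x = 0" using M(2)[of x] x by auto
    have "((\<lambda>_. 0) has_real_derivative 0) (at x)" by simp
    hence "(\<phi> has_real_derivative 0) (at x)"
    proof (rule has_field_derivative_transform_within)
      fix y assume "dist y x < 1"
      hence "\<not> \<bar>y\<bar> \<le> M" using x unfolding dist_real_def by linarith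
      thus "0 = \<phi> y" using M(2)[of y] by auto
    qed (use M in auto)
    thus "deriv \<phi> x = 0" by (rule DERIV_imp_deriv)
  qed (use M in simp)
qed

lemma integrable_test_function_deriv:
  assumes "test_function \<phi>" "locally_integrable h"
  shows "integrable lborel (\<lambda>x. deriv \<phi> x *\<^sub>R h x)"
proof -
  obtain N where N: "N > 0" "\<And>x. N \<le> \<bar>x\<bar> \<Longrightarrow> \<phi> x = 0" "\<And>x. N \<le> \<bar>x\<bar> \<Longrightarrow> deriv \<phi> x = 0"
    using test_function_support[OF assms(1)] by blast
  note c = test_function_derivative(3)[OF assms(1)]
  obtain D where D: "\<And>x. x \<in> {- N..N} \<Longrightarrow> \<bar>deriv \<phi> x\<bar> \<le> D"
    using continuous_bounded_Icc[OF continuous_on_subset[OF c subset_UNIV]] by (metis real_norm_def)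
  have "\<bar>deriv \<phi> x\<bar> \<le> max D 0" for x
    using D[of x] N(3)[of x] by (cases "x \<in> {- N..N}") auto
  thus ?thesis
    by (rule integrable_scaleR_compact_support[OF assms(2) borel_measurable_continuous_onI[OF c], of _ "- N" N])
       (use N(3) in auto)
qed

text \<open>Open intervals form an intersection-stable generator of the Borel sets, so the integral
  vanishes over every Borel set, once \<open>k\<close> is cut off to make it integrable.\<close>

lemma AE_zero_if_interval_integrals_zero:
  assumes k: "locally_integrable k" and zero: "\<And>a b. (LINT x:{a<..<b}|lborel. k x) = 0"
  shows "AE x in lborel. k x = 0"
proof -
  have "AE x in lborel. indicator {- real m<..<real m} x *\<^sub>R k x = 0" for m :: nat
  proof (rule sigma_finite_measure.density_zero[OF sigma_finite_lborel])
    define k0 where "k0 x = indicator {- real m<..<real m} x *\<^sub>R k x" for x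
    have "set_integrable lborel {- real m<..<real m} k"
      by (rule set_integrable_subset[of lborel "{- real m..real m}"]) (use k in \<open>auto simp: locally_integrable_def\<close>)
    hence k0: "integrable lborel k0" by (simp add: set_integrable_def k0_def[abs_def])
    thus "integrable lborel (\<lambda>x. indicator {- real m<..<real m} x *\<^sub>R k x)" by (simp add: k0_def[abs_def])
    define G where "G = range (\<lambda>(a, b). {a<..<b::real})"
    have "(sets borel :: real set set) = sigma_sets UNIV (range (\<lambda>(a, b). box a b))"
      by (subst borel_eq_box) (simp add: sets_measure_of)
    hence sb: "sigma_sets UNIV G = sets borel" by (simp add: G_def box_real)
    have interval: "(LINT x:{a<..<b}|lborel. k0 x) = 0" for a b
    proof -
      have "indicator {a<..<b} x *\<^sub>R k0 x = indicator {max a (- real m)<..<min b (real m)} x *\<^sub>R k x" for x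
        by (auto simp: k0_def split: split_indicator)
      thus ?thesis using zero[of "max a (- real m)" "min b (real m)"] by (simp add: set_lebesgue_integral_def)
    qed
    \<comment> \<open>The integral over the line is needed for complements in the induction.\<close>
    have total: "(LINT x|lborel. k0 x) = 0"
      using zero[of "- real m" "real m"] by (simp add: set_lebesgue_integral_def k0_def)
    have si: "A \<in> sets borel \<Longrightarrow> set_integrable lborel A k0" for A
      unfolding set_integrable_def by (intro integrable_mult_indicator k0) auto
    have "(LINT x:A|lborel. k0 x) = 0" if "A \<in> sigma_sets UNIV G" for A
    proof (rule sigma_sets_induct_disjoint[OF _ _ that])
      have "{a<..<b} \<inter> {c<..<d} = {max a c<..<min b d}" for a b c d :: real by auto
      thus "Int_stable G" unfolding Int_stable_def G_def by auto
      show "(LINT x:A|lborel. k0 x) = 0" if "A \<in> G" for A using that interval by (auto simp: G_def)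
      show "(LINT x:UNIV - A|lborel. k0 x) = 0" if "A \<in> sigma_sets UNIV G" "(LINT x:A|lborel. k0 x) = 0" for A
      proof -
        have A: "A \<in> sets borel" using that sb by simp
        have "(LINT x:A \<union> (UNIV - A)|lborel. k0 x) = (LINT x:A|lborel. k0 x) + (LINT x:UNIV - A|lborel. k0 x)"
          using A by (intro set_integral_Un si) auto
        thus ?thesis using that total by (simp add: set_lebesgue_integral_def)
      qed
      show "(LINT x:(\<Union>i. A i)|lborel. k0 x) = 0"
        if "disjoint_family A" "range A \<subseteq> sigma_sets UNIV G" "\<And>i. (LINT x:A i|lborel. k0 x) = 0" for A :: "nat \<Rightarrow> real set"
      proof -
        have A: "A i \<in> sets borel" for i using that(2) sb by auto
        have "(LINT x:(\<Union>i. A i)|lborel. k0 x) = (\<Sum>i. (LINT x:A i|lborel. k0 x))"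
          using A that(1) by (intro lebesgue_integral_countable_add si) (auto simp: disjoint_family_on_def)
        thus ?thesis using that by simp
      qed
    qed (auto simp: G_def set_lebesgue_integral_def)
    thus "(LINT x:A|lborel. indicator {- real m<..<real m} x *\<^sub>R k x) = 0" if "A \<in> sets lborel" for A
      using that by (simp add: k0_def[abs_def] sb)
  qed
  hence "AE x in lborel. \<forall>m::nat. indicator {- real m<..<real m} x *\<^sub>R k x = 0"
    by (subst AE_all_countable) simp
  thus ?thesis
  proof eventually_elim
    case (elim x)
    obtain m :: nat where "\<bar>x\<bar> < real m" using reals_Archimedean2 by blast
    hence "x \<in> {- real m<..<real m}" by auto
    thus ?case using elim[rule_format, of m] by simp
  qed
qed

text \<open>The derivative of a test function has integral 0. Subtracting the right multiple of one
  fixed bump achieves this for every other bump, and \<open>C\<close> is the normalized integral of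
  \<open>h\<close> against the fixed one.\<close>

lemma du_Bois_Reymond:
  assumes h: "locally_integrable h"
    and zero: "\<And>\<phi>. test_function \<phi> \<Longrightarrow> (LINT x|lborel. deriv \<phi> x *\<^sub>R h x) = 0"
  shows "\<exists>C. AE x in lborel. h x = C"
proof -
  have bc: "continuous_on S (bump n a b)" for S n a b by (rule smooth_algebra_cont[OF bump_smooth])
  have bm [measurable]: "bump n a b \<in> borel_measurable borel" for n a b
    by (rule borel_measurable_continuous_onI[OF bc])
  have bi: "integrable lborel (\<lambda>x. bump n a b x *\<^sub>R k x)" if "locally_integrable k" for k n a b
    by (rule integrable_scaleR_compact_support[OF that bm, where M = 1 and a = a and b = b])
       (use bump_bounds in \<open>auto simp: bump_support\<close>)
  have one: "locally_integrable (\<lambda>_. 1)" by (rule locally_integrable_continuous) simp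
  have "integrable lborel (\<lambda>x. complex_of_real (bump n a b x))" for n a b
    using bi[OF one, of n a b] by (simp add: scaleR_conv_of_real)
  hence br: "integrable lborel (bump n a b)" for n a b
    using integrable_Re[of lborel "\<lambda>x. complex_of_real (bump n a b x)"] by simp
  define I where "I n a b = (LINT x|lborel. bump n a b x)" for n a b
  have I0: "I 0 0 1 \<noteq> 0"
  proof
    assume "I 0 0 1 = 0"
    hence "AE x in lborel. bump 0 0 1 x = 0"
      using integral_nonneg_eq_0_iff_AE[OF br, of 0 0 1] bump_bounds by (simp add: I_def)
    hence "AE x in lborel. x \<notin> {0<..<1::real}" by eventually_elim (use bump_pos[of 0 _ 1 0] in force)
    hence "emeasure lborel {0<..<1::real} = 0" by (subst (asm) AE_iff_measurable[of "{0<..<1}"]) auto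
    thus False by simp
  qed
  define C where "C = (1 / I 0 0 1) *\<^sub>R (LINT x|lborel. bump 0 0 1 x *\<^sub>R h x)"
  have eq: "(LINT x|lborel. bump n a b x *\<^sub>R h x) = I n a b *\<^sub>R C" for n a b
  proof -
    define k where "k = I n a b / I 0 0 1"
    define \<psi> where "\<psi> x = bump n a b x + (- k) * bump 0 0 1 x" for x
    have \<psi>: "\<psi> \<in> smooth_algebra"
      unfolding \<psi>_def[abs_def] by (intro smooth_algebra.add smooth_algebra.mult smooth_algebra.const bump_smooth)
    \<comment> \<open>An interval containing both supports; the primitive starting at
      \<open>lo\<close> vanishes after \<open>hi\<close> because \<open>\<psi>\<close> has integral
      0.\<close>
    define lo hi where "lo = min a 0" and "hi = max b 1"
    have supp: "\<psi> x = 0" if "x \<notin> {lo<..<hi}" for x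
    proof -
      have "bump n a b x = 0" "bump 0 0 1 x = 0"
        by (intro bump_support; use that in \<open>auto simp: lo_def hi_def\<close>)+
      thus ?thesis by (simp add: \<psi>_def)
    qed
    have \<psi>0: "(LINT x|lborel. \<psi> x) = 0"
      unfolding \<psi>_def using br I0 by (simp add: I_def[symmetric] k_def)
    obtain \<phi> where \<phi>: "\<And>x. (\<phi> has_real_derivative \<psi> x) (at x)" "\<phi> lo = 0"
      using antiderivative_vanishing_at[OF smooth_algebra_cont[OF \<psi>]] by blast
    have inc: "(LINT z|lborel. indicator {x..y} z *\<^sub>R \<psi> z) = \<phi> y - \<phi> x" if "x \<le> y" for x y
      using \<phi>(1) by (intro integral_FTC_atLeastAtMost[OF that] smooth_algebra_cont[OF \<psi>])
        (auto simp: has_real_derivative_iff_has_vector_derivative intro: has_vector_derivative_at_within)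
    have "\<phi> x = 0" if "x \<notin> {lo..hi}" for x
    proof (cases "x < lo")
      case True
      have "(LINT z|lborel. indicator {x..lo} z *\<^sub>R \<psi> z) = (LINT z|(lborel :: real measure). (0 :: real))"
        by (rule Bochner_Integration.integral_cong[OF refl]) (use supp in \<open>auto split: split_indicator\<close>)
      thus ?thesis using inc[of x lo] True \<phi>(2) by simp
    next
      case False
      have "lo \<le> hi" by (simp add: lo_def hi_def)
      have "(LINT z|lborel. indicator {lo..x} z *\<^sub>R \<psi> z) = (LINT z|lborel. \<psi> z)"
      proof (rule Bochner_Integration.integral_cong[OF refl])
        show "indicator {lo..x} z *\<^sub>R \<psi> z = \<psi> z" for z
          using False that \<open>lo \<le> hi\<close> supp[of z] by (cases "z \<in> {lo<..<hi}") auto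
      qed
      thus ?thesis using inc[of lo x] False \<phi>(2) \<psi>0 by simp
    qed
    hence "test_function \<phi>" by (rule test_function_primitive[OF \<psi> \<phi>(1)])
    moreover have "deriv \<phi> = \<psi>" using \<phi>(1) by (auto intro: DERIV_imp_deriv)
    ultimately have "(LINT x|lborel. \<psi> x *\<^sub>R h x) = 0" using zero[of \<phi>] by simp
    moreover have "(LINT x|lborel. \<psi> x *\<^sub>R h x) =
        (LINT x|lborel. bump n a b x *\<^sub>R h x + (- k) *\<^sub>R (bump 0 0 1 x *\<^sub>R h x))"
      by (simp add: \<psi>_def scaleR_add_left scaleR_diff_left)
    moreover have "\<dots> = (LINT x|lborel. bump n a b x *\<^sub>R h x) + (LINT x|lborel. (- k) *\<^sub>R (bump 0 0 1 x *\<^sub>R h x))"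
      by (intro Bochner_Integration.integral_add integrable_scaleR_right bi[OF h])
    moreover have "(LINT x|lborel. (- k) *\<^sub>R (bump 0 0 1 x *\<^sub>R h x)) = (- k) *\<^sub>R (LINT x|lborel. bump 0 0 1 x *\<^sub>R h x)"
      by (rule integral_scaleR_right)
    ultimately show ?thesis using I0 by (simp add: k_def C_def)
  qed
  define k where "k x = h x - C" for x
  have k: "locally_integrable k"
    unfolding k_def[abs_def] by (intro locally_integrable_diff h locally_integrable_continuous) simp
  have k0: "(LINT x|lborel. bump n a b x *\<^sub>R k x) = 0" for n a b
  proof -
    have "(LINT x|lborel. bump n a b x *\<^sub>R k x) =
        (LINT x|lborel. bump n a b x *\<^sub>R h x - bump n a b x *\<^sub>R C)"
      by (simp add: k_def scaleR_diff_right)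
    also have "\<dots> = I n a b *\<^sub>R C - I n a b *\<^sub>R C"
      using bi[OF h, of n a b] br[of n a b] eq[of n a b] by (simp add: I_def)
    finally show ?thesis by simp
  qed
  have "(LINT x:{a<..<b}|lborel. k x) = 0" for a b
  proof -
    have kab: "integrable lborel (\<lambda>x. indicator {a..b} x *\<^sub>R k x)"
      using k by (auto simp: locally_integrable_def set_integrable_def)
    have "(\<lambda>n. LINT x|lborel. bump n a b x *\<^sub>R k x) \<longlonglongrightarrow> (LINT x|lborel. indicator {a<..<b} x *\<^sub>R k x)"
    proof (rule integral_dominated_convergence[where w = "\<lambda>x. norm (indicator {a..b} x *\<^sub>R k x)"])
      have "(\<lambda>x. indicator {a<..<b} x *\<^sub>R (indicator {a..b} x *\<^sub>R k x)) \<in> borel_measurable lborel"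
        using borel_measurable_integrable[OF kab] by measurable
      also have "(\<lambda>x. indicator {a<..<b} x *\<^sub>R (indicator {a..b} x *\<^sub>R k x)) = (\<lambda>x. indicator {a<..<b} x *\<^sub>R k x)"
        by (auto simp: fun_eq_iff split: split_indicator)
      finally show "(\<lambda>x. indicator {a<..<b} x *\<^sub>R k x) \<in> borel_measurable lborel" .
      show "(\<lambda>x. bump n a b x *\<^sub>R k x) \<in> borel_measurable lborel" for n
        using bi[OF k] by (rule borel_measurable_integrable)
      show "integrable lborel (\<lambda>x. norm (indicator {a..b} x *\<^sub>R k x))" using kab by (rule integrable_norm)
      show "AE x in lborel. (\<lambda>n. bump n a b x *\<^sub>R k x) \<longlonglongrightarrow> indicator {a<..<b} x *\<^sub>R k x"
        by (intro AE_I2 tendsto_scaleR bump_limit tendsto_const)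
      show "AE x in lborel. norm (bump n a b x *\<^sub>R k x) \<le> norm (indicator {a..b} x *\<^sub>R k x)" for n
      proof (rule AE_I2)
        fix x
        show "norm (bump n a b x *\<^sub>R k x) \<le> norm (indicator {a..b} x *\<^sub>R k x)"
        proof (cases "x \<in> {a..b}")
          case True
          have "\<bar>bump n a b x\<bar> * norm (k x) \<le> 1 * norm (k x)"
            using bump_bounds[of n a b x] by (intro mult_right_mono) auto
          thus ?thesis using True by simp
        qed (auto simp: bump_support)
      qed
    qed
    thus ?thesis unfolding k0 by (simp add: set_lebesgue_integral_def LIMSEQ_const_iff)
  qed
  from AE_zero_if_interval_integrals_zero[OF k this]
  have "AE x in lborel. h x = C" by (simp add: k_def)
  thus ?thesis by blast
qed

text \<open>\<open>Q\<close> need not be differentiable at every point, so integration by parts is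
  done by Fubini, for \<open>deriv \<phi> x *\<^sub>R q y\<close> on the region
  \<open>y \<le> x\<close>.\<close>

lemma integral_deriv_times_primitive:
  assumes q: "locally_integrable q" and Qc: "continuous_on UNIV Q"
    and Q: "\<And>a b. a \<le> b \<Longrightarrow> Q b - Q a = (LINT x:{a..b}|lborel. q x)"
    and \<phi>: "test_function \<phi>"
  shows "(LINT x|lborel. deriv \<phi> x *\<^sub>R Q x) = - (LINT x|lborel. \<phi> x *\<^sub>R q x)"
proof -
  obtain N where N: "N > 0" "\<And>x. N \<le> \<bar>x\<bar> \<Longrightarrow> \<phi> x = 0" "\<And>x. N \<le> \<bar>x\<bar> \<Longrightarrow> deriv \<phi> x = 0"
    using test_function_support[OF \<phi>] by blast
  note d\<phi> = test_function_derivative[OF \<phi>]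
  have m [measurable]: "\<phi> \<in> borel_measurable borel" "deriv \<phi> \<in> borel_measurable borel"
    using d\<phi>(2,3) by (auto intro: borel_measurable_continuous_onI)
  define q1 where "q1 y = indicator {- N..N} y *\<^sub>R q y" for y
  have q1: "integrable lborel q1"
    using q by (auto simp: q1_def[abs_def] locally_integrable_def set_integrable_def)
  have q1m [measurable]: "q1 \<in> borel_measurable borel" using borel_measurable_integrable[OF q1] by simp
  define J where "J x y = (deriv \<phi> x * of_bool (y \<le> x)) *\<^sub>R q1 y" for x y
  have Jm [measurable]: "case_prod J \<in> borel_measurable (lborel \<Otimes>\<^sub>M lborel)"
    unfolding J_def of_bool_def by measurable
  have Jb: "norm (J x y) \<le> \<bar>deriv \<phi> x\<bar> * norm (q1 y)" for x y by (simp add: J_def)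
  have Ji: "integrable lborel (\<lambda>y. J x y)" for x
  proof (rule Bochner_Integration.integrable_bound[of _ "\<lambda>y. \<bar>deriv \<phi> x\<bar> * norm (q1 y)"])
    show "(\<lambda>y. J x y) \<in> borel_measurable lborel" unfolding J_def of_bool_def by measurable
  qed (use Jb q1 in \<open>auto intro!: AE_I2\<close>)
  have JI: "integrable (lborel \<Otimes>\<^sub>M lborel) (case_prod J)"
  proof (rule lborel_pair.Fubini_integrable[OF Jm])
    show "integrable lborel (\<lambda>x. LINT y|lborel. norm (case_prod J (x, y)))"
    proof (rule Bochner_Integration.integrable_bound)
      have "set_integrable lborel {- N..N} (\<lambda>x. \<bar>deriv \<phi> x\<bar> * (LINT y|lborel. norm (q1 y)))"
        by (intro borel_integrable_atLeastAtMost' continuous_intros continuous_on_subset[OF d\<phi>(3)]) auto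
      thus "integrable lborel (\<lambda>x. indicator {- N..N} x *\<^sub>R (\<bar>deriv \<phi> x\<bar> * (LINT y|lborel. norm (q1 y))))"
        by (simp add: set_integrable_def)
      show "(\<lambda>x. LINT y|lborel. norm (case_prod J (x, y))) \<in> borel_measurable lborel" by measurable
      show "AE x in lborel. norm (LINT y|lborel. norm (case_prod J (x, y))) \<le>
          norm (indicator {- N..N} x *\<^sub>R (\<bar>deriv \<phi> x\<bar> * (LINT y|lborel. norm (q1 y))))"
      proof (rule AE_I2)
        fix x
        have "(LINT y|lborel. norm (J x y)) \<le> (LINT y|lborel. \<bar>deriv \<phi> x\<bar> * norm (q1 y))"
          using Ji q1 Jb by (intro integral_mono) auto
        moreover have "0 \<le> (LINT y|lborel. norm (J x y))" by (rule integral_nonneg_AE) simp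
        moreover have eq: "indicator {- N..N} x *\<^sub>R (\<bar>deriv \<phi> x\<bar> * (LINT y|lborel. norm (q1 y))) = \<bar>deriv \<phi> x\<bar> * (LINT y|lborel. norm (q1 y))"
          using N(3)[of x] by (auto split: split_indicator)
        ultimately show "norm (LINT y|lborel. norm (case_prod J (x, y))) \<le>
          norm (indicator {- N..N} x *\<^sub>R (\<bar>deriv \<phi> x\<bar> * (LINT y|lborel. norm (q1 y))))" unfolding eq by simp
      qed
    qed
  qed (use Ji in simp)
  have intd: "(LINT x|lborel. indicator {y..N} x *\<^sub>R deriv \<phi> x) = - \<phi> y" if "y \<le> N" for y
    using integral_FTC_atLeastAtMost[OF that, of \<phi> "deriv \<phi>"] d\<phi> N(2)[of N] N(1)
    by (auto simp: has_real_derivative_iff_has_vector_derivative intro: has_vector_derivative_at_within continuous_on_subset)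
  have xy: "(LINT y|lborel. J x y) = deriv \<phi> x *\<^sub>R (Q x - Q (- N))" for x
  proof (cases "x \<in> {- N..N}")
    case True
    have "J x y = deriv \<phi> x *\<^sub>R (indicator {- N..x} y *\<^sub>R q y)" for y
      using True by (auto simp: J_def q1_def split: split_indicator)
    thus ?thesis using Q[of "- N" x] True
      unfolding set_lebesgue_integral_def by (simp only: integral_scaleR_right) simp
  qed (use N(3)[of x] in \<open>auto simp: J_def\<close>)
  have yx: "(LINT x|lborel. J x y) = - (\<phi> y *\<^sub>R q y)" for y
  proof (cases "y \<in> {- N..N}")
    case True
    have "J x y = (indicator {y..N} x *\<^sub>R deriv \<phi> x) *\<^sub>R q y" for x
      using True N(3)[of x] by (auto simp: J_def q1_def split: split_indicator)
    moreover have "integrable lborel (\<lambda>x. indicator {y..N} x *\<^sub>R deriv \<phi> x)"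
      using borel_integrable_atLeastAtMost'[OF continuous_on_subset[OF d\<phi>(3) subset_UNIV]] by (simp add: set_integrable_def)
    ultimately show ?thesis using intd[of y] True by simp
  qed (use N(2)[of y] in \<open>auto simp: J_def q1_def\<close>)
  have id: "integrable lborel (\<lambda>x. deriv \<phi> x *\<^sub>R k x)" if "continuous_on UNIV k" for k :: "real \<Rightarrow> complex"
    by (rule integrable_test_function_deriv[OF \<phi> locally_integrable_continuous[OF that]])
  \<comment> \<open>The base value \<open>Q (- N)\<close> drops out because
    \<open>deriv \<phi>\<close> has integral 0.\<close>
  have "(LINT x|lborel. deriv \<phi> x *\<^sub>R Q (- N)) = (LINT x|lborel. (indicator {- N..N} x *\<^sub>R deriv \<phi> x) *\<^sub>R Q (- N))"
    by (rule Bochner_Integration.integral_cong[OF refl]) (use N(3) in \<open>auto split: split_indicator\<close>)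
  also have "\<dots> = 0"
    using borel_integrable_atLeastAtMost'[OF continuous_on_subset[OF d\<phi>(3) subset_UNIV], of "- N" N] intd[of "- N"] N
    by (simp add: set_integrable_def)
  finally have c0: "(LINT x|lborel. deriv \<phi> x *\<^sub>R Q (- N)) = 0" .
  have "(LINT x|lborel. deriv \<phi> x *\<^sub>R Q x) = (LINT x|lborel. deriv \<phi> x *\<^sub>R Q x - deriv \<phi> x *\<^sub>R Q (- N))"
    using id[OF Qc] id[of "\<lambda>_. Q (- N)"] c0 by simp
  also have "\<dots> = (LINT x|lborel. LINT y|lborel. J x y)" by (simp add: xy scaleR_diff_right)
  also have "\<dots> = (LINT y|lborel. LINT x|lborel. J x y)" using lborel_pair.Fubini_integral[OF JI] by simp
  also have "\<dots> = - (LINT x|lborel. \<phi> x *\<^sub>R q x)" by (simp add: yx)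
  finally show ?thesis .
qed

text \<open>Continuity at 0 prevents a point mass there, and the fundamental theorem tolerates one
  exceptional point.\<close>

lemma weak_derivative_piecewise:
  fixes f f' :: "real \<Rightarrow> complex"
  assumes cont: "continuous_on UNIV f"
    and der: "\<And>x. x \<noteq> 0 \<Longrightarrow> (f has_vector_derivative f' x) (at x)" and f': "locally_integrable f'"
  shows "weak_derivative f f'"
proof -
  have "f b - f a = (LINT x:{a..b}|lborel. f' x)" if "a \<le> b" for a b
  proof -
    have "(f' has_integral (f b - f a)) {a..b}"
      by (rule fundamental_theorem_of_calculus_interior_strong[of "{0}"])
         (use that der cont in \<open>auto intro: continuous_on_subset\<close>)
    thus ?thesis using f' by (simp add: locally_integrable_def set_borel_integral_eq_integral(2) integral_unique)
  qed
  thus ?thesis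
    using integral_deriv_times_primitive[OF f' cont] f' locally_integrable_continuous[OF cont]
    by (simp add: weak_derivative_def locally_integrable_def)
qed

lemma square_integrable_locally_integrable:
  assumes "square_integrable h"
  shows "locally_integrable h"
  unfolding locally_integrable_def set_integrable_def
proof (intro allI, rule Bochner_Integration.integrable_bound)
  have [measurable]: "h \<in> borel_measurable borel" using assms by (simp add: square_integrable_def)
  fix a b :: real
  show "integrable lborel (\<lambda>x. indicator {a..b} x + (cmod (h x))\<^sup>2)"
    using assms by (intro Bochner_Integration.integrable_add integrable_real_indicator)
      (auto simp: square_integrable_def emeasure_lborel_Icc_eq)
  show "(\<lambda>x. indicat_real {a..b} x *\<^sub>R h x) \<in> borel_measurable lborel"
    by measurable
  have "y \<le> 1 + y\<^sup>2" for y :: real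
    using sum_squares_bound[of y 1] zero_le_power2[of y] unfolding power_one mult_1_right by linarith
  thus "AE x in lborel. norm (indicat_real {a..b} x *\<^sub>R h x) \<le> norm (indicat_real {a..b} x + (cmod (h x))\<^sup>2)"
    by (intro AE_I2) (auto split: split_indicator)
qed

text \<open>Both functions have the weak derivative \<open>q\<close>, so the lemma of du
  Bois-Reymond applies to their difference.\<close>

lemma weak_derivative_AE_primitive:
  assumes w: "weak_derivative p q" and Qc: "continuous_on UNIV Q"
    and Q: "\<And>a b. a \<le> b \<Longrightarrow> Q b - Q a = (LINT x:{a..b}|lborel. q x)"
  shows "\<exists>C. AE x in lborel. p x = Q x + C"
proof -
  have p: "locally_integrable p" and q: "locally_integrable q"
    using w by (auto simp: weak_derivative_def locally_integrable_def)
  have Ql: "locally_integrable Q" by (rule locally_integrable_continuous[OF Qc])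
  have "\<exists>C. AE x in lborel. p x - Q x = C"
  proof (rule du_Bois_Reymond)
    show "locally_integrable (\<lambda>x. p x - Q x)" by (rule locally_integrable_diff[OF p Ql])
    fix \<phi> assume \<phi>: "test_function \<phi>"
    have "(LINT x|lborel. deriv \<phi> x *\<^sub>R (p x - Q x)) =
        (LINT x|lborel. deriv \<phi> x *\<^sub>R p x) - (LINT x|lborel. deriv \<phi> x *\<^sub>R Q x)"
      using integrable_test_function_deriv[OF \<phi> p] integrable_test_function_deriv[OF \<phi> Ql] by (simp add: scaleR_diff_right)
    thus "(LINT x|lborel. deriv \<phi> x *\<^sub>R (p x - Q x)) = 0"
      using integral_deriv_times_primitive[OF q Qc Q \<phi>] w \<phi> by (simp add: weak_derivative_def)
  qed
  then obtain C where "AE x in lborel. p x - Q x = C" by blast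
  hence "AE x in lborel. p x = Q x + C" by eventually_elim (auto simp: algebra_simps)
  thus ?thesis by blast
qed

lemma locally_integrable_primitive:
  assumes "locally_integrable q"
  shows "\<exists>Q. continuous_on UNIV Q \<and> (\<forall>a b. a \<le> b \<longrightarrow> Q b - Q a = (LINT x:{a..b}|lborel. q x))"
proof -
  define Q where "Q x = (LBINT y=ereal 0..ereal x. q y)" for x
  have Q: "Q b - Q a = (LINT x:{a..b}|lborel. q x)" if "a \<le> b" for a b
  proof -
    define u v where "u = min 0 (min a b)" and "v = max 0 (max a b)"
    have "set_integrable lborel {u<..<v} q"
      by (rule set_integrable_subset[of lborel "{u..v}"]) (use assms in \<open>auto simp: locally_integrable_def\<close>)
    hence "interval_lebesgue_integrable lborel (min (ereal 0) (min (ereal a) (ereal b))) (max (ereal 0) (max (ereal a) (ereal b))) q"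
    proof -
      assume *: "set_integrable lborel {u<..<v} q"
      have "min (ereal 0) (min (ereal a) (ereal b)) = ereal u" "max (ereal 0) (max (ereal a) (ereal b)) = ereal v"
        by (simp_all only: u_def v_def ereal_min ereal_max)
      moreover have "u \<le> v" by (simp add: u_def v_def)
      ultimately show ?thesis using * by (simp only: interval_lebesgue_integrable_def einterval_eq_Icc ereal_less_eq if_True)
    qed
    from interval_integral_sum[OF this] show ?thesis
      using interval_integral_Icc[OF that, of q] by (simp add: Q_def algebra_simps)
  qed
  have "continuous_on {- real m<..<real m} Q" for m :: nat
  proof -
    have si: "set_integrable lborel {- real m..real m} q" using assms by (simp add: locally_integrable_def)
    have "continuous_on {- real m..real m} (\<lambda>x. integral {- real m..x} q)"
      by (rule indefinite_integral_continuous_1[OF set_borel_integral_eq_integral(1)[OF si]])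
    hence "continuous_on {- real m..real m} (\<lambda>x. Q (- real m) + integral {- real m..x} q)"
      by (intro continuous_intros)
    moreover have "Q (- real m) + integral {- real m..x} q = Q x" if "x \<in> {- real m..real m}" for x
    proof -
      have "set_integrable lborel {- real m..x} q" using assms by (simp add: locally_integrable_def)
      from set_borel_integral_eq_integral(2)[OF this] show ?thesis using Q[of "- real m" x] that by (simp add: algebra_simps)
    qed
    ultimately have "continuous_on {- real m..real m} Q"
      by (subst (asm) continuous_on_cong[OF refl, of _ _ Q]) auto
    thus ?thesis by (rule continuous_on_subset) auto
  qed
  hence "isCont Q x" for x
  proof -
    obtain m :: nat where "\<bar>x\<bar> < real m" using reals_Archimedean2 by blast
    hence "x \<in> {- real m<..<real m}" by auto
    thus ?thesis using \<open>\<And>m. continuous_on {- real m<..<real m} Q\<close>[of m]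
      by (auto simp: continuous_on_eq_continuous_at)
  qed
  hence "continuous_on UNIV Q" by (simp add: continuous_on_eq_continuous_at)
  thus ?thesis using Q by blast
qed

text \<open>The embedding of H^2 into C^1 on the line. \<open>S\<close> is only absolutely
  continuous at this stage, so its increments are recorded; differentiability off 0 comes later from
  the eigenvalue equation.\<close>

theorem H2_regular_representative:
  assumes H: "H2_derivs p p1 p2"
  obtains P S where "\<And>x. (P has_vector_derivative S x) (at x)" "continuous_on UNIV S"
    "\<And>a b. a \<le> b \<Longrightarrow> S b - S a = (LINT x:{a..b}|lborel. p2 x)"
    "AE x in lborel. p x = P x" "AE x in lborel. p1 x = S x"
proof -
  have w: "weak_derivative p p1" "weak_derivative p1 p2" using H by (auto simp: H2_derivs_def)
  have "locally_integrable p2" using w(2) by (simp add: weak_derivative_def locally_integrable_def)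
  then obtain Q where Q: "continuous_on UNIV Q" "\<And>a b. a \<le> b \<Longrightarrow> Q b - Q a = (LINT x:{a..b}|lborel. p2 x)"
    using locally_integrable_primitive by blast
  obtain C where C: "AE x in lborel. p1 x = Q x + C"
    using weak_derivative_AE_primitive[OF w(2) Q] by blast
  define S where "S x = Q x + C" for x
  have Sc: "continuous_on UNIV S" unfolding S_def using Q(1) by (intro continuous_intros)
  obtain F where F: "\<And>x. (F has_vector_derivative S x) (at x)"
    using continuous_antiderivative[OF Sc] by blast
  have Fc: "continuous_on UNIV F"
    by (intro continuous_at_imp_continuous_on ballI has_vector_derivative_continuous[OF F])
  have "F b - F a = (LINT x:{a..b}|lborel. p1 x)" if "a \<le> b" for a b
  proof -
    have "F b - F a = (LINT x|lborel. indicator {a..b} x *\<^sub>R S x)"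
      by (rule integral_FTC_atLeastAtMost[OF that, symmetric])
         (auto intro: has_vector_derivative_at_within[OF F] continuous_on_subset[OF Sc])
    also have "\<dots> = (LINT x|lborel. indicator {a..b} x *\<^sub>R p1 x)"
    proof (rule integral_cong_AE)
      have "set_integrable lborel {a..b} p1" using w(1) by (simp add: weak_derivative_def)
      thus "(\<lambda>x. indicator {a..b} x *\<^sub>R p1 x) \<in> borel_measurable lborel"
        by (auto simp: set_integrable_def dest: borel_measurable_integrable)
      show "(\<lambda>x. indicator {a..b} x *\<^sub>R S x) \<in> borel_measurable lborel"
        using borel_measurable_continuous_onI[OF Sc] by measurable
      show "AE x in lborel. indicator {a..b} x *\<^sub>R S x = indicator {a..b} x *\<^sub>R p1 x"
        using C by eventually_elim (simp add: S_def)
    qed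
    finally show ?thesis by (simp add: set_lebesgue_integral_def)
  qed
  from weak_derivative_AE_primitive[OF w(1) Fc this]
  obtain C' where C': "AE x in lborel. p x = F x + C'" by blast
  show thesis
  proof (rule that[of "\<lambda>x. F x + C'" S])
    show "((\<lambda>x. F x + C') has_vector_derivative S x) (at x)" for x
      using F by (auto intro!: derivative_eq_intros)
    show "S b - S a = (LINT x:{a..b}|lborel. p2 x)" if "a \<le> b" for a b
      using Q(2)[OF that] by (simp add: S_def)
  qed (use Sc C C' in \<open>auto simp: S_def\<close>)
qed

section \<open>Square integrability of bounded positive solutions\<close>

lemma set_integrable_tail:
  fixes F f :: "real \<Rightarrow> real"
  assumes cont: "continuous_on UNIV f" and der: "\<And>x. R \<le> x \<Longrightarrow> (F has_real_derivative f x) (at x)"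
    and nonneg: "\<And>x. R \<le> x \<Longrightarrow> 0 \<le> f x" and C: "\<And>x. R \<le> x \<Longrightarrow> F x \<le> C"
  shows "set_integrable lborel {R..} f"
proof -
  have mono: "F x \<le> F y" if "R \<le> x" "x \<le> y" for x y
    using that der nonneg by (intro DERIV_nonneg_imp_nondecreasing[of x y F]) (auto intro: order_trans)
  define T where "T = Sup (F ` {R..})"
  have bdd: "bdd_above (F ` {R..})" using C by (auto intro!: bdd_aboveI[of _ C])
  \<comment> \<open>A bounded monotone primitive converges, and its limit makes the improper
    integral finite.\<close>
  have "(F \<longlongrightarrow> T) at_top"
  proof (rule order_tendstoI)
    fix a assume "a < T"
    then obtain x where "x \<ge> R" "a < F x" unfolding T_def using less_cSupD[of "F ` {R..}" a] by auto
    thus "\<forall>\<^sub>F x in at_top. a < F x"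
      unfolding eventually_at_top_linorder using mono by (meson less_le_trans)
  next
    fix a assume "T < a"
    moreover have "F x \<le> T" if "R \<le> x" for x unfolding T_def using bdd that by (intro cSup_upper) auto
    ultimately show "\<forall>\<^sub>F x in at_top. F x < a"
      unfolding eventually_at_top_linorder by (meson le_less_trans)
  qed
  from nn_integral_FTC_atLeast[OF borel_measurable_continuous_onI[OF cont] der nonneg this]
  have *: "(\<integral>\<^sup>+x. ennreal (f x) * indicator {R..} x \<partial>lborel) = ennreal (T - F R)" .
  have "integrable lborel (\<lambda>x. indicator {R..} x * f x)"
  proof (rule integrableI_nonneg)
    show "(\<lambda>x. indicator {R..} x * f x) \<in> borel_measurable lborel"
      using borel_measurable_continuous_onI[OF cont] by measurable
    have "(\<integral>\<^sup>+x. ennreal (indicator {R..} x * f x) \<partial>lborel) = (\<integral>\<^sup>+x. ennreal (f x) * indicator {R..} x \<partial>lborel)"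
      by (intro nn_integral_cong) (auto split: split_indicator)
    thus "(\<integral>\<^sup>+x. ennreal (indicator {R..} x * f x) \<partial>lborel) < \<infinity>" using * by simp
  qed (use nonneg in \<open>auto split: split_indicator\<close>)
  thus ?thesis by (simp add: set_integrable_def)
qed

lemma set_integrable_mono_continuous:
  fixes f h :: "real \<Rightarrow> real"
  assumes "set_integrable lborel S h" "S \<in> sets borel" "continuous_on UNIV f" "\<And>x. x \<in> S \<Longrightarrow> \<bar>f x\<bar> \<le> h x"
  shows "set_integrable lborel S f"
  using assms(1) unfolding set_integrable_def
proof (rule Bochner_Integration.integrable_bound)
  show "(\<lambda>x. indicat_real S x *\<^sub>R f x) \<in> borel_measurable lborel"
    using borel_measurable_continuous_onI[OF assms(3)] assms(2) by measurable
qed (use assms(4) in \<open>fastforce split: split_indicator intro!: AE_I2\<close>)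

context sturm_liouville
begin

text \<open>With \<open>h = p' + B * p\<close> the equation reads
  \<open>h' = (\<omega> - g) * p\<close>, which is at least \<open>\<delta> * p\<close>; as
  \<open>h\<close> is bounded above, \<open>p\<close> is integrable, and
  \<open>p\<^sup>2 \<le> p\<close>. Likewise \<open>- p'\<close> is nonnegative and bounded, and its
  primitive \<open>- p\<close> is bounded.\<close>

lemma square_integrable_right:
  assumes s: "sol \<omega> p t" and "\<omega> \<ge> 0" and p: "\<And>z. p z > 0" "\<And>z. p z \<le> 1"
  shows "set_integrable lborel {R..} (\<lambda>z. (p z)\<^sup>2)" "set_integrable lborel {R..} (\<lambda>z. (t z / \<rho> z)\<^sup>2)"
proof -
  have pb: "\<bar>p z\<bar> \<le> 1" for z using p[of z] by simp
  have t0: "t z \<le> 0" if "R \<le> z" for z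
    using bounded_tail_pt[OF s \<open>\<omega> \<ge> 0\<close> pb that] p(1)[of z] by (simp add: mult_le_0_iff)
  define h where "h z = t z / \<rho> z + B * p z" for z
  have pc: "continuous_on UNIV p" and tc: "continuous_on UNIV (\<lambda>z. t z / \<rho> z)"
    using sl_solution_cont[OF s] by (auto intro!: continuous_intros weight_cont)
  have hd: "(h has_real_derivative (\<omega> - g z) * p z) (at z)" if "R \<le> z" for z
    unfolding h_def using that R_pos
    by (auto intro!: derivative_eq_intros solD[OF s] weight_has_derivative simp: field_simps)
  have kp: "\<delta> * p z \<le> (\<omega> - g z) * p z" if "R \<le> z" for z
    using g_tail[of z] that R_pos \<open>\<omega> \<ge> 0\<close> p(1)[of z] by (intro mult_right_mono) auto
  have kp0: "0 \<le> (\<omega> - g z) * p z" if "R \<le> z" for z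
    using kp[OF that] mult_pos_pos[OF \<delta>_pos p(1)[of z]] by linarith
  have Bp: "\<bar>B * p z\<bar> \<le> \<bar>B\<bar>" for z
    using pb[of z] by (simp add: abs_mult mult_left_le)
  have I: "set_integrable lborel {R..} (\<lambda>z. (\<omega> - g z) * p z)"
  proof (rule set_integrable_tail[where F = h and C = "\<bar>B\<bar>"])
    fix z assume z: "R \<le> z"
    have "t z / \<rho> z \<le> 0" using t0[OF z] by (simp add: divide_nonpos_pos)
    thus "h z \<le> \<bar>B\<bar>" using Bp[of z] unfolding h_def by linarith
  qed (use hd kp0 pc g_cont in \<open>auto intro!: continuous_intros\<close>)
  show "set_integrable lborel {R..} (\<lambda>z. (p z)\<^sup>2)"
  proof (rule set_integrable_mono_continuous)
    show "set_integrable lborel {R..} (\<lambda>z. (1 / \<delta>) * ((\<omega> - g z) * p z))"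
      using I by (rule set_integrable_mult_right)
    fix z assume "z \<in> {R..}"
    hence "p z \<le> (1 / \<delta>) * ((\<omega> - g z) * p z)"
      using kp[of z] \<delta>_pos by (simp add: field_simps)
    moreover have "(p z)\<^sup>2 \<le> p z" using p[of z] by (simp add: power2_eq_square mult_left_le)
    ultimately show "\<bar>(p z)\<^sup>2\<bar> \<le> (1 / \<delta>) * ((\<omega> - g z) * p z)" by simp
  qed (auto intro!: continuous_intros pc)
  define C where "C = \<bar>h R\<bar> + \<bar>B\<bar>"
  have sb: "- (t z / \<rho> z) \<le> C" if "R \<le> z" for z
  proof -
    have "h R \<le> h z"
      using that hd kp0 by (intro DERIV_nonneg_imp_nondecreasing[of R z h]) auto
    thus ?thesis using Bp[of z] by (simp add: C_def h_def)
  qed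
  have I2: "set_integrable lborel {R..} (\<lambda>z. - (t z / \<rho> z))"
  proof (rule set_integrable_tail[where F = "\<lambda>z. - p z" and C = 0])
    show "continuous_on UNIV (\<lambda>z. - (t z / \<rho> z))" by (rule continuous_on_minus[OF tc])
    show "0 \<le> - (t z / \<rho> z)" if "R \<le> z" for z using t0[OF that] by (simp add: divide_nonpos_pos)
  qed (use p solD[OF s] in \<open>auto intro!: derivative_intros less_imp_le\<close>)
  show "set_integrable lborel {R..} (\<lambda>z. (t z / \<rho> z)\<^sup>2)"
  proof (rule set_integrable_mono_continuous)
    show "set_integrable lborel {R..} (\<lambda>z. C * (- (t z / \<rho> z)))"
      using I2 by (rule set_integrable_mult_right)
    fix z assume "z \<in> {R..}"
    hence "- (t z / \<rho> z) * - (t z / \<rho> z) \<le> C * - (t z / \<rho> z)"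
      using sb[of z] t0[of z] by (intro mult_right_mono) (auto simp: divide_nonpos_pos)
    thus "\<bar>(t z / \<rho> z)\<^sup>2\<bar> \<le> C * - (t z / \<rho> z)" by (simp add: power2_eq_square)
  qed (auto intro!: continuous_intros tc)
qed

lemma integrable_from_tails:
  fixes h :: "real \<Rightarrow> real"
  assumes "set_integrable lborel {R..} h" "set_integrable lborel {R..} (\<lambda>z. h (- z))" "continuous_on UNIV h"
  shows "integrable lborel h"
proof -
  have "integrable lborel (\<lambda>x. indicator {R..} x *\<^sub>R h (- x))" using assms(2) by (simp add: set_integrable_def)
  hence "integrable lborel (\<lambda>x. indicator {R..} (0 + (- 1) * x) *\<^sub>R h (- (0 + (- 1) * x)))"
    by (subst lborel_integrable_real_affine_iff) auto
  moreover have "indicator {R..} (0 + (- 1) * x) = (indicator {..- R} x :: real)" for x :: real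
    by (auto split: split_indicator)
  ultimately have left: "set_integrable lborel {..- R} h" by (simp add: set_integrable_def)
  have mid: "set_integrable lborel {- R..R} h"
    by (rule borel_integrable_atLeastAtMost') (use assms(3) continuous_on_subset in blast)
  have "set_integrable lborel (({..- R} \<union> {- R..R}) \<union> {R..}) h"
    using left mid assms(1) by (intro set_integrable_Un) auto
  moreover have "({..- R} \<union> {- R..R}) \<union> {R..} = UNIV" by auto
  ultimately show ?thesis by (simp add: set_integrable_def)
qed

text \<open>The second derivative is read off from the equation as a combination of \<open>p\<close>
  and \<open>p'\<close> with bounded coefficients, hence square integrable. \<open>a\<close> is free
  at 0 because \<open>wind\<close> takes the value 0 there.\<close>

lemma H2_derivs_of_positive_solution:
  assumes s: "sol \<omega> p t" and "\<omega> \<ge> 0" and p: "\<And>z. p z > 0" "\<And>z. p z \<le> 1"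
    and a: "\<And>z. z < 0 \<Longrightarrow> a z = A" "\<And>z. z > 0 \<Longrightarrow> a z = B"
  shows "H2_derivs (\<lambda>z. of_real (p z)) (\<lambda>z. of_real (t z / \<rho> z))
     (\<lambda>z. of_real ((\<omega> - g z) * p z - a z * (t z / \<rho> z)))"
proof -
  define v where "v z = t z / \<rho> z" for z
  define r where "r z = (\<omega> - g z) * p z - a z * v z" for z
  interpret r: sturm_liouville "- B" "- A" "\<lambda>z. g (- z)" R \<delta> K by (rule reflected)
  have cont: "continuous_on S p" "continuous_on S v" "continuous_on S g" for S
    using sl_solution_cont[OF s] continuous_on_subset[OF g_cont]
    by (auto intro!: continuous_intros weight_cont simp: v_def)
  have m [measurable]: "p \<in> borel_measurable borel" "v \<in> borel_measurable borel" "g \<in> borel_measurable borel"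
    by (auto intro!: borel_measurable_continuous_onI cont)
  have "a = (\<lambda>z. if z < 0 then A else if z = 0 then a 0 else B)" using a by force
  hence [measurable]: "a \<in> borel_measurable borel" by (rule ssubst) measurable
  have [measurable]: "r \<in> borel_measurable borel" unfolding r_def by measurable
  have Ip: "integrable lborel (\<lambda>z. (p z)\<^sup>2)"
  proof (rule integrable_from_tails)
    show "set_integrable lborel {R..} (\<lambda>z. (p (- z))\<^sup>2)"
      by (rule r.square_integrable_right(1)[OF sl_solution_reflect[OF s] \<open>\<omega> \<ge> 0\<close>]) (use p in auto)
  qed (use square_integrable_right[OF s \<open>\<omega> \<ge> 0\<close> p] cont in \<open>auto intro!: continuous_intros\<close>)
  have Iv: "integrable lborel (\<lambda>z. (v z)\<^sup>2)"
  proof (rule integrable_from_tails)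
    have "set_integrable lborel {R..} (\<lambda>z. (- t (- z) / weight (- B) (- A) z)\<^sup>2)"
      by (rule r.square_integrable_right(2)[OF sl_solution_reflect[OF s] \<open>\<omega> \<ge> 0\<close>]) (use p in auto)
    thus "set_integrable lborel {R..} (\<lambda>z. (v (- z))\<^sup>2)" by (simp add: v_def weight_reflect power_divide)
  qed (use square_integrable_right[OF s \<open>\<omega> \<ge> 0\<close> p, folded v_def] cont in \<open>auto intro!: continuous_intros\<close>)
  define M where "M = \<omega> + K"
  define m where "m = max \<bar>a 0\<bar> (max \<bar>A\<bar> \<bar>B\<bar>)"
  have am: "\<bar>a z\<bar> \<le> m" for z using a[of z] by (cases z "0::real" rule: linorder_cases) (auto simp: m_def)
  have kM: "\<bar>\<omega> - g z\<bar> \<le> M" for z using g_bound[of z] \<open>\<omega> \<ge> 0\<close> unfolding M_def by linarith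
  have rb: "\<bar>r z\<bar> \<le> M * \<bar>p z\<bar> + m * \<bar>v z\<bar>" for z
  proof -
    have "\<bar>r z\<bar> \<le> \<bar>(\<omega> - g z) * p z\<bar> + \<bar>a z * v z\<bar>" unfolding r_def by (rule abs_triangle_ineq4)
    also have "\<dots> \<le> M * \<bar>p z\<bar> + m * \<bar>v z\<bar>"
      unfolding abs_mult by (intro add_mono mult_right_mono kM am) auto
    finally show ?thesis .
  qed
  have Ir: "integrable lborel (\<lambda>z. (r z)\<^sup>2)"
  proof (rule Bochner_Integration.integrable_bound[of _ "\<lambda>z. 2 * M\<^sup>2 * (p z)\<^sup>2 + 2 * m\<^sup>2 * (v z)\<^sup>2"])
    show "AE z in lborel. norm ((r z)\<^sup>2) \<le> norm (2 * M\<^sup>2 * (p z)\<^sup>2 + 2 * m\<^sup>2 * (v z)\<^sup>2)"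
    proof (rule AE_I2)
      fix z
      have "(r z)\<^sup>2 \<le> (M * \<bar>p z\<bar> + m * \<bar>v z\<bar>)\<^sup>2" using rb[of z] by (simp add: abs_le_square_iff[symmetric])
      also have "\<dots> \<le> 2 * (M * \<bar>p z\<bar>)\<^sup>2 + 2 * (m * \<bar>v z\<bar>)\<^sup>2"
        using sum_squares_bound[of "M * \<bar>p z\<bar>" "m * \<bar>v z\<bar>"] by (simp add: power2_sum)
      finally show "norm ((r z)\<^sup>2) \<le> norm (2 * M\<^sup>2 * (p z)\<^sup>2 + 2 * m\<^sup>2 * (v z)\<^sup>2)"
        by (simp add: power_mult_distrib)
    qed
  qed (auto intro!: Ip Iv Bochner_Integration.integrable_add integrable_mult_right)
  have sq: "square_integrable (\<lambda>z. of_real (p z))" "square_integrable (\<lambda>z. of_real (v z))" "square_integrable (\<lambda>z. of_real (r z))"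
    using Ip Iv Ir by (simp_all add: square_integrable_def)
  have w1: "weak_derivative (\<lambda>z. of_real (p z)) (\<lambda>z. of_real (v z))"
  proof (rule weak_derivative_piecewise)
    show "((\<lambda>z. complex_of_real (p z)) has_vector_derivative of_real (v x)) (at x)" for x
      using solD(1)[OF s, of x] unfolding v_def
      by (rule has_vector_derivative_of_real)
  qed (use cont sq in \<open>auto intro!: continuous_intros square_integrable_locally_integrable\<close>)
  have w2: "weak_derivative (\<lambda>z. of_real (v z)) (\<lambda>z. of_real (r z))"
  proof (rule weak_derivative_piecewise)
    fix x :: real assume x: "x \<noteq> 0"
    have "(v has_real_derivative r x) (at x)"
      unfolding v_def r_def using x a
      by (auto intro!: derivative_eq_intros solD[OF s] weight_has_derivative simp: field_simps)
    thus "((\<lambda>z. complex_of_real (v z)) has_vector_derivative of_real (r x)) (at x)"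
      by (rule has_vector_derivative_of_real)
  qed (use cont sq in \<open>auto intro!: continuous_intros square_integrable_locally_integrable\<close>)
  show ?thesis
    unfolding H2_derivs_def v_def[symmetric] r_def[symmetric] using w1 w2 sq by blast
qed

end

section \<open>The maximum principle for increasing fronts\<close>

lemma not_max_if_second_derivative_pos:
  fixes T T' :: "real \<Rightarrow> real"
  assumes "\<And>x. x \<in> X \<Longrightarrow> (T has_real_derivative T' x) (at x)" "open X" "z \<in> X"
    and "T' z = 0" "(T' has_real_derivative d) (at z)" "d > 0"
  shows "\<exists>x. T x > T z"
proof -
  obtain e1 where e1: "e1 > 0" "\<And>h. 0 < h \<Longrightarrow> h < e1 \<Longrightarrow> T' z < T' (z + h)"
    using DERIV_pos_inc_right[OF assms(5,6)] by blast
  obtain e2 where e2: "e2 > 0" "\<And>y. dist y z < e2 \<Longrightarrow> y \<in> X"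
    using assms(2,3) by (auto simp: open_dist)
  define h where "h = min e1 e2 / 2"
  have h: "0 < h" "h < e1" "h < e2" using e1(1) e2(1) by (auto simp: h_def)
  have X: "y \<in> X" if "z \<le> y" "y \<le> z + h" for y
    using that h by (intro e2(2)) (auto simp: dist_real_def)
  have "T z < T (z + h)"
  proof (rule DERIV_pos_imp_increasing_open[where f = T])
    show "z < z + h" using h by simp
    show "continuous_on {z..z + h} T"
      by (intro continuous_at_imp_continuous_on ballI) (use X in \<open>auto intro!: DERIV_isCont[OF assms(1)]\<close>)
    fix y assume y: "z < y" "y < z + h"
    have "T' y > 0" using e1(2)[of "y - z"] y h assms(4) by simp
    thus "\<exists>d. (T has_real_derivative d) (at y) \<and> d > 0" using assms(1) X y by (meson less_imp_le)
  qed
  thus ?thesis by blast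
qed

text \<open>\<open>T\<close> may have a kink at 0, and \<open>G 0\<close> is its left-hand
  derivative. Were it negative, \<open>T\<close> would decrease strictly just before 0.\<close>

lemma left_derivative_nonneg_at_max:
  fixes T G :: "real \<Rightarrow> real"
  assumes T: "continuous_on UNIV T" and G: "isCont G 0"
    and d: "\<And>x. x < 0 \<Longrightarrow> (T has_real_derivative G x) (at x)" and max: "\<And>x. T x \<le> T 0"
  shows "G 0 \<ge> 0"
proof (rule ccontr)
  assume "\<not> G 0 \<ge> 0"
  hence "\<forall>\<^sub>F x in at 0. G x < 0" using G unfolding isCont_def by (intro order_tendstoD) auto
  then obtain e where e: "e > 0" "\<And>x. x \<noteq> 0 \<Longrightarrow> dist x 0 < e \<Longrightarrow> G x < 0"
    unfolding eventually_at by blast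
  have "- T (- e / 2) < - T 0"
  proof (rule DERIV_pos_imp_increasing_open[where f = "\<lambda>x. - T x"])
    show "- e / 2 < 0" using e by simp
    show "continuous_on {- e / 2..0} (\<lambda>x. - T x)"
      by (intro continuous_intros continuous_on_subset[OF T]) simp
    fix x assume x: "- e / 2 < x" "x < 0"
    thus "\<exists>y. ((\<lambda>x. - T x) has_real_derivative y) (at x) \<and> y > 0"
      using e(2)[of x] by (intro exI[of _ "- G x"]) (auto intro!: derivative_eq_intros d)
  qed
  thus False using max[of "- e / 2"] by simp
qed

lemma right_derivative_nonpos_at_max:
  fixes T G :: "real \<Rightarrow> real"
  assumes T: "continuous_on UNIV T" and G: "isCont G 0"
    and d: "\<And>x. x > 0 \<Longrightarrow> (T has_real_derivative G x) (at x)" and max: "\<And>x. T x \<le> T 0"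
  shows "G 0 \<le> 0"
proof -
  have "(\<lambda>x. - G (- x)) 0 \<ge> 0"
  proof (rule left_derivative_nonneg_at_max[where T = "\<lambda>x. T (- x)"])
    show "continuous_on UNIV (\<lambda>x. T (- x))"
      by (intro continuous_on_compose2[OF T] continuous_intros) auto
    show "isCont (\<lambda>x. - G (- x)) 0"
      by (rule isCont_minus, rule isCont_o2[where g = G]) (use G in \<open>auto intro!: isCont_minus\<close>)
    show "((\<lambda>x. T (- x)) has_real_derivative - G (- x)) (at x)" if "x < 0" for x
      using d[of "- x"] that by (simp flip: DERIV_mirror)
  qed (use max in auto)
  thus ?thesis by simp
qed

lemma integral_ge_on_interval:
  fixes N :: "real \<Rightarrow> real"
  assumes "integrable lborel N" "\<And>x. 0 \<le> N x" "a \<le> b" "\<And>x. a \<le> x \<Longrightarrow> x \<le> b \<Longrightarrow> c \<le> N x"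
  shows "c * (b - a) \<le> integral\<^sup>L lborel N"
proof -
  have i: "integrable lborel (\<lambda>x. c * indicator {a..b} x)"
    by (intro integrable_mult_right integrable_real_indicator) (auto simp: emeasure_lborel_Icc_eq)
  have "c * (b - a) = (LINT x|lborel. c * indicator {a..b} x)" using assms(3) by simp
  also have "\<dots> \<le> integral\<^sup>L lborel N"
    by (rule integral_mono[OF i assms(1)]) (use assms in \<open>auto split: split_indicator\<close>)
  finally show ?thesis .
qed

text \<open>\<open>exp (B * z) * (P z \<bullet> S z)\<close> is nondecreasing, so if it were ever positive then \<open>\<bar>P\<bar>\<close> would
  increase from then on and could not be square integrable.\<close>

lemma square_integrable_mode_decays:
  fixes P S :: "real \<Rightarrow> complex" and k :: "real \<Rightarrow> real"
  assumes P: "\<And>z. (P has_vector_derivative S z) (at z)"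
    and S: "\<And>z. R \<le> z \<Longrightarrow> (S has_vector_derivative \<omega> * P z - k z *\<^sub>R P z - B *\<^sub>R S z) (at z)"
    and k: "\<And>z. R \<le> z \<Longrightarrow> k z \<le> Re \<omega>"
    and int: "integrable lborel (\<lambda>z. (cmod (P z))\<^sup>2)" and "e > 0"
  shows "\<exists>X. \<forall>z\<ge>X. cmod (P z) < e"
proof -
  define N where "N z = P z \<bullet> P z" for z
  have N: "N z = (cmod (P z))\<^sup>2" for z by (simp add: N_def power2_norm_eq_inner)
  have N0: "0 \<le> N z" for z by (simp add: N)
  have Ni: "integrable lborel N" using int by (simp add: N[abs_def])
  have Nd: "(N has_real_derivative 2 * (P z \<bullet> S z)) (at z)" for z
    unfolding N_def[abs_def] has_real_derivative_iff_has_vector_derivative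
    using bounded_bilinear.has_vector_derivative[OF bounded_bilinear_inner P[of z] P[of z]]
    by (simp add: inner_commute)
  define M where "M z = exp (B * z) * (P z \<bullet> S z)" for z
  have iw: "P z \<bullet> (\<omega> * P z) = Re \<omega> * N z" for z
    by (simp add: N_def inner_complex_def algebra_simps)
  have Md: "(M has_real_derivative exp (B * z) * (S z \<bullet> S z + (Re \<omega> - k z) * N z)) (at z)" if "R \<le> z" for z
  proof -
    have "((\<lambda>z. P z \<bullet> S z) has_real_derivative
        P z \<bullet> (\<omega> * P z - k z *\<^sub>R P z - B *\<^sub>R S z) + S z \<bullet> S z) (at z)"
      unfolding has_real_derivative_iff_has_vector_derivative
      using bounded_bilinear.has_vector_derivative[OF bounded_bilinear_inner P[of z] S[OF that]] by simp
    thus ?thesis unfolding M_def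
      by (auto intro!: derivative_eq_intros simp: inner_diff_right iw N_def[symmetric] algebra_simps)
  qed
  have Mm: "M x \<le> M y" if "R \<le> x" "x \<le> y" for x y
  proof (rule DERIV_nonneg_imp_nondecreasing[OF that(2)])
    fix z assume "x \<le> z" "z \<le> y"
    hence z: "R \<le> z" using that by simp
    have "0 \<le> exp (B * z) * (S z \<bullet> S z + (Re \<omega> - k z) * N z)"
      using k[OF z] N0[of z] by (intro mult_nonneg_nonneg add_nonneg_nonneg) auto
    thus "\<exists>d. (M has_real_derivative d) (at z) \<and> 0 \<le> d" using Md[OF z] by blast
  qed
  have neg: "P z \<bullet> S z \<le> 0" if z: "R \<le> z" for z
  proof (rule ccontr)
    assume pos: "\<not> P z \<bullet> S z \<le> 0"
    hence "M z > 0" by (simp add: M_def)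
    hence "M y > 0" if "z \<le> y" for y using Mm[OF z that] by linarith
    hence PS: "P y \<bullet> S y > 0" if "z \<le> y" for y using that by (force simp: M_def zero_less_mult_iff)
    have Nm: "N z \<le> N y" if "z \<le> y" for y
    proof (rule DERIV_nonneg_imp_nondecreasing[OF that])
      fix x assume "z \<le> x" "x \<le> y"
      thus "\<exists>d. (N has_real_derivative d) (at x) \<and> 0 \<le> d"
        using Nd PS[of x] by (intro exI[of _ "2 * (P x \<bullet> S x)"]) auto
    qed
    have "P z \<noteq> 0" using pos by auto
    hence Nz: "N z > 0" by (simp add: N)
    define I where "I = integral\<^sup>L lborel N"
    have "I \<ge> 0" unfolding I_def using N0 by (intro integral_nonneg_AE) auto
    \<comment> \<open>The interval is so long that the lower bound \<open>N z\<close> alone gives an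
      integral above \<open>I\<close>.\<close>
    define b where "b = z + (I + 1) / N z"
    have "z \<le> b" using \<open>I \<ge> 0\<close> Nz by (simp add: b_def)
    hence "N z * (b - z) \<le> I" unfolding I_def
      using Nm by (intro integral_ge_on_interval[OF Ni N0]) auto
    thus False using Nz by (simp add: b_def)
  qed
  define I where "I = integral\<^sup>L lborel N"
  have "I \<ge> 0" unfolding I_def using N0 by (intro integral_nonneg_AE) auto
  \<comment> \<open>A nonincreasing \<open>N\<close> satisfies \<open>N z * (z - R) \<le> I\<close>;
    the summand 1 makes \<open>z - R\<close> exceed \<open>I / e\<^sup>2\<close>.\<close>
  have "cmod (P z) < e" if z: "R + I / e\<^sup>2 + 1 \<le> z" for z
  proof -
    have "0 \<le> I / e\<^sup>2" using \<open>I \<ge> 0\<close> by simp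
    hence zR: "R < z" using z by linarith
    have dec: "N z \<le> N x" if "R \<le> x" "x \<le> z" for x
    proof (rule DERIV_nonpos_imp_nonincreasing[OF that(2)])
      fix y assume "x \<le> y" "y \<le> z"
      thus "\<exists>d. (N has_real_derivative d) (at y) \<and> d \<le> 0"
        using Nd neg[of y] that by (intro exI[of _ "2 * (P y \<bullet> S y)"]) auto
    qed
    have "N z * (z - R) \<le> I" unfolding I_def
      using dec zR by (intro integral_ge_on_interval[OF Ni N0]) auto
    also have "I < e\<^sup>2 * (z - R)"
    proof -
      have "I / e\<^sup>2 < z - R" using z by linarith
      thus ?thesis using \<open>e > 0\<close> by (simp add: pos_divide_less_eq mult.commute)
    qed
    finally have "N z < e\<^sup>2" using zR by simp
    thus ?thesis using \<open>e > 0\<close> by (intro power2_less_imp_less[of "cmod (P z)" e]) (auto simp: N)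
  qed
  thus ?thesis by blast
qed

text \<open>The maximum principle: compare \<open>\<bar>P\<bar>\<close> with the smallest multiple of \<open>q\<close> that dominates it on
  \<open>{- R..R}\<close>. To differentiate at a point \<open>y\<close>, replace \<open>\<bar>P\<bar>\<close> by \<open>Re (cnj (sgn (P y)) * P)\<close>, which
  is a lower bound with equality at \<open>y\<close>. At \<open>y = 0\<close> the jump of \<open>q'\<close> has the wrong sign for a maximum.\<close>

theorem (in smooth_bistable_front) no_unstable_mode:
  fixes P S :: "real \<Rightarrow> complex"
  assumes AB: "A < B" and \<omega>: "Re \<omega> > 0"
    and P: "\<And>z. (P has_vector_derivative S z) (at z)" and Sc: "continuous_on UNIV S"
    and S: "\<And>z. z \<noteq> 0 \<Longrightarrow> (S has_vector_derivative
        \<omega> * P z - f' (U z) *\<^sub>R P z - (if z < 0 then A else B) *\<^sub>R S z) (at z)"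
    and int: "integrable lborel (\<lambda>z. (cmod (P z))\<^sup>2)"
  shows "P z = 0"
proof (rule ccontr)
  assume Pz: "P z \<noteq> 0"
  obtain R \<delta> where "sturm_liouville (\<lambda>z. f' (U z)) R \<delta> K" using tails by blast
  then interpret sturm_liouville A B "\<lambda>z. f' (U z)" R \<delta> K .
  have q0: "q y > 0" for y by (rule increasing[OF AB])
  have Pc: "continuous_on X P" for X
    by (intro continuous_at_imp_continuous_on ballI has_vector_derivative_continuous[OF P])
  have decay: "\<exists>X. \<forall>z. X \<le> \<bar>z\<bar> \<longrightarrow> cmod (P z) < e" if "e > 0" for e
  proof -
    have "\<exists>X. \<forall>z\<ge>X. cmod (P z) < e"
    proof (rule square_integrable_mode_decays[OF P _ _ int that, of R \<omega> "\<lambda>z. f' (U z)" B])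
      show "(S has_vector_derivative \<omega> * P z - f' (U z) *\<^sub>R P z - B *\<^sub>R S z) (at z)" if "R \<le> z" for z
        using S[of z] R_pos that by simp
      show "f' (U z) \<le> Re \<omega>" if "R \<le> z" for z using that g_neg_tail[of z "Re \<omega>"] \<omega> by simp
    qed
    moreover have "\<exists>X. \<forall>z\<ge>X. cmod (P (- z)) < e"
    proof (rule square_integrable_mode_decays[where S = "\<lambda>z. - S (- z)" and R = R and \<omega> = \<omega> and k = "\<lambda>z. f' (U (- z))" and B = "- A"])
      have m: "((\<lambda>z. h (- z)) has_vector_derivative - d) (at z)" if "(h has_vector_derivative d) (at (- z))"
        for h :: "real \<Rightarrow> complex" and d z
        using vector_diff_chain_at[of uminus "- 1" z h d] that by (simp add: o_def has_vector_derivative_minus[OF has_vector_derivative_id])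
      show "((\<lambda>z. P (- z)) has_vector_derivative - S (- z)) (at z)" for z by (rule m[OF P])
      show "((\<lambda>z. - S (- z)) has_vector_derivative \<omega> * P (- z) - f' (U (- z)) *\<^sub>R P (- z) - (- A) *\<^sub>R (- S (- z))) (at z)"
        if "R \<le> z" for z
        using has_vector_derivative_minus[OF m[OF S[of "- z"]]] R_pos that by simp
      show "f' (U (- z)) \<le> Re \<omega>" if "R \<le> z" for z using that g_neg_tail[of "- z" "Re \<omega>"] \<omega> by simp
      show "integrable lborel (\<lambda>z. (cmod (P (- z)))\<^sup>2)"
        using lborel_integrable_real_affine[OF int, of "- 1" 0] by simp
    qed (rule that)
    ultimately obtain X1 X2 where X: "\<And>z. X1 \<le> z \<Longrightarrow> cmod (P z) < e" "\<And>z. X2 \<le> z \<Longrightarrow> cmod (P (- z)) < e" by blast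
    have "cmod (P z) < e" if "max X1 X2 \<le> \<bar>z\<bar>" for z
      using X(1)[of z] X(2)[of "- z"] that by (cases "z \<ge> 0") auto
    thus ?thesis by blast
  qed
  have "\<exists>x\<in>{- R..R}. \<forall>y\<in>{- R..R}. cmod (P y) / q y \<le> cmod (P x) / q x"
    using R_pos q0 by (intro continuous_attains_sup)
      (auto intro!: continuous_intros Pc q_cont' simp: less_imp_neq[OF q0, symmetric])
  then obtain z0 where z0: "z0 \<in> {- R..R}" "\<And>y. y \<in> {- R..R} \<Longrightarrow> cmod (P y) / q y \<le> cmod (P z0) / q z0" by blast
  define M where "M = cmod (P z0) / q z0"
  have M0: "M \<ge> 0" using q0[of z0] by (simp add: M_def)
  define D where "D y = cmod (P y) - M * q y" for y
  have D0: "D y \<le> 0" if "y \<in> {- R..R}" for y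
    using z0(2)[OF that] q0[of y] by (simp add: D_def M_def pos_divide_le_eq)
  have Dz0: "D z0 = 0" using q0[of z0] by (simp add: D_def M_def)
  \<comment> \<open>If \<open>P y = 0\<close>, the default \<open>sgn 0 = 0\<close> leaves
    \<open>- M * q\<close>, still a lower bound for \<open>D\<close> with equality at
    \<open>y\<close>.\<close>
  define T where "T y x = Re (cnj (sgn (P y)) * P x) - M * q x" for y x
  have TD: "T y x \<le> D x" for y x
  proof -
    have "Re (cnj (sgn (P y)) * P x) \<le> cmod (cnj (sgn (P y)) * P x)" by (rule complex_Re_le_cmod)
    also have "\<dots> \<le> cmod (P x)" by (cases "P y = 0") (simp_all add: norm_mult norm_sgn)
    finally show ?thesis by (simp add: T_def D_def)
  qed
  have cs: "cnj (sgn w) * w = of_real (cmod w)" for w :: complex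
    by (cases "w = 0") (simp_all add: sgn_eq mult.commute[of _ w] complex_norm_square[symmetric] power2_eq_square)
  have TDy: "T y y = D y" for y using cs[of "P y"] by (simp add: T_def D_def)
  define T' where "T' a y x = Re (cnj (sgn (P y)) * S x) - M * (- a * q x - f (U x))" for a y x
  have Td: "(T y has_real_derivative T' (if x < 0 then A else B) y x) (at x)" if "x \<noteq> 0" for x y
  proof -
    have "((\<lambda>x. Re (cnj (sgn (P y)) * P x)) has_vector_derivative Re (cnj (sgn (P y)) * S x)) (at x)"
      by (intro bounded_linear.has_vector_derivative[OF bounded_linear_Re]
          bounded_linear.has_vector_derivative[OF bounded_linear_mult_right] P)
    hence "((\<lambda>x. Re (cnj (sgn (P y)) * P x)) has_real_derivative Re (cnj (sgn (P y)) * S x)) (at x)"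
      by (simp add: has_real_derivative_iff_has_vector_derivative)
    from DERIV_diff[OF this DERIV_cmult[OF q_deriv[OF that], of M]] show ?thesis
      by (simp only: T_def[abs_def] T'_def)
  qed
  \<comment> \<open>At a maximum of \<open>D\<close> the touching function \<open>T y\<close> has
    slope 0, and its second derivative is exactly the quantity assumed positive.\<close>
  have no_max: False if y: "y \<noteq> 0" "\<And>x. D x \<le> D y" and pos: "Re \<omega> * cmod (P y) - f' (U y) * D y > 0" for y
  proof -
    define a where "a = (if y < 0 then A else B)"
    define X where "X = (if y < 0 then {..<0} else {0<..} :: real set)"
    have X: "open X" "y \<in> X" "\<And>x. x \<in> X \<Longrightarrow> x \<noteq> 0 \<and> (if x < 0 then A else B) = a"
      using y(1) by (auto simp: X_def a_def split: if_splits)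
    have Tx: "(T y has_real_derivative T' a y x) (at x)" if "x \<in> X" for x
      using Td[of x y] X(3)[OF that] by auto
    have max: "T y x \<le> T y y" for x using TD[of y x] y(2)[of x] TDy[of y] by simp
    have T'0: "T' a y y = 0"
      by (rule DERIV_local_max[OF Tx[OF X(2)] zero_less_one]) (use max in auto)
    have "((\<lambda>x. Re (cnj (sgn (P y)) * S x)) has_vector_derivative
        Re (cnj (sgn (P y)) * (\<omega> * P y - f' (U y) *\<^sub>R P y - a *\<^sub>R S y))) (at y)"
      unfolding a_def
      by (intro bounded_linear.has_vector_derivative[OF bounded_linear_Re]
          bounded_linear.has_vector_derivative[OF bounded_linear_mult_right] S y)
    hence 1: "((\<lambda>x. Re (cnj (sgn (P y)) * S x)) has_real_derivative
        Re (cnj (sgn (P y)) * (\<omega> * P y - f' (U y) *\<^sub>R P y - a *\<^sub>R S y))) (at y)"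
      by (simp add: has_real_derivative_iff_has_vector_derivative)
    have 2: "(q has_real_derivative - a * q y - f (U y)) (at y)"
      unfolding a_def by (rule q_deriv[OF y(1)])
    have 3: "((\<lambda>x. - a * q x - f (U x)) has_real_derivative - a * (- a * q y - f (U y)) - f' (U y) * q y) (at y)"
      by (auto intro!: derivative_eq_intros 2 DERIV_chain2[OF f_deriv] U_deriv)
    have "(T' a y has_real_derivative
        Re (cnj (sgn (P y)) * (\<omega> * P y - f' (U y) *\<^sub>R P y - a *\<^sub>R S y))
        - M * (- a * (- a * q y - f (U y)) - f' (U y) * q y)) (at y)"
      using DERIV_diff[OF 1 DERIV_cmult[OF 3, of M]] by (simp only: T'_def[abs_def])
    also have "cnj (sgn (P y)) * (\<omega> * P y - f' (U y) *\<^sub>R P y - a *\<^sub>R S y) =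
        \<omega> * (cnj (sgn (P y)) * P y) - f' (U y) *\<^sub>R (cnj (sgn (P y)) * P y) - a *\<^sub>R (cnj (sgn (P y)) * S y)"
      by (simp add: algebra_simps)
    also have "Re \<dots> - M * (- a * (- a * q y - f (U y)) - f' (U y) * q y) =
        Re \<omega> * cmod (P y) - f' (U y) * D y - a * T' a y y"
      unfolding cs by (simp add: T'_def D_def algebra_simps)
    finally have "(T' a y has_real_derivative Re \<omega> * cmod (P y) - f' (U y) * D y) (at y)"
      using T'0 by simp
    from not_max_if_second_derivative_pos[OF Tx X(1,2) T'0 this pos] max show False
      by (meson not_le)
  qed
  \<comment> \<open>A positive value of \<open>D\<close> would lead, by the decay of
    \<open>P\<close>, to a global maximum outside the interior of \<open>{- R..R}\<close>, where
    \<open>f' (U x)\<close> is negative and \<open>no_max\<close> applies.\<close>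
  have Dle: "D y \<le> 0" for y
  proof (rule ccontr)
    assume Dy: "\<not> D y \<le> 0"
    then obtain X where X: "\<And>z. X \<le> \<bar>z\<bar> \<Longrightarrow> cmod (P z) < D y" using decay[of "D y"] by auto
    define Y where "Y = max X \<bar>y\<bar>"
    have "\<exists>x\<in>{- Y..Y}. \<forall>z\<in>{- Y..Y}. D z \<le> D x"
      unfolding D_def by (intro continuous_attains_sup) (auto intro!: continuous_intros Pc q_cont' simp: Y_def)
    then obtain x where x: "x \<in> {- Y..Y}" "\<And>z. z \<in> {- Y..Y} \<Longrightarrow> D z \<le> D x" by blast
    have "y \<in> {- Y..Y}" unfolding Y_def by auto
    hence xy: "D y \<le> D x" using x(2) by blast
    have xmax: "D z \<le> D x" for z
    proof (cases "z \<in> {- Y..Y}")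
      case False
      hence "X \<le> \<bar>z\<bar>" by (auto simp: Y_def)
      hence "cmod (P z) < D y" by (rule X)
      moreover have "D z \<le> cmod (P z)" using M0 q0[of z] by (simp add: D_def)
      ultimately show ?thesis using xy by linarith
    qed (rule x(2))
    have Dx: "D x > 0" using xy Dy by simp
    hence xR: "R \<le> \<bar>x\<bar>" using D0[of x] by force
    have "f' (U x) * D x < 0" using g_tail[OF xR] \<delta>_pos Dx by (simp add: mult_neg_pos)
    moreover have "Re \<omega> * cmod (P x) \<ge> 0" using \<omega> by simp
    ultimately show False using no_max[of x] xmax xR R_pos by force
  qed
  have "M > 0"
  proof (rule ccontr)
    assume "\<not> M > 0"
    hence "M = 0" using M0 by simp
    thus False using Dle[of z] Pz by (simp add: D_def)
  qed
  hence Pz0: "cmod (P z0) > 0" using q0[of z0] by (auto simp: M_def zero_less_divide_iff)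
  show False
  proof (cases "z0 = 0")
    case False
    have "Re \<omega> * cmod (P z0) - f' (U z0) * D z0 > 0" using \<omega> Pz0 Dz0 by simp
    thus False using no_max[OF False] Dle Dz0 by simp
  next
    case True
    have max: "T 0 x \<le> T 0 0" for x using TD[of 0 x] Dle[of x] TDy[of 0] Dz0 True by simp
    have Tc: "continuous_on UNIV (T 0)" unfolding T_def by (intro continuous_intros Pc q_cont')
    have T'c: "isCont (T' a 0) 0" for a
    proof -
      have "continuous_on UNIV (T' a 0)"
        unfolding T'_def by (intro continuous_intros Sc q_cont' continuous_on_compose2[OF f_cont[of UNIV] U_cont]) auto
      thus ?thesis by (simp add: continuous_on_eq_continuous_at)
    qed
    have TA: "(T 0 has_real_derivative T' A 0 x) (at x)" if "x < 0" for x using Td[of x 0] that by simp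
    have TB: "(T 0 has_real_derivative T' B 0 x) (at x)" if "x > 0" for x using Td[of x 0] that by simp
    have "T' A 0 0 \<ge> 0" by (rule left_derivative_nonneg_at_max[OF Tc T'c TA max])
    moreover have "T' B 0 0 \<le> 0" by (rule right_derivative_nonpos_at_max[OF Tc T'c TB max])
    \<comment> \<open>\<open>S\<close> is continuous at 0, so only the jump of \<open>q'\<close> is
      left in the difference of the one-sided slopes.\<close>
    moreover have "T' A 0 0 - T' B 0 0 = M * ((A - B) * q 0)" by (simp add: T'_def algebra_simps)
    moreover have "M * ((A - B) * q 0) < 0" using \<open>M > 0\<close> AB q0[of 0] by (simp add: mult_pos_neg mult_neg_pos)
    ultimately show False by linarith
  qed
qed

section \<open>Stability and instability of the front\<close>

lemma reaction_flat: "reaction v l u = v * flat 1 u - l * u"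
  by (simp add: reaction_def activation_def flat_def)

lemma reaction_deriv_flat: "reaction_deriv v l u = v * flat [:0, 0, 1:] u - l"
  by (simp add: reaction_deriv_def flat_def power2_eq_square)

lemma reaction_has_derivative: "(reaction v l has_real_derivative reaction_deriv v l u) (at u)"
proof -
  have "pderiv 1 = (0 :: real poly)" using pderiv_1 by simp
  hence "(flat 1 has_real_derivative flat [:0, 0, 1:] u) (at u)" using flat_has_derivative[of 1 u] by simp
  thus ?thesis unfolding reaction_flat[abs_def] reaction_deriv_flat
    by (auto intro!: derivative_eq_intros)
qed

lemma reaction_deriv_continuous: "continuous_on UNIV (reaction_deriv v l)"
proof -
  have "continuous_on UNIV (flat P)" for P
    by (intro continuous_at_imp_continuous_on ballI DERIV_isCont[OF flat_has_derivative])
  thus ?thesis unfolding reaction_deriv_flat[abs_def] by (intro continuous_intros)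
qed

text \<open>The 2 comes from \<open>x\<^sup>2 * exp (- x) \<le> 2\<close> with
  \<open>x = 1 / u\<close>, by the quadratic Taylor bound for \<open>exp\<close>.\<close>

lemma reaction_deriv_bound:
  assumes "v \<in> {0..1}" "l > 0"
  shows "\<bar>reaction_deriv v l u\<bar> \<le> 2 + l"
proof -
  have "0 \<le> flat [:0, 0, 1:] u" by (simp add: flat_def)
  moreover have "flat [:0, 0, 1:] u \<le> 2"
  proof (cases "u > 0")
    case True
    define x where "x = 1 / u"
    have "1 + x + x\<^sup>2 / 2 \<le> exp x" using True by (intro exp_lower_Taylor_quadratic) (simp add: x_def)
    moreover have "0 \<le> x" using True by (simp add: x_def)
    ultimately have "x\<^sup>2 \<le> 2 * exp x" by linarith
    hence "x\<^sup>2 * exp (- x) \<le> 2 * exp x * exp (- x)" by (intro mult_right_mono) auto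
    thus ?thesis using True by (simp add: flat_def x_def power2_eq_square mult.assoc exp_add[symmetric])
  qed (simp add: flat_def)
  ultimately have "0 \<le> v * flat [:0, 0, 1:] u" "v * flat [:0, 0, 1:] u \<le> 1 * 2"
    using assms by (simp, intro mult_mono) auto
  thus ?thesis using assms unfolding reaction_deriv_flat by (simp add: abs_le_iff)
qed

lemma reaction_lipschitz:
  assumes "v \<in> {0..1}" "l > 0"
  shows "\<bar>reaction v l x - reaction v l y\<bar> \<le> (2 + l) * \<bar>x - y\<bar>"
proof -
  have "norm (reaction v l x - reaction v l y) \<le> (2 + l) * norm (x - y)"
    by (rule field_differentiable_bound[of UNIV _ "reaction_deriv v l"])
       (use reaction_deriv_bound[OF assms] in \<open>auto intro: reaction_has_derivative\<close>)
  thus ?thesis by simp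
qed

text \<open>The sign of \<open>reaction v l u\<close> for \<open>u > 0\<close> is that of \<open>v * exp (- 1 / u) / u - l\<close>, which is
  unimodal with its maximum at \<open>u = 1\<close>; hence \<open>u\<^sub>1 < 1 < u\<^sub>2\<close>.\<close>

lemma reaction_sign:
  assumes v: "v \<in> {0..1}" and l: "l > 0" and roots: "reaction v l u1 = 0" "reaction v l u2 = 0"
    and u: "0 < u1" "u1 < u2"
  shows "\<And>x. 0 < x \<Longrightarrow> x < u1 \<Longrightarrow> reaction v l x < 0"
    "\<And>x. u1 < x \<Longrightarrow> x < u2 \<Longrightarrow> reaction v l x > 0"
    "\<And>x. u2 < x \<Longrightarrow> reaction v l x < 0"
    "reaction_deriv v l u2 < 0"
proof -
  define h where "h x = v * exp (- (1 / x)) / x - l" for x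
  have fh: "reaction v l x = x * h x" if "x > 0" for x
    using that by (simp add: reaction_def activation_def h_def field_simps)
  have "v \<noteq> 0" using roots(1) u l by (auto simp: reaction_def)
  hence v0: "v > 0" using v by simp
  have hd: "(h has_real_derivative v * exp (- (1 / x)) * (1 - x) / x ^ 3) (at x)" if "x > 0" for x
    unfolding h_def using that
    by (auto intro!: derivative_eq_intros simp: field_simps power2_eq_square power3_eq_cube)
  have hc: "continuous_on {x..y} h" if "x > 0" for x y
    using that by (intro continuous_at_imp_continuous_on ballI DERIV_isCont[OF hd]) auto
  have inc: "h x < h y" if "0 < x" "x < y" "y \<le> 1" for x y
  proof (rule DERIV_pos_imp_increasing_open[OF that(2) _ hc[OF that(1)]])
    fix z assume "x < z" "z < y"
    thus "\<exists>d. (h has_real_derivative d) (at z) \<and> d > 0"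
      using that v0 by (intro exI[of _ "v * exp (- (1 / z)) * (1 - z) / z ^ 3"] conjI hd) auto
  qed
  have dec: "h y < h x" if "1 \<le> x" "x < y" for x y
  proof -
    have "- h x < - h y"
    proof (rule DERIV_pos_imp_increasing_open[OF that(2), where f = "\<lambda>x. - h x"])
      show "continuous_on {x..y} (\<lambda>x. - h x)" using that by (intro continuous_intros hc) auto
      fix z assume "x < z" "z < y"
      thus "\<exists>d. ((\<lambda>x. - h x) has_real_derivative d) (at z) \<and> d > 0"
        using that v0
        by (intro exI[of _ "- (v * exp (- (1 / z)) * (1 - z) / z ^ 3)"] conjI DERIV_minus hd)
           (auto simp: divide_neg_pos mult_pos_neg)
    qed
    thus ?thesis by simp
  qed
  have h0: "h u1 = 0" "h u2 = 0" using roots fh[of u1] fh[of u2] u by auto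
  have u1: "u1 < 1" using dec[of u1 u2] u h0 by force
  have u2: "u2 > 1" using inc[of u1 u2] u h0 by force
  show "reaction v l x < 0" if "0 < x" "x < u1" for x
    using inc[of x u1] u1 h0 that fh[of x] by (simp add: mult_pos_neg)
  show "reaction v l x > 0" if "u1 < x" "x < u2" for x
    using inc[of u1 x] dec[of x u2] h0 that fh[of x] u by (cases "x \<le> 1") auto
  show "reaction v l x < 0" if "u2 < x" for x
    using dec[of u2 x] u2 h0 that fh[of x] u by (simp add: mult_pos_neg)
  \<comment> \<open>The root equation eliminates the exponential from the derivative, which becomes
    \<open>l / u2 - l\<close>, negative since \<open>u2 > 1\<close>.\<close>
  have "v * exp (- 1 / u2) = l * u2" using roots(2) u by (simp add: reaction_def activation_def)
  hence "reaction_deriv v l u2 = l / u2 - l"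
    using u by (simp add: reaction_deriv_def power2_eq_square)
  also have "\<dots> < 0" using u2 l by (simp add: field_simps)
  finally show "reaction_deriv v l u2 < 0" .
qed

lemma phase_field_componentD:
  assumes "solves_on (phase_field v l c a) (\<lambda>z. (U z, deriv U z)) I" "open I" "z \<in> I"
  shows "(deriv U has_real_derivative - (c - a) * deriv U z - reaction v l (U z)) (at z)"
proof -
  have "((\<lambda>z. (U z, deriv U z)) has_vector_derivative phase_field v l c a (U z, deriv U z)) (at z)"
    using assms(1,3) unfolding solves_on_def at_within_open[OF assms(3,2), symmetric] by blast
  from bounded_linear.has_vector_derivative[OF bounded_linear_snd this]
  show ?thesis by (simp add: phase_field_def has_real_derivative_iff_has_vector_derivative)
qed

lemma front_smooth_bistable:
  assumes "l > 0" "v \<in> {0..1}" "reaction v l u1 = 0" "reaction v l u2 = 0" "0 < u1" "u1 < u2"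
    and front: "is_front v l \<alpha> \<beta> c u2 P U"
  shows "smooth_bistable_front (reaction v l) u1 u2 (c - \<alpha>) (c - \<beta>) (2 + l) U (deriv U) (reaction_deriv v l) (2 + l)"
proof
  note sgn = reaction_sign[OF assms(2,1,3-6)]
  have front': "U C1_differentiable_on UNIV"
    "solves_on (phase_field v l c \<alpha>) (\<lambda>z. (U z, deriv U z)) {..<0}"
    "solves_on (phase_field v l c \<beta>) (\<lambda>z. (U z, deriv U z)) {0<..}"
    "(U \<longlongrightarrow> 0) at_bot" "(U \<longlongrightarrow> u2) at_top"
    using front by (simp_all add: is_front_def)
  obtain D where D: "\<And>z. (U has_vector_derivative D z) (at z)" "continuous_on UNIV D"
    using front'(1) unfolding C1_differentiable_on_def by blast
  have DU: "deriv U = D"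
    using D(1) by (auto intro!: DERIV_imp_deriv simp: has_real_derivative_iff_has_vector_derivative)
  show "(U has_real_derivative deriv U z) (at z)" for z
    using D(1) by (simp add: DU has_real_derivative_iff_has_vector_derivative)
  show "continuous_on UNIV (deriv U)" using D(2) by (simp add: DU)
  show "(deriv U has_real_derivative - (c - \<alpha>) * deriv U z - reaction v l (U z)) (at z)" if "z < 0" for z
    by (rule phase_field_componentD[OF front'(2)]) (use that in auto)
  show "(deriv U has_real_derivative - (c - \<beta>) * deriv U z - reaction v l (U z)) (at z)" if "z > 0" for z
    by (rule phase_field_componentD[OF front'(3)]) (use that in auto)
  show "reaction v l x > 0" if "x < 0" for x
    using that assms(1) by (simp add: reaction_def activation_def mult_pos_neg)
  show "reaction v l 0 = 0" by (simp add: reaction_def activation_def)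
  show "reaction_deriv v l 0 < 0" using assms(1) by (simp add: reaction_deriv_def)
  show "(reaction v l has_real_derivative reaction_deriv v l x) (at x)" for x
    by (rule reaction_has_derivative)
qed (use assms front reaction_sign[OF assms(2,1,3-6)] reaction_lipschitz[OF assms(2,1)]
      reaction_deriv_bound[OF assms(2,1)] reaction_deriv_continuous in \<open>auto simp: is_front_def\<close>)

text \<open>On \<open>X\<close> the increments of \<open>S\<close> are those of a primitive of the
  continuous function \<open>G\<close>, so an identity almost everywhere becomes a classical
  derivative.\<close>

lemma has_vector_derivative_from_increments:
  fixes S G :: "real \<Rightarrow> complex"
  assumes X: "open X" "is_interval X" "z \<in> X" and Gc: "continuous_on UNIV G"
    and S: "\<And>a b. a \<le> b \<Longrightarrow> S b - S a = (LINT x:{a..b}|lborel. p2 x)"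
    and p2: "\<And>a b. set_integrable lborel {a..b} p2" "AE x in lborel. x \<in> X \<longrightarrow> p2 x = G x"
  shows "(S has_vector_derivative G z) (at z)"
proof -
  obtain F where F: "\<And>x. (F has_vector_derivative G x) (at x)"
    using continuous_antiderivative[OF Gc] by blast
  have inc: "S b - S a = F b - F a" if "a \<le> b" "a \<in> X" "b \<in> X" for a b
  proof -
    have sub: "x \<in> X" if "x \<in> {a..b}" for x
      using mem_is_interval_1_I[OF X(2) \<open>a \<in> X\<close> \<open>b \<in> X\<close>] that by simp
    have "S b - S a = (LINT x|lborel. indicator {a..b} x *\<^sub>R p2 x)"
      using S[OF that(1)] by (simp add: set_lebesgue_integral_def)
    also have "\<dots> = (LINT x|lborel. indicator {a..b} x *\<^sub>R G x)"
    proof (rule integral_cong_AE)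
      show "(\<lambda>x. indicator {a..b} x *\<^sub>R p2 x) \<in> borel_measurable lborel"
        using p2(1)[of a b] by (auto simp: set_integrable_def dest: borel_measurable_integrable)
      show "(\<lambda>x. indicator {a..b} x *\<^sub>R G x) \<in> borel_measurable lborel"
        using borel_measurable_continuous_onI[OF Gc] by measurable
      show "AE x in lborel. indicator {a..b} x *\<^sub>R p2 x = indicator {a..b} x *\<^sub>R G x"
        using p2(2) by eventually_elim (use sub in \<open>auto split: split_indicator\<close>)
    qed
    also have "\<dots> = F b - F a"
      by (rule integral_FTC_atLeastAtMost[OF that(1)])
         (auto intro: has_vector_derivative_at_within[OF F] continuous_on_subset[OF Gc])
    finally show ?thesis .
  qed
  have eq: "F x + (S z - F z) = S x" if "x \<in> X" for x
    using inc[of x z] inc[of z x] that X(3) by (cases "x \<le> z") (auto simp: algebra_simps)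
  have "((\<lambda>x. F x + (S z - F z)) has_vector_derivative G z) (at z)"
    using F by (auto intro!: derivative_eq_intros)
  thus ?thesis
    by (rule has_vector_derivative_transform_within_open[OF _ X(1,3)]) (rule eq)
qed

lemma front_stable_if_friction_increases:
  assumes front: "smooth_bistable_front (reaction v l) u1 u2 (c - \<alpha>) (c - \<beta>) L U (deriv U) (reaction_deriv v l) K"
    and "\<alpha> > \<beta>"
  shows "front_stable v l \<alpha> \<beta> c U"
  unfolding front_stable_def
proof (intro notI, elim exE conjE)
  interpret smooth_bistable_front "reaction v l" u1 u2 "c - \<alpha>" "c - \<beta>" L U "deriv U" "reaction_deriv v l" K
    by (rule front)
  fix \<omega> :: complex assume eig: "is_eigenvalue v l \<alpha> \<beta> c U \<omega>" and \<omega>: "Re \<omega> > 0"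
  obtain p p1 p2 where H: "H2_derivs p p1 p2" and nz: "\<not> (AE z in lborel. p z = 0)"
    and eq: "AE z in lborel. p2 z + of_real (c - wind \<alpha> \<beta> z) * p1 z + of_real (reaction_deriv v l (U z)) * p z = \<omega> * p z"
    using eig unfolding is_eigenvalue_def by blast
  obtain P S where P: "\<And>x. (P has_vector_derivative S x) (at x)" "continuous_on UNIV S"
    "\<And>a b. a \<le> b \<Longrightarrow> S b - S a = (LINT x:{a..b}|lborel. p2 x)"
    "AE x in lborel. p x = P x" "AE x in lborel. p1 x = S x"
    by (rule H2_regular_representative[OF H]) blast
  have Pc: "continuous_on UNIV P"
    by (intro continuous_at_imp_continuous_on ballI has_vector_derivative_continuous[OF P(1)])
  \<comment> \<open>The friction is frozen at the constant \<open>a\<close> to make the right-hand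
    side continuous on the whole line; it agrees with \<open>p2\<close> almost everywhere on the
    matching half-line.\<close>
  define G where "G a z = \<omega> * P z - reaction_deriv v l (U z) *\<^sub>R P z - a *\<^sub>R S z" for a z
  have Gc: "continuous_on UNIV (G a)" for a
    unfolding G_def
    by (intro continuous_intros Pc P(2) continuous_on_compose2[OF f'_cont U_cont]) auto
  have p2i: "set_integrable lborel {a..b} p2" for a b
    using H by (simp add: H2_derivs_def weak_derivative_def)
  have p2: "AE z in lborel. p2 z = G (c - wind \<alpha> \<beta> z) z"
    using eq P(4,5) by eventually_elim (simp add: G_def scaleR_conv_of_real algebra_simps)
  have S: "(S has_vector_derivative \<omega> * P z - reaction_deriv v l (U z) *\<^sub>R P z
      - (if z < 0 then c - \<alpha> else c - \<beta>) *\<^sub>R S z) (at z)" if "z \<noteq> 0" for z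
  proof (cases "z < 0")
    case True
    have "(S has_vector_derivative G (c - \<alpha>) z) (at z)"
    proof (rule has_vector_derivative_from_increments[of "{..<0}", OF _ _ _ Gc P(3) p2i])
      show "AE x in lborel. x \<in> {..<0} \<longrightarrow> p2 x = G (c - \<alpha>) x"
        using p2 by eventually_elim (simp add: wind_def)
    qed (use True in \<open>auto simp: is_interval_1\<close>)
    thus ?thesis using True by (simp add: G_def)
  next
    case False
    have "(S has_vector_derivative G (c - \<beta>) z) (at z)"
    proof (rule has_vector_derivative_from_increments[of "{0<..}", OF _ _ _ Gc P(3) p2i])
      show "AE x in lborel. x \<in> {0<..} \<longrightarrow> p2 x = G (c - \<beta>) x"
        using p2 by eventually_elim (simp add: wind_def)
    qed (use False that in \<open>auto simp: is_interval_1\<close>)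
    thus ?thesis using False by (simp add: G_def)
  qed
  have "integrable lborel (\<lambda>z. (cmod (p z))\<^sup>2)" and pm: "p \<in> borel_measurable lborel"
    using H by (auto simp: H2_derivs_def square_integrable_def)
  moreover have "integrable lborel (\<lambda>z. (cmod (p z))\<^sup>2) \<longleftrightarrow> integrable lborel (\<lambda>z. (cmod (P z))\<^sup>2)"
  proof (rule integrable_cong_AE)
    show "(\<lambda>z. (cmod (p z))\<^sup>2) \<in> borel_measurable lborel" using pm by measurable
    show "(\<lambda>z. (cmod (P z))\<^sup>2) \<in> borel_measurable lborel" using borel_measurable_continuous_onI[OF Pc] by measurable
    show "AE z in lborel. (cmod (p z))\<^sup>2 = (cmod (P z))\<^sup>2" using P(4) by eventually_elim simp
  qed
  ultimately have int: "integrable lborel (\<lambda>z. (cmod (P z))\<^sup>2)" by simp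
  have "P z = 0" for z
    by (rule no_unstable_mode[OF _ \<omega> P(1,2) S int]) (use assms(2) in auto)
  hence "AE z in lborel. p z = 0" using P(4) by simp
  thus False using nz by simp
qed

lemma front_unstable_if_friction_decreases:
  assumes front: "smooth_bistable_front (reaction v l) u1 u2 (c - \<alpha>) (c - \<beta>) L U (deriv U) (reaction_deriv v l) K"
    and "\<alpha> < \<beta>"
  shows "front_unstable v l \<alpha> \<beta> c U"
proof -
  interpret smooth_bistable_front "reaction v l" u1 u2 "c - \<alpha>" "c - \<beta>" L U "deriv U" "reaction_deriv v l" K
    by (rule front)
  obtain R \<delta> where "sturm_liouville (\<lambda>z. reaction_deriv v l (U z)) R \<delta> K" using tails by blast
  then interpret sturm_liouville "c - \<alpha>" "c - \<beta>" "\<lambda>z. reaction_deriv v l (U z)" R \<delta> K .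
  have "c - \<beta> < c - \<alpha>" using assms(2) by simp
  then obtain \<omega> p t where p: "\<omega> > 0" "sol \<omega> p t" "\<And>z. p z > 0" "\<And>z. p z \<le> 1"
    using unstable_mode by metis
  have H: "H2_derivs (\<lambda>z. of_real (p z)) (\<lambda>z. of_real (t z / \<rho> z))
     (\<lambda>z. of_real ((\<omega> - reaction_deriv v l (U z)) * p z - (c - wind \<alpha> \<beta> z) * (t z / \<rho> z)))"
    by (rule H2_derivs_of_positive_solution[OF p(2) _ p(3,4)]) (use p(1) in \<open>auto simp: wind_def\<close>)
  have "\<not> (AE z in lborel. complex_of_real (p z) = 0)"
  proof
    assume "AE z in lborel. complex_of_real (p z) = 0"
    hence "AE z in (lborel :: real measure). False" by eventually_elim (metis of_real_eq_0_iff p(3) less_irrefl)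
    hence "emeasure lborel (UNIV :: real set) = 0" by (simp add: AE_iff_measurable[of UNIV])
    thus False by simp
  qed
  \<comment> \<open>The equation holds at every point, even at 0, because the second derivative was
    chosen with this very coefficient.\<close>
  moreover have "of_real ((\<omega> - reaction_deriv v l (U z)) * p z - (c - wind \<alpha> \<beta> z) * (t z / \<rho> z)) +
      of_real (c - wind \<alpha> \<beta> z) * of_real (t z / \<rho> z) + of_real (reaction_deriv v l (U z)) * of_real (p z) =
      complex_of_real \<omega> * of_real (p z)" for z
    unfolding of_real_mult[symmetric] of_real_add[symmetric]
    by (rule arg_cong[where f = of_real]) (simp add: algebra_simps)
  ultimately have "is_eigenvalue v l \<alpha> \<beta> c U (of_real \<omega>)"
    unfolding is_eigenvalue_def using H by blast
  thus ?thesis unfolding front_unstable_def using p(1) by force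
qed

theorem proposition2:
  fixes l v u\<^sub>1 u\<^sub>2 \<alpha> \<beta> c :: real and P :: "real \<times> real" and U :: "real \<Rightarrow> real"
  assumes "l > 0" and "v \<in> {0..1}"
    and "{u. reaction v l u = 0} = {0, u\<^sub>1, u\<^sub>2}" and "0 < u\<^sub>1" and "u\<^sub>1 < u\<^sub>2"
    and "\<alpha> \<noteq> \<beta>"
    and "P \<in> unstable_manifold (phase_field v l c \<alpha>) (0, 0) \<inter>
             stable_manifold (phase_field v l c \<beta>) (u\<^sub>2, 0)"
    and "is_front v l \<alpha> \<beta> c u\<^sub>2 P U"
  shows "(\<alpha> > \<beta> \<longrightarrow> front_stable v l \<alpha> \<beta> c U) \<and>
         (\<alpha> < \<beta> \<longrightarrow> front_unstable v l \<alpha> \<beta> c U)"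
proof -
  have "reaction v l u\<^sub>1 = 0" "reaction v l u\<^sub>2 = 0" using assms(3) by blast+
  from front_smooth_bistable[OF assms(1,2) this assms(4,5,8)]
  show ?thesis
    using front_stable_if_friction_increases front_unstable_if_friction_decreases by blast
qed

end
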